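(* Let $n\ge 2$, let $\Omega\subset\mathbb{R}^n$ be open and bounded, let $0<s\le t<1$, $1<p\le q<\infty$, $\Lambda\ge 1$, and let the kernels $K_{sp},K_{tq}$ and the coefficient $a$ be as in the context. Assume moreover that there are $\alpha\in(0,1]$ and $[a]_\alpha\ge 0$ with $$|a(x_1,y_1)-a(x_2,y_2)|\le [a]_\alpha(|x_1-x_2|+|y_1-y_2|)^\alpha\quad\text{for all }(x_1,y_1),(x_2,y_2)\in\mathbb{R}^n\times\mathbb{R}^n,$$ that $\alpha<tq\le sp+\alpha$, and that $a(x,y)\ge\lambda$ for all $(x,y)\in\mathbb{R}^n\times\mathbb{R}^n$ with some constant $\lambda>0$. Let $u\in\mathcal{A}(\Omega)\cap L^{p-1}_{sp}(\mathbb{R}^n)\cap L^{q-1}_{a,tq}(\Omega,\mathbb{R}^n)$ be a locally bounded minimizer of $\mathcal{F}(\cdot;\Omega)$ that is nonnegative in a ball $B_{4R}(x_0)\subset\Omega$ with $R\le 1$. Then there exists a constant $\gamma\in(0,1)$, depending only on $\mathbf{data}(B_{4R}(x_0))$ and $\lambda$, such that $$\inf_{B_R(x_0)}u+h_{4R}^{-1}\big(\mathrm{Tail}(u_-;x_0,4R)+\mathrm{Tail}_a(u_-;x_0,4R)\big)\ge\gamma\min\left\{\mathrm{Tail}_p(u_+;x_0,2R),\left(a^-_{4R}\right)^{\frac{-1}{q-1}}\mathrm{Tail}_q(u_+;x_0,2R)\right\},$$ where $$\mathrm{Tail}_p(u_+;x_0,r)=\left(r^{sp}\int_{\mathbb{R}^n\setminus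 B_r(x_0)}\frac{u_+^{p-1}(x)}{|x-x_0|^{n+sp}}\,dx\right)^{\frac1{p-1}},\qquad \mathrm{Tail}_q(u_+;x_0,r)=\left(r^{tq}\int_{\mathbb{R}^n\setminus B_r(x_0)}\frac{u_+^{q-1}(x)}{|x-x_0|^{n+tq}}\,dx\right)^{\frac1{q-1}}.$$
   Context: Setting. $B_r(x_0)=\{x\in\mathbb{R}^n:|x-x_0|<r\}$. The kernels $K_{sp},K_{tq}:\mathbb{R}^n\times\mathbb{R}^n\to[0,\infty)$ are measurable and satisfy $$\frac{\Lambda^{-1}}{|x-y|^{n+sp}}\le K_{sp}(x,y)\le\frac{\Lambda}{|x-y|^{n+sp}},\qquad \frac{\Lambda^{-1}}{|x-y|^{n+tq}}\le K_{tq}(x,y)\le\frac{\Lambda}{|x-y|^{n+tq}}.$$ The coefficient $a:\mathbb{R}^n\times\mathbb{R}^n\to\mathbb{R}$ is measurable with $0\le a(x,y)=a(y,x)$. Put $\mathcal{C}_\Omega=(\mathbb{R}^n\times\mathbb{R}^n)\setminus((\mathbb{R}^n\setminus\Omega)\times(\mathbb{R}^n\setminus\Omega))$ and $$\mathcal{F}(u;\Omega)=\iint_{\mathcal{C}_\Omega}\big[|u(x)-u(y)|^pK_{sp}(x,y)+a(x,y)|u(x)-u(y)|^qK_{tq}(x,y)\big]\,dx\,dy.$$ Function spaces and minimizers (all functions measurable). $\mathcal{A}(\Omega)$ is the set of $u:\mathbb{R}^n\to\mathbb{R}$ with $u|_\Omega\in L^p(\Omega)$ and $$\iint_{\mathcal{C}_\Omega}\frac{|u(x)-u(y)|^p}{|x-y|^{n+sp}}+a(x,y)\frac{|u(x)-u(y)|^q}{|x-y|^{n+tq}}\,dx\,dy<\infty.$$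 $L^{p-1}_{sp}(\mathbb{R}^n)$ is the set of $u$ with $\int_{\mathbb{R}^n}\frac{|u(x)|^{p-1}}{(1+|x|)^{n+sp}}\,dx<\infty$; $L^{q-1}_{a,tq}(\Omega,\mathbb{R}^n)$ is the set of $u$ with $\sup_{x\in\Omega}\int_{\mathbb{R}^n}a(x,y)\frac{|u(y)|^{q-1}}{(1+|y|)^{n+tq}}\,dy<\infty$. A function $u\in\mathcal{A}(\Omega)$ is a minimizer of $\mathcal{F}(\cdot;\Omega)$ if $\mathcal{F}(u;\Omega)\le\mathcal{F}(v;\Omega)$ for every $v\in\mathcal{A}(\Omega)$ with $v=u$ a.e. in $\mathbb{R}^n\setminus\Omega$. Locally bounded means locally bounded in $\Omega$. Pointwise inequalities, suprema and infima of $u$ are understood in the a.e./essential sense; $u_\pm=\max\{\pm u,0\}$. Further notation. $a_r^-=\inf_{B_r(x_0)\times B_r(x_0)}a(x,y)$; for $k\ge 0$, $h_r(k)=\frac{k^{p-1}}{r^{sp}}+a_r^-\frac{k^{q-1}}{r^{tq}}$, and $h_r^{-1}$ is the inverse of $h_r$ on $[0,\infty)$. $$\mathrm{Tail}(u_-;x_0,r)=\int_{\mathbb{R}^n\setminus B_r(x_0)}\frac{u_-^{p-1}(x)}{|x-x_0|^{n+sp}}\,dx,\qquad \mathrm{Tail}_a(u_-;x_0,r)=\sup_{y\in B_r(x_0)}\int_{\mathbb{R}^n\setminus B_r(x_0)}a(x,y)\frac{u_-^{q-1}(x)}{|x-x_0|^{n+tq}}\,dx.$$ For $D\subset\Omega$,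 $\mathbf{data}(D)$ is the list $n,p,q,s,t,\Lambda,\alpha,[a]_\alpha,\|u\|_{L^\infty(D)}$ if $sp\le n$, and $n,p,q,s,t,\Lambda,\alpha,[a]_\alpha,[u]_{W^{s,p}(D)}$ if $sp>n$, where $[u]_{W^{s,p}(D)}=\big(\int_D\int_D\frac{|u(x)-u(y)|^p}{|x-y|^{n+sp}}dxdy\big)^{1/p}$. Dependence on $\mathbf{data}(D)$ presupposes that the listed quantities are finite (in particular $u$ is bounded in $D$). *)

theory Defs
  imports "HOL-Probability.Essential_Supremum"
begin

text \<open>
  Measurable means Lebesgue measurable, and \<open>lebesgue\<close> on a product type is the (complete)
  Lebesgue measure of the product space. Integrals of nonnegative functions are
  \<open>ennreal\<close>-valued, so that finiteness is a genuine condition.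
\<close>

text \<open>
  The two-sided bound is required off the diagonal only: for \<open>x = y\<close> the comparison function
  is infinite, whereas division by zero in HOL would force \<open>K x x = 0\<close>.
  The parameter \<open>\<sigma>\<close> stands for \<open>s * p\<close> or \<open>t * q\<close>.
\<close>

definition admissible_kernel ::
  "real \<Rightarrow> real \<Rightarrow> (real^'n \<Rightarrow> real^'n \<Rightarrow> real) \<Rightarrow> bool" where
  "admissible_kernel \<Lambda> \<sigma> K \<longleftrightarrow>
     case_prod K \<in> borel_measurable lebesgue \<and>
     (\<forall>x y. 0 \<le> K x y) \<and>
     (\<forall>x y. x \<noteq> y \<longrightarrow>
        inverse \<Lambda> / norm (x - y) powr (real CARD('n) + \<sigma>) \<le> K x y \<and>
        K x y \<le> \<Lambda> / norm (x - y) powr (real CARD('n) + \<sigma>))"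

definition admissible_coefficient :: "(real^'n \<Rightarrow> real^'n \<Rightarrow> real) \<Rightarrow> bool" where
  "admissible_coefficient a \<longleftrightarrow>
     case_prod a \<in> borel_measurable lebesgue \<and>
     (\<forall>x y. 0 \<le> a x y \<and> a x y = a y x)"

definition holder_coefficient ::
  "real \<Rightarrow> real \<Rightarrow> (real^'n \<Rightarrow> real^'n \<Rightarrow> real) \<Rightarrow> bool" where
  "holder_coefficient A \<alpha> a \<longleftrightarrow>
     (\<forall>x1 y1 x2 y2.
        \<bar>a x1 y1 - a x2 y2\<bar> \<le> A * (norm (x1 - x2) + norm (y1 - y2)) powr \<alpha>)"

definition C_set :: "(real^'n) set \<Rightarrow> ((real^'n) \<times> (real^'n)) set" where
  "C_set \<Omega> = UNIV - (- \<Omega>) \<times> (- \<Omega>)"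

definition energy ::
  "real \<Rightarrow> real \<Rightarrow> (real^'n \<Rightarrow> real^'n \<Rightarrow> real) \<Rightarrow> (real^'n \<Rightarrow> real^'n \<Rightarrow> real) \<Rightarrow>
   (real^'n \<Rightarrow> real^'n \<Rightarrow> real) \<Rightarrow> (real^'n \<Rightarrow> real) \<Rightarrow> (real^'n) set \<Rightarrow> ennreal" where
  "energy p q Ksp Ktq a u \<Omega> =
     (\<integral>\<^sup>+ z \<in> C_set \<Omega>. (case z of (x, y) \<Rightarrow>
        ennreal (\<bar>u x - u y\<bar> powr p * Ksp x y + a x y * \<bar>u x - u y\<bar> powr q * Ktq x y))
      \<partial>lebesgue)"

definition A_space ::
  "real \<Rightarrow> real \<Rightarrow> real \<Rightarrow> real \<Rightarrow> (real^'n \<Rightarrow> real^'n \<Rightarrow> real) \<Rightarrow> (real^'n) set \<Rightarrow>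
   (real^'n \<Rightarrow> real) set" where
  "A_space s t p q a \<Omega> =
     {u. u \<in> borel_measurable lebesgue \<and>
         (\<integral>\<^sup>+ x \<in> \<Omega>. ennreal (\<bar>u x\<bar> powr p) \<partial>lebesgue) < \<infinity> \<and>
         (\<integral>\<^sup>+ z \<in> C_set \<Omega>. (case z of (x, y) \<Rightarrow>
            ennreal (\<bar>u x - u y\<bar> powr p / norm (x - y) powr (real CARD('n) + s * p)
              + a x y * (\<bar>u x - u y\<bar> powr q / norm (x - y) powr (real CARD('n) + t * q))))
          \<partial>lebesgue) < \<infinity>}"

definition L_tail_space :: "real \<Rightarrow> real \<Rightarrow> (real^'n \<Rightarrow> real) set" where
  "L_tail_space s p =
     {u. u \<in> borel_measurable lebesgue \<and>
         (\<integral>\<^sup>+ x. ennreal (\<bar>u x\<bar> powr (p - 1) / (1 + norm x) powr (real CARD('n) + s * p))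
          \<partial>lebesgue) < \<infinity>}"

definition L_tail_space_coeff ::
  "real \<Rightarrow> real \<Rightarrow> (real^'n \<Rightarrow> real^'n \<Rightarrow> real) \<Rightarrow> (real^'n) set \<Rightarrow> (real^'n \<Rightarrow> real) set" where
  "L_tail_space_coeff t q a \<Omega> =
     {u. u \<in> borel_measurable lebesgue \<and>
         (SUP x\<in>\<Omega>. \<integral>\<^sup>+ y. ennreal (a x y *
            (\<bar>u y\<bar> powr (q - 1) / (1 + norm y) powr (real CARD('n) + t * q))) \<partial>lebesgue) < \<infinity>}"

definition is_minimizer ::
  "real \<Rightarrow> real \<Rightarrow> real \<Rightarrow> real \<Rightarrow> (real^'n \<Rightarrow> real^'n \<Rightarrow> real) \<Rightarrow> (real^'n \<Rightarrow> real^'n \<Rightarrow> real) \<Rightarrow>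
   (real^'n \<Rightarrow> real^'n \<Rightarrow> real) \<Rightarrow> (real^'n) set \<Rightarrow> (real^'n \<Rightarrow> real) \<Rightarrow> bool" where
  "is_minimizer s t p q Ksp Ktq a \<Omega> u \<longleftrightarrow>
     u \<in> A_space s t p q a \<Omega> \<and>
     (\<forall>v \<in> A_space s t p q a \<Omega>. (AE x in lebesgue. x \<notin> \<Omega> \<longrightarrow> v x = u x) \<longrightarrow>
        energy p q Ksp Ktq a u \<Omega> \<le> energy p q Ksp Ktq a v \<Omega>)"

definition locally_bounded_in :: "(real^'n) set \<Rightarrow> (real^'n \<Rightarrow> real) \<Rightarrow> bool" where
  "locally_bounded_in \<Omega> u \<longleftrightarrow>
     (\<forall>S. compact S \<and> S \<subseteq> \<Omega> \<longrightarrow> (\<exists>C. AE x in lebesgue. x \<in> S \<longrightarrow> \<bar>u x\<bar> \<le> C))"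

definition essinf_on :: "(real^'n) set \<Rightarrow> (real^'n \<Rightarrow> real) \<Rightarrow> ereal" where
  "essinf_on D u = - esssup (lebesgue_on D) (\<lambda>x. - ereal (u x))"

definition Linf_norm :: "(real^'n) set \<Rightarrow> (real^'n \<Rightarrow> real) \<Rightarrow> ereal" where
  "Linf_norm D u = esssup (lebesgue_on D) (\<lambda>x. ereal \<bar>u x\<bar>)"

definition gagliardo_energy ::
  "real \<Rightarrow> real \<Rightarrow> (real^'n) set \<Rightarrow> (real^'n \<Rightarrow> real) \<Rightarrow> ennreal" where
  "gagliardo_energy s p D u =
     (\<integral>\<^sup>+ z \<in> D \<times> D. (case z of (x, y) \<Rightarrow>
        ennreal (\<bar>u x - u y\<bar> powr p / norm (x - y) powr (real CARD('n) + s * p))) \<partial>lebesgue)"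

text \<open>
  \<open>data_entry s p D u M\<close>: the entry of \<open>data(D)\<close> that depends on \<open>u\<close> is finite and equals the
  real number \<open>M\<close>. This entry is the \<open>L\<^sup>\<infinity>\<close> norm if \<open>s p \<le> n\<close> and the \<open>W\<^sup>s\<^sup>,\<^sup>p\<close> seminorm if \<open>s p > n\<close>.
\<close>

definition data_entry ::
  "real \<Rightarrow> real \<Rightarrow> (real^'n) set \<Rightarrow> (real^'n \<Rightarrow> real) \<Rightarrow> real \<Rightarrow> bool" where
  "data_entry s p D u M \<longleftrightarrow>
     (if s * p \<le> real CARD('n) then Linf_norm D u = ereal M
      else gagliardo_energy s p D u < \<infinity> \<and>
           enn2real (gagliardo_energy s p D u) powr (1 / p) = M)"

definition a_minus :: "(real^'n \<Rightarrow> real^'n \<Rightarrow> real) \<Rightarrow> real^'n \<Rightarrow> real \<Rightarrow> real" where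
  "a_minus a x0 r = (INF (x, y) \<in> ball x0 r \<times> ball x0 r. a x y)"

definition h_fun ::
  "real \<Rightarrow> real \<Rightarrow> real \<Rightarrow> real \<Rightarrow> (real^'n \<Rightarrow> real^'n \<Rightarrow> real) \<Rightarrow> real^'n \<Rightarrow> real \<Rightarrow> real \<Rightarrow> real" where
  "h_fun s t p q a x0 r k =
     k powr (p - 1) / r powr (s * p) + a_minus a x0 r * (k powr (q - 1) / r powr (t * q))"

definition h_inv ::
  "real \<Rightarrow> real \<Rightarrow> real \<Rightarrow> real \<Rightarrow> (real^'n \<Rightarrow> real^'n \<Rightarrow> real) \<Rightarrow> real^'n \<Rightarrow> real \<Rightarrow> real \<Rightarrow> real" where
  "h_inv s t p q a x0 r = the_inv_into {0..} (h_fun s t p q a x0 r)"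

definition pos_part :: "(real^'n \<Rightarrow> real) \<Rightarrow> real^'n \<Rightarrow> real" where
  "pos_part u x = max (u x) 0"

definition neg_part :: "(real^'n \<Rightarrow> real) \<Rightarrow> real^'n \<Rightarrow> real" where
  "neg_part u x = max (- u x) 0"

definition Tail :: "real \<Rightarrow> real \<Rightarrow> (real^'n \<Rightarrow> real) \<Rightarrow> real^'n \<Rightarrow> real \<Rightarrow> ennreal" where
  "Tail s p w x0 r =
     (\<integral>\<^sup>+ x \<in> - ball x0 r.
        ennreal (w x powr (p - 1) / norm (x - x0) powr (real CARD('n) + s * p)) \<partial>lebesgue)"

definition Tail_a ::
  "real \<Rightarrow> real \<Rightarrow> (real^'n \<Rightarrow> real^'n \<Rightarrow> real) \<Rightarrow> (real^'n \<Rightarrow> real) \<Rightarrow> real^'n \<Rightarrow> real \<Rightarrow> ennreal" where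
  "Tail_a t q a w x0 r =
     (SUP y\<in>ball x0 r. \<integral>\<^sup>+ x \<in> - ball x0 r.
        ennreal (a x y * (w x powr (q - 1) / norm (x - x0) powr (real CARD('n) + t * q)))
        \<partial>lebesgue)"

text \<open>
  \<open>Tail_root s p\<close> is \<open>Tail\<^sub>p\<close> and \<open>Tail_root t q\<close> is \<open>Tail\<^sub>q\<close>.

  Tails are turned into real numbers by \<open>enn2real\<close>, which sends \<open>\<infinity>\<close> to \<open>0\<close>. This never happens
  if \<open>u\<close> is in \<open>L_tail_space s p \<inter> L_tail_space_coeff t q a \<Omega>\<close>, the symmetric coefficient \<open>a\<close> has
  a positive lower bound and the ball lies in \<open>\<Omega>\<close>: off \<open>ball x0 r\<close> the weights \<open>norm (x - x0)\<close>
  and \<open>1 + norm x\<close> are comparable, and the lower bound on \<open>a\<close> makes the unweighted integral in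
  \<open>Tail_root t q\<close> finite.
\<close>

definition Tail_root :: "real \<Rightarrow> real \<Rightarrow> (real^'n \<Rightarrow> real) \<Rightarrow> real^'n \<Rightarrow> real \<Rightarrow> real" where
  "Tail_root s p w x0 r =
     (r powr (s * p) * enn2real (Tail s p w x0 r)) powr (1 / (p - 1))"

end

theory Submission
  imports Defs
begin

text \<open>
  Let \<open>u\<close> be a minimizer that is nonnegative in the ball \<open>B(4R)\<close> around \<open>x0\<close>, let \<open>\<psi>\<close> be an obstacle with
  \<open>0 \<le> \<psi> \<le> k\<close>, Lipschitz constant \<open>k L / R\<close> and support in \<open>B(3R)\<close>, and let
  \<open>E\<close> be the part of \<open>B(3R)\<close> where \<open>u < \<psi>\<close>. Compare \<open>u\<close> with
  the competitor \<open>v\<close> that equals \<open>\<psi>\<close> on \<open>E\<close> and \<open>u\<close> elsewhere. For \<open>x\<close> in \<open>E\<close> the pair \<open>(x, y)\<close> costs at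
  most a multiple of \<open>k\<^sup>r min(1, L |x - y| / R)\<^sup>r\<close>, by the Lipschitz bound, and of
  \<open>k u\<^sub>-(y)\<^sup>r\<^sup>-\<^sup>1\<close> (with \<open>r\<close> equal to \<open>p\<close> or \<open>q\<close>). If \<open>u(y) \<ge> \<psi>(x)\<close>, then the pair even gains
  \<open>(\<psi>(x) - u(x)) (u(y) - u(x))\<^sup>r\<^sup>-\<^sup>1\<close>, because \<open>v(x)\<close> is closer to \<open>u(y)\<close> than \<open>u(x)\<close> is. Minimality
  says that the total gain is at most a multiple of the total cost (\<open>total_gain_le\<close>).
  
  Since \<open>a\<close> is Hoelder continuous, bounded below by \<open>\<lambda> > 0\<close>, and \<open>R \<le> 1\<close>, the coefficient \<open>a(x, y)\<close> is at
  most a multiple of its infimum over \<open>B(4R) \<times> B(4R)\<close>, up to a growth of order \<open>\<alpha> < tq\<close> in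
  \<open>|x - y| / R\<close> that the kernel absorbs (\<open>a_upper\<close>). Hence one point of \<open>E\<close> costs at most
  \<open>C L\<^sup>q k h(k)\<close> as soon as the tails of \<open>u\<^sub>-\<close> are at most \<open>h(k)\<close>, and the cost is proportional to the
  measure of \<open>E\<close> (\<open>level_set_bound\<close>).
  
  Take \<open>k\<close> to be a small multiple of the minimum on the right-hand side of the theorem. If
  \<open>k \<le> h\<^sup>-\<^sup>1(tails of u\<^sub>-)\<close>, there is nothing to prove. Otherwise the inequality is used twice.
  
  \<^item> With \<open>\<psi> = k\<close> on \<open>B(2R)\<close>, the far points, where \<open>u\<^sub>+\<close> is large, contribute to the gain a large
    multiple of \<open>k h(k)\<close> for each \<open>x\<close> in \<open>B(2R)\<close> with \<open>u(x) < k/2\<close>. So \<open>{u < k/2}\<close> occupies only a small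
    fraction of \<open>B(2R)\<close> (\<open>initial_smallness\<close>).
  
  \<^item> De Giorgi's iteration then passes from \<open>k/2\<close> and \<open>B(2R)\<close> to \<open>k/4\<close> and \<open>B(R)\<close> through sublevel sets
    \<open>A\<^sub>j\<close>. The part of the Sobolev inequality is played by the kernel itself: if the measure of \<open>A\<^sub>j\<close> is at most half
    that of a ball of radius \<open>\<rho>\<close>, then a point of \<open>A\<^sub>j\<^sub>+\<^sub>1\<close> sees points outside \<open>A\<^sub>j\<close> within distance \<open>\<rho>\<close>, where the kernel is
    large. The gain from these near points yields \<open>|A\<^sub>j\<^sub>+\<^sub>1| \<le> C 4\<^sup>j\<^sup>q (\<rho>/R)\<^sup>s\<^sup>p |A\<^sub>j|\<close>
    (\<open>sublevel_step\<close>), and a geometric choice of \<open>\<rho>\<close> makes the measures tend to \<open>0\<close>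
    (\<open>lower_bound_AE\<close>). Therefore \<open>u \<ge> k/4\<close> almost everywhere in \<open>B(R)\<close>.
\<close>

section \<open>Convexity inequalities for powers\<close>

text \<open>
  The gain of a pair when \<open>a\<close> is raised to \<open>b\<close> below a third value \<open>c\<close>. Its factor
  \<open>(c - a) powr (r - 1)\<close> is at least \<open>(b - a) powr (r - 1)\<close>, which serves for near points, and it grows
  with \<open>c\<close> like the integrand of a tail, which serves for far points.
\<close>
lemma powr_gain:
  fixes a b c r :: real
  assumes "1 \<le> r" "a < b" "b \<le> c"
  shows "(c - b) powr r + (b - a) * (c - a) powr (r - 1) \<le> (c - a) powr r"
proof -
  have split: "x powr r = x * x powr (r - 1)" if "0 \<le> x" for x :: real
    using that powr_mult_base[of x "r - 1"] by simp
  have "(c - b) powr r = (c - b) * (c - b) powr (r - 1)"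
    using assms by (intro split) simp
  also have "\<dots> \<le> (c - b) * (c - a) powr (r - 1)"
    using assms by (intro mult_left_mono powr_mono2) auto
  finally have "(c - b) powr r + (b - a) * (c - a) powr (r - 1)
      \<le> (c - a) * (c - a) powr (r - 1)"
    by (simp add: algebra_simps)
  with split[of "c - a"] assms show ?thesis by simp
qed

lemma powr_add_le:
  fixes b m e :: real
  assumes "0 \<le> b" "0 \<le> m" "0 \<le> e"
  shows "(b + m) powr e \<le> 2 powr e * (b powr e + m powr e)"
proof -
  have "(b + m) powr e \<le> (2 * max b m) powr e"
    using assms by (intro powr_mono2) auto
  also have "\<dots> = 2 powr e * max b m powr e"
    using assms by (simp add: powr_mult)
  also have "max b m powr e \<le> b powr e + m powr e"
    by (auto simp: max_def)
  finally show ?thesis by simp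
qed

text \<open>
  Raising a value to \<open>b \<le> k\<close> against a partner at \<open>- m\<close> costs \<open>r b (b + m)\<^sup>r\<^sup>-\<^sup>1\<close> by the mean value
  theorem. Since this is linear in \<open>b\<close>, only the power \<open>r - 1\<close> of \<open>m\<close> occurs, as in the tails.
\<close>
lemma powr_loss:
  fixes b m r k :: real
  assumes "1 \<le> r" "0 \<le> b" "b \<le> k" "0 \<le> m"
  shows "(b + m) powr r \<le> m powr r + r * 2 powr r * (k powr r + k * m powr (r - 1))"
proof (cases "b = 0")
  case True
  then show ?thesis using assms by auto
next
  case False
  then have b: "0 < b" using assms by simp
  have "(b + m) powr r - m powr r \<le> r * b * (b + m) powr (r - 1)"
  proof (cases "m = 0")
    case True
    have "b powr r = b * b powr (r - 1)"
      using b powr_mult_base[of b "r - 1"] by simp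
    also have "\<dots> \<le> r * (b * b powr (r - 1))"
      using assms b mult_right_mono[of 1 r "b * b powr (r - 1)"] by simp
    finally show ?thesis using True assms by (simp add: mult.assoc)
  next
    case False
    then have m: "0 < m" using assms by simp
    have "\<exists>z>m. z < b + m \<and> (b + m) powr r - m powr r = (b + m - m) * (r * z powr (r - 1))"
      using b m by (intro MVT2) (auto intro!: derivative_eq_intros)
    then obtain z where z: "m < z" "z < b + m"
      "(b + m) powr r - m powr r = b * (r * z powr (r - 1))" by auto
    have "z powr (r - 1) \<le> (b + m) powr (r - 1)"
      using z m assms by (intro powr_mono2) auto
    then show ?thesis using z(3) b assms by (simp add: mult_left_mono mult.assoc mult.left_commute)
  qed
  also have "\<dots> \<le> r * k * (2 powr (r - 1) * (k powr (r - 1) + m powr (r - 1)))"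
  proof (intro mult_mono)
    have "(b + m) powr (r - 1) \<le> (k + m) powr (r - 1)"
      using assms by (intro powr_mono2) auto
    also have "\<dots> \<le> 2 powr (r - 1) * (k powr (r - 1) + m powr (r - 1))"
      using assms by (intro powr_add_le) auto
    finally show "(b + m) powr (r - 1) \<le> 2 powr (r - 1) * (k powr (r - 1) + m powr (r - 1))" .
  qed (use assms in auto)
  also have "\<dots> = r * 2 powr (r - 1) * (k * k powr (r - 1) + k * m powr (r - 1))"
    by (simp add: algebra_simps)
  also have "k * k powr (r - 1) = k powr r"
    using assms b powr_mult_base[of k "r - 1"] by simp
  also have "r * 2 powr (r - 1) * (k powr r + k * m powr (r - 1))
      \<le> r * 2 powr r * (k powr r + k * m powr (r - 1))"
    using assms by (intro mult_right_mono mult_left_mono) auto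
  finally show ?thesis by simp
qed

text \<open>
  An upper bound for the energy that a pair at distance \<open>d\<close> can lose when a function is replaced by an
  obstacle of height \<open>k\<close> and Lipschitz constant \<open>k l\<close>; the partner has negative part \<open>m\<close>.
\<close>
definition pair_cost :: "real \<Rightarrow> real \<Rightarrow> real \<Rightarrow> real \<Rightarrow> real \<Rightarrow> real" where
  "pair_cost r k l d m = r * 2 powr r * (k powr r * min 1 (l * d) powr r + k * m powr (r - 1))"

lemma pair_cost_nonneg:
  "0 \<le> r \<Longrightarrow> 0 \<le> k \<Longrightarrow> 0 \<le> pair_cost r k l d m"
  by (simp add: pair_cost_def)

lemma pair_cost_lipschitz:
  fixes r k l d x :: real
  assumes "1 \<le> r" "0 \<le> x" "x \<le> k" "x \<le> k * (l * d)" "0 \<le> d" "0 \<le> l"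
  shows "x powr r \<le> pair_cost r k l d m"
proof -
  have k: "0 \<le> k" using assms by simp
  have "x \<le> k * min 1 (l * d)"
    using assms by (auto simp: min_def)
  then have "x powr r \<le> (k * min 1 (l * d)) powr r"
    using assms by (intro powr_mono2) auto
  also have "\<dots> = k powr r * min 1 (l * d) powr r"
    using assms k by (simp add: powr_mult)
  also have "\<dots> \<le> k powr r * min 1 (l * d) powr r + k * m powr (r - 1)"
    using k by simp
  also have "\<dots> \<le> r * 2 powr r * (k powr r * min 1 (l * d) powr r + k * m powr (r - 1))"
  proof -
    have "1 * 1 \<le> r * 2 powr r"
      using assms by (intro mult_mono) (auto simp: ge_one_powr_ge_zero)
    then show ?thesis
      using k mult_right_mono[of 1 "r * 2 powr r" "k powr r * min 1 (l * d) powr r + k * m powr (r - 1)"]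
      by simp
  qed
  finally show ?thesis by (simp add: pair_cost_def)
qed

section \<open>The mass of a truncated power kernel\<close>
lemma dyadic_scale:
  assumes "1 \<le> (x::real)"
  shows "\<exists>j::nat. 2 ^ j \<le> x \<and> x < 2 ^ (j + 1)"
proof -
  obtain N where N: "x < 2 ^ N"
    using real_arch_pow[of 2 x] by auto
  define j where "j = (LEAST N. x < 2 ^ N)"
  have j: "x < 2 ^ j" unfolding j_def using N by (rule LeastI)
  then obtain i where i: "j = Suc i" using assms by (cases j) auto
  have "\<not> x < 2 ^ i"
    using not_less_Least[of i "\<lambda>N. x < 2 ^ N"] i unfolding j_def[symmetric] by simp
  then show ?thesis using j i by (intro exI[of _ i]) auto
qed

lemma suminf_geometric_finite:
  assumes "0 \<le> c" "0 \<le> x" "x < 1"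
  shows "(\<Sum>j. ennreal (c * x ^ j)) < \<infinity>"
proof -
  have "(\<Sum>j. ennreal (c * x ^ j)) = ennreal (\<Sum>j. c * x ^ j)"
    using assms by (intro suminf_ennreal2 summable_mult summable_geometric) auto
  then show ?thesis by simp
qed

text \<open>
  Near \<open>0\<close> the integrand is of order \<open>|z|\<^sup>\<tau>\<^sup>-\<^sup>n\<^sup>-\<^sup>\<sigma>\<close> with \<open>\<tau> > \<sigma>\<close>, at infinity of order \<open>|z|\<^sup>\<beta>\<^sup>-\<^sup>n\<^sup>-\<^sup>\<sigma>\<close> with
  \<open>\<beta> < \<sigma>\<close>. On dyadic shells both are dominated by indicator functions of balls whose integrals form
  geometric series.
\<close>
lemma radial_mass_finite:
  fixes \<beta> \<sigma> \<tau> :: real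
  assumes "0 \<le> \<beta>" "\<beta> < \<sigma>" "\<sigma> < \<tau>"
  shows "(\<integral>\<^sup>+ z. ennreal (max 1 (norm z) powr \<beta> * min 1 (norm z) powr \<tau>
      / norm (z :: real^'n) powr (real CARD('n) + \<sigma>)) \<partial>lborel) < \<infinity>"
    (is "(\<integral>\<^sup>+ z. ennreal (?f z) \<partial>lborel) < _")
proof -
  define n where "n = real CARD('n)"
  define \<omega> where "\<omega> = unit_ball_vol n"
  have \<omega>: "0 \<le> \<omega>" by (simp add: \<omega>_def n_def)
  define c where "c j = (2 powr (-(n + \<sigma> - \<beta>))) ^ j" for j :: nat
  define e where "e j = 2 powr (n + \<sigma>) * (2 powr (n + \<sigma> - \<tau>)) ^ j" for j :: nat
  define g where "g j z = ennreal (c j) * indicator (ball 0 (2 ^ (j + 1))) z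
      + ennreal (e j) * indicator (cball 0 ((1/2) ^ j)) z" for j and z :: "real^'n"
  have fg: "ennreal (?f z) \<le> (\<Sum>j. g j z)" for z
  proof -
    have *: "g j z \<le> (\<Sum>j. g j z)" for j
      using sum_le_suminf[of "\<lambda>j. g j z" "{j}"] by auto
    consider "z = 0" | "norm z \<ge> 1" | "0 < norm z" "norm z < 1" by force
    then show ?thesis
    proof cases
      case 1 then show ?thesis by simp
    next
      case 2
      then obtain j where j: "2 ^ j \<le> norm z" "norm z < 2 ^ (j + 1)"
        using dyadic_scale by blast
      have "?f z = norm z powr (-(n + \<sigma> - \<beta>))"
        using 2 by (simp add: n_def powr_diff [symmetric] flip: powr_diff)
      also have "\<dots> \<le> (2 ^ j) powr (-(n + \<sigma> - \<beta>))"
        using j(1) assms by (intro powr_mono2') (auto simp: n_def)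
      also have "\<dots> = c j"
        by (simp add: c_def powr_realpow[symmetric] powr_powr mult.commute)
      finally have "ennreal (?f z) \<le> g j z"
        using j(2) by (auto simp: g_def intro!: ennreal_leI add_increasing2)
      with *[of j] show ?thesis by simp
    next
      case 3
      then have "1 \<le> 1 / norm z" by simp
      then obtain j where j: "2 ^ j \<le> 1 / norm z" "1 / norm z < 2 ^ (j + 1)"
        using dyadic_scale by blast
      have lo: "(1/2) ^ (j + 1) \<le> norm z" and up: "norm z \<le> (1/2) ^ j"
        using j 3 by (auto simp: field_simps)
      have "?f z = norm z powr \<tau> * norm z powr (-(n + \<sigma>))"
        unfolding n_def[symmetric] powr_minus using 3 by (simp add: divide_inverse)
      also have "\<dots> \<le> ((1/2) ^ j) powr \<tau> * ((1/2) ^ (j + 1)) powr (-(n + \<sigma>))"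
        using lo up assms 3 by (intro mult_mono powr_mono2 powr_mono2') (auto simp: n_def)
      also have "(1/2::real) ^ j = 2 powr (- real j)" for j
        by (simp add: powr_minus powr_realpow power_one_over inverse_eq_divide)
      then have "((1/2::real) ^ j) powr \<tau> * ((1/2) ^ (j + 1)) powr (-(n + \<sigma>)) = e j"
        by (simp only: e_def powr_powr powr_realpow[symmetric] powr_gt_zero powr_add[symmetric])
           (simp add: algebra_simps powr_realpow[symmetric] powr_powr powr_add[symmetric])
      finally have "ennreal (?f z) \<le> g j z"
        using up by (auto simp: g_def intro!: ennreal_leI add_increasing)
      with *[of j] show ?thesis by simp
    qed
  qed
  have [measurable]: "ball 0 r \<in> sets lborel" "cball 0 r \<in> sets lborel" for r :: real and z :: "real^'n"
    by auto
  have [measurable]: "g j \<in> borel_measurable lborel" for j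
    unfolding g_def by measurable
  have "(\<integral>\<^sup>+ z. ennreal (?f z) \<partial>lborel) \<le> (\<integral>\<^sup>+ z. (\<Sum>j. g j z) \<partial>lborel)"
    using fg by (intro nn_integral_mono)
  also have "\<dots> = (\<Sum>j. \<integral>\<^sup>+ z. g j z \<partial>lborel)"
    by (intro nn_integral_suminf) measurable
  also have "\<dots> = (\<Sum>j. ennreal ((\<omega> * 2 powr n) * (2 powr (\<beta> - \<sigma>)) ^ j)
      + ennreal ((\<omega> * 2 powr (n + \<sigma>)) * (2 powr (\<sigma> - \<tau>)) ^ j))"
  proof (intro arg_cong[where f = suminf] ext)
    fix j
    have ce: "0 \<le> c j" "0 \<le> e j" for j by (simp_all add: c_def e_def)
    have A: "c j * (\<omega> * (2 ^ (j + 1)) ^ CARD('n)) = (\<omega> * 2 powr n) * (2 powr (\<beta> - \<sigma>)) ^ j"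
    proof -
      have "(2 ^ (j + 1) :: real) ^ CARD('n) = 2 powr (n * (j + 1))"
        using powr_realpow[of 2 "CARD('n) * (j + 1)"]
        by (simp add: n_def power_mult[symmetric] algebra_simps del: power_Suc)
      then show ?thesis
        by (simp add: c_def powr_realpow[symmetric] powr_powr powr_add[symmetric] algebra_simps)
    qed
    have B: "e j * (\<omega> * ((1/2) ^ j) ^ CARD('n))
        = (\<omega> * 2 powr (n + \<sigma>)) * (2 powr (\<sigma> - \<tau>)) ^ j"
    proof -
      have "((1/2) ^ j :: real) ^ CARD('n) = 2 powr (- (n * j))"
        using powr_realpow[of 2 "CARD('n) * j"]
        by (simp add: n_def power_mult[symmetric] powr_minus power_one_over mult.commute inverse_eq_divide)
      then show ?thesis
        by (simp add: e_def powr_realpow[symmetric] powr_powr powr_add[symmetric] algebra_simps)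
    qed
    have "(\<integral>\<^sup>+ z. g j z \<partial>lborel) = ennreal (c j) * ennreal (\<omega> * (2 ^ (j + 1)) ^ CARD('n))
        + ennreal (e j) * ennreal (\<omega> * ((1/2) ^ j) ^ CARD('n))"
      unfolding g_def
      by (subst nn_integral_add) (auto simp: nn_integral_cmult_indicator emeasure_ball emeasure_cball \<omega>_def n_def)
    then show "(\<integral>\<^sup>+ z. g j z \<partial>lborel) = ennreal ((\<omega> * 2 powr n) * (2 powr (\<beta> - \<sigma>)) ^ j)
      + ennreal ((\<omega> * 2 powr (n + \<sigma>)) * (2 powr (\<sigma> - \<tau>)) ^ j)"
      unfolding A[symmetric] B[symmetric] using ce[of j] by (simp only: ennreal_mult')
  qed
  also have "\<dots> = (\<Sum>j. ennreal ((\<omega> * 2 powr n) * (2 powr (\<beta> - \<sigma>)) ^ j))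
      + (\<Sum>j. ennreal ((\<omega> * 2 powr (n + \<sigma>)) * (2 powr (\<sigma> - \<tau>)) ^ j))"
    by (intro suminf_add[symmetric]) auto
  also have "\<dots> < \<infinity>"
  proof -
    have "2 powr (\<beta> - \<sigma>) < 1" "2 powr (\<sigma> - \<tau>) < 1"
      using assms by (auto intro!: powr_less_one)
    then have "(\<Sum>j. ennreal ((\<omega> * 2 powr n) * (2 powr (\<beta> - \<sigma>)) ^ j)) < \<infinity>"
      "(\<Sum>j. ennreal ((\<omega> * 2 powr (n + \<sigma>)) * (2 powr (\<sigma> - \<tau>)) ^ j)) < \<infinity>"
      using \<omega> by (intro suminf_geometric_finite; simp)+
    then show ?thesis by (simp only: ennreal_add_less_top infinity_ennreal_def)
  qed
  finally show ?thesis .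
qed


lemma nn_integral_affine:
  fixes f :: "'a::euclidean_space \<Rightarrow> ennreal"
  assumes [measurable]: "f \<in> borel_measurable borel" and R: "0 < R"
  shows "(\<integral>\<^sup>+ y. f y \<partial>lborel) = ennreal (R ^ DIM('a)) * (\<integral>\<^sup>+ z. f (x + R *\<^sub>R z) \<partial>lborel)"
proof -
  have "(\<integral>\<^sup>+ y. f y \<partial>lborel)
      = (\<integral>\<^sup>+ y. f y \<partial>density (distr lborel borel (\<lambda>z. x + R *\<^sub>R z)) (\<lambda>_. ennreal (\<bar>R\<bar> ^ DIM('a))))"
    by (rule arg_cong[where f = "\<lambda>M. nn_integral M f", OF lborel_affine]) (use R in simp)
  also have "\<dots> = (\<integral>\<^sup>+ z. ennreal (R ^ DIM('a)) * f (x + R *\<^sub>R z) \<partial>lborel)"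
    using R by (simp add: nn_integral_density nn_integral_distr)
  also have "\<dots> = ennreal (R ^ DIM('a)) * (\<integral>\<^sup>+ z. f (x + R *\<^sub>R z) \<partial>lborel)"
    by (intro nn_integral_cmult) auto
  finally show ?thesis .
qed

text \<open>
  Scaling by \<open>R\<close> shows that the truncation at distance \<open>R\<close> has mass of order \<open>R\<^sup>-\<^sup>\<sigma>\<close>, which is the power of \<open>R\<close> that
  occurs in \<open>h\<close>.
\<close>
lemma radial_mass_scaled:
  fixes \<beta> \<sigma> \<tau> :: real
  assumes "0 \<le> \<beta>" "\<beta> < \<sigma>" "\<sigma> < \<tau>"
  obtains J where "0 < J"
    "\<And>(x::real^'n) R. 0 < R \<Longrightarrow>
      (\<integral>\<^sup>+ y. ennreal (max 1 (norm (x - y) / R) powr \<beta> * min 1 (norm (x - y) / R) powr \<tau>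
        / norm (x - y) powr (real CARD('n) + \<sigma>)) \<partial>lborel) \<le> ennreal (J / R powr \<sigma>)"
proof -
  define I where "I = (\<integral>\<^sup>+ z. ennreal (max 1 (norm z) powr \<beta> * min 1 (norm z) powr \<tau>
      / norm (z :: real^'n) powr (real CARD('n) + \<sigma>)) \<partial>lborel)"
  have I: "I < \<infinity>" unfolding I_def by (rule radial_mass_finite[OF assms])
  define J where "J = enn2real I + 1"
  have IJ: "I \<le> ennreal J"
    using I by (cases I) (auto simp: J_def intro!: ennreal_leI)
  show ?thesis
  proof
    show "0 < J" by (simp add: J_def add_nonneg_pos)
    fix x :: "real^'n" and R :: real assume R: "0 < R"
    have "(\<integral>\<^sup>+ y. ennreal (max 1 (norm (x - y) / R) powr \<beta> * min 1 (norm (x - y) / R) powr \<tau>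
        / norm (x - y) powr (real CARD('n) + \<sigma>)) \<partial>lborel)
      = ennreal (R ^ CARD('n)) * (\<integral>\<^sup>+ z. ennreal (max 1 (norm z) powr \<beta> * min 1 (norm z) powr \<tau>
        / norm (R *\<^sub>R z :: real^'n) powr (real CARD('n) + \<sigma>)) \<partial>lborel)"
      using R by (subst nn_integral_affine[where R = R and x = x]) auto
    also have "(\<integral>\<^sup>+ z. ennreal (max 1 (norm z) powr \<beta> * min 1 (norm z) powr \<tau>
        / norm (R *\<^sub>R z :: real^'n) powr (real CARD('n) + \<sigma>)) \<partial>lborel)
      = (\<integral>\<^sup>+ z. ennreal (1 / R powr (real CARD('n) + \<sigma>)) * ennreal (max 1 (norm z) powr \<beta>
         * min 1 (norm z) powr \<tau> / norm (z :: real^'n) powr (real CARD('n) + \<sigma>)) \<partial>lborel)"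
      using R by (intro nn_integral_cong) (auto simp: powr_mult ennreal_mult'[symmetric] mult_ac)
    also have "\<dots> = ennreal (1 / R powr (real CARD('n) + \<sigma>)) * I"
      unfolding I_def by (intro nn_integral_cmult) auto
    also have "ennreal (R ^ CARD('n)) * (ennreal (1 / R powr (real CARD('n) + \<sigma>)) * I)
      = ennreal (1 / R powr \<sigma>) * I"
      using R by (simp add: mult.assoc[symmetric] ennreal_mult'[symmetric] powr_add powr_realpow)
    also have "\<dots> \<le> ennreal (1 / R powr \<sigma>) * ennreal J"
      by (intro mult_left_mono IJ) auto
    also have "\<dots> = ennreal (J / R powr \<sigma>)"
      by (simp add: ennreal_mult'[symmetric])
    finally show "(\<integral>\<^sup>+ y. ennreal (max 1 (norm (x - y) / R) powr \<beta> * min 1 (norm (x - y) / R) powr \<tau>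
        / norm (x - y) powr (real CARD('n) + \<sigma>)) \<partial>lborel) \<le> ennreal (J / R powr \<sigma>)" .
  qed
qed

section \<open>Truncation from below by an obstacle\<close>
definition gain :: "real \<Rightarrow> ('a \<Rightarrow> real) \<Rightarrow> ('a \<Rightarrow> real) \<Rightarrow> 'a \<Rightarrow> 'a \<Rightarrow> real" where
  "gain r \<psi> u x y = (if \<psi> x \<le> u y then (\<psi> x - u x) * (u y - u x) powr (r - 1) else 0)"

text \<open>
  The pointwise heart of the comparison. If \<open>y\<close> also lies in \<open>E\<close>, or \<open>0 \<le> u y < \<psi> x\<close>, the new
  difference is controlled by the Lipschitz bound of \<open>\<psi>\<close>; if \<open>u y \<ge> \<psi> x\<close>, energy is gained by
  \<open>powr_gain\<close>; if \<open>u y < 0\<close>, then \<open>y\<close> is far away and \<open>powr_loss\<close> applies.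
\<close>
lemma competitor_one_sided:
  fixes u \<psi> :: "'a::real_normed_vector \<Rightarrow> real"
  assumes r: "1 \<le> r" and k: "0 \<le> k" and l: "0 \<le> l"
    and \<psi>: "\<And>x. 0 \<le> \<psi> x" "\<And>x. \<psi> x \<le> k"
    and lip: "\<And>x y. \<bar>\<psi> x - \<psi> y\<bar> \<le> k * (l * norm (x - y))"
    and E: "\<And>x. x \<in> E \<Longrightarrow> 0 \<le> u x \<and> u x < \<psi> x"
    and notE: "\<And>y. y \<notin> E \<Longrightarrow> \<psi> y \<le> max (u y) 0"
    and far: "\<And>x y. x \<in> E \<Longrightarrow> u y < 0 \<Longrightarrow> 1 \<le> l * norm (x - y)"
    and v: "\<And>x. v x = (if x \<in> E then \<psi> x else u x)"
    and x: "x \<in> E"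
  shows "\<bar>v x - v y\<bar> powr r + gain r \<psi> u x y
    \<le> \<bar>u x - u y\<bar> powr r + pair_cost r k l (norm (x - y)) (max (- u y) 0)"
proof -
  note ux = E[OF x]
  have vx: "v x = \<psi> x" using x v by simp
  have lip_cost: "z powr r \<le> pair_cost r k l (norm (x - y)) m"
    if "0 \<le> z" "z \<le> \<bar>\<psi> x - \<psi> y\<bar>" for z m
  proof (rule pair_cost_lipschitz)
    have "\<bar>\<psi> x - \<psi> y\<bar> \<le> k" using \<psi>[of x] \<psi>[of y] by linarith
    then show "z \<le> k" using that by simp
    show "z \<le> k * (l * norm (x - y))" using that lip[of x y] by simp
  qed (use that r l in auto)
  have cost: "0 \<le> pair_cost r k l (norm (x - y)) (max (- u y) 0)"
    using r k by (intro pair_cost_nonneg) auto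
  have gain_le: "(u y - \<psi> x) powr r + gain r \<psi> u x y \<le> \<bar>u x - u y\<bar> powr r" if "\<psi> x \<le> u y"
    using powr_gain[OF r, of "u x" "\<psi> x" "u y"] that ux by (simp add: gain_def abs_minus_commute)
  consider (both) "y \<in> E" | (above) "y \<notin> E" "\<psi> x \<le> u y" | (below) "y \<notin> E" "u y < \<psi> x" "0 \<le> u y"
    | (negative) "y \<notin> E" "u y < 0"
    by force
  then show ?thesis
  proof cases
    case both
    have "gain r \<psi> u x y \<le> \<bar>u x - u y\<bar> powr r"
    proof (cases "\<psi> x \<le> u y")
      case True
      then show ?thesis using gain_le powr_ge_zero[of "u y - \<psi> x" r] by linarith
    next
      case False
      then show ?thesis by (simp add: gain_def)
    qed
    moreover have "\<bar>v x - v y\<bar> powr r \<le> pair_cost r k l (norm (x - y)) (max (- u y) 0)"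
      using lip_cost[of "\<bar>\<psi> x - \<psi> y\<bar>"] both vx v[of y] by simp
    ultimately show ?thesis by linarith
  next
    case above
    then have "\<bar>v x - v y\<bar> = u y - \<psi> x" using vx v[of y] by simp
    then show ?thesis using gain_le[OF above(2)] cost by simp
  next
    case below
    then have "\<bar>v x - v y\<bar> = \<psi> x - u y" using vx v[of y] by simp
    moreover have "(\<psi> x - u y) powr r \<le> pair_cost r k l (norm (x - y)) (max (- u y) 0)"
      using below notE[of y] by (intro lip_cost) auto
    ultimately show ?thesis using below by (simp add: gain_def add_increasing)
  next
    case negative
    define m where "m = - u y"
    have m: "0 < m" using negative by (simp add: m_def)
    have "\<bar>v x - v y\<bar> = \<psi> x + m" using negative vx v[of y] \<psi>[of x] by (simp add: m_def)
    moreover have "(\<psi> x + m) powr r \<le> m powr r + r * 2 powr r * (k powr r + k * m powr (r - 1))"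
      using m \<psi> by (intro powr_loss[OF r]) auto
    moreover have "m powr r \<le> \<bar>u x - u y\<bar> powr r"
      using m ux r by (intro powr_mono2) (auto simp: m_def)
    moreover have "pair_cost r k l (norm (x - y)) (max (- u y) 0)
        = r * 2 powr r * (k powr r + k * m powr (r - 1))"
      using far[OF x negative(2)] m by (simp add: pair_cost_def m_def)
    moreover have "gain r \<psi> u x y = 0"
      using negative \<psi>(1)[of x] by (simp add: gain_def)
    ultimately show ?thesis by (simp only: add_0_right)
  qed
qed

lemma competitor_pointwise:
  fixes u \<psi> :: "'a::real_normed_vector \<Rightarrow> real"
  assumes r: "1 \<le> r" and k: "0 \<le> k" and l: "0 \<le> l"
    and \<psi>: "\<And>x. 0 \<le> \<psi> x" "\<And>x. \<psi> x \<le> k"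
    and lip: "\<And>x y. \<bar>\<psi> x - \<psi> y\<bar> \<le> k * (l * norm (x - y))"
    and E: "\<And>x. x \<in> E \<Longrightarrow> 0 \<le> u x \<and> u x < \<psi> x"
    and notE: "\<And>y. y \<notin> E \<Longrightarrow> \<psi> y \<le> max (u y) 0"
    and far: "\<And>x y. x \<in> E \<Longrightarrow> u y < 0 \<Longrightarrow> 1 \<le> l * norm (x - y)"
    and v: "\<And>x. v x = (if x \<in> E then \<psi> x else u x)"
  shows "\<bar>v x - v y\<bar> powr r + indicator E x * gain r \<psi> u x y
    \<le> \<bar>u x - u y\<bar> powr r
      + (indicator E x * pair_cost r k l (norm (x - y)) (max (- u y) 0)
       + indicator E y * pair_cost r k l (norm (x - y)) (max (- u x) 0))"
proof -
  note one = competitor_one_sided[OF assms]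
  have cost: "0 \<le> pair_cost r k l d m" for d m
    using r k by (intro pair_cost_nonneg) auto
  have gain: "0 \<le> gain r \<psi> u x y" if "x \<in> E" for x y
    using E[OF that] by (simp add: gain_def)
  consider "x \<in> E" | "x \<notin> E" "y \<in> E" | "x \<notin> E" "y \<notin> E" by auto
  then show ?thesis
  proof cases
    case 1
    then show ?thesis using one[of x y] cost[of "norm (x - y)" "max (- u x) 0"]
      by (auto simp: indicator_def)
  next
    case 2
    then show ?thesis using one[of y x] gain[of y x]
      by (simp add: abs_minus_commute norm_minus_commute)
  next
    case 3
    then show ?thesis by (simp add: v)
  qed
qed

section \<open>The setting\<close>

text \<open>
  The constant \<open>J\<close> bounds the masses from \<open>radial_mass_scaled\<close> for both phases. Fixing it here makes all
  later constants explicit functions of the parameters, so that they are visibly the same for all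
  coefficients, minimizers and balls.
\<close>
locale double_phase =
  fixes s t p q \<Lambda> \<alpha> A lam J :: real and a :: "real^'n::finite \<Rightarrow> real^'n \<Rightarrow> real"
  assumes s: "0 < s" and st: "s \<le> t" and t: "t < 1" and p: "1 < p" and pq: "p \<le> q"
    and \<Lambda>: "1 \<le> \<Lambda>" and \<alpha>: "0 < \<alpha>" "\<alpha> \<le> 1" and A: "0 \<le> A" and \<alpha>_tq: "\<alpha> < t * q"
    and lam: "0 < lam" and coeff: "admissible_coefficient a" and holder: "holder_coefficient A \<alpha> a"
    and a_lower: "\<And>x y. lam \<le> a x y"
    and J: "0 < J"
    and mass_p: "\<And>(x::real^'n) r. 0 < r \<Longrightarrow>
      (\<integral>\<^sup>+ y. ennreal (max 1 (norm (x - y) / r) powr 0 * min 1 (norm (x - y) / r) powr p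
        / norm (x - y) powr (real CARD('n) + s * p)) \<partial>lborel) \<le> ennreal (J / r powr (s * p))"
    and mass_q: "\<And>(x::real^'n) r. 0 < r \<Longrightarrow>
      (\<integral>\<^sup>+ y. ennreal (max 1 (norm (x - y) / r) powr \<alpha> * min 1 (norm (x - y) / r) powr q
        / norm (x - y) powr (real CARD('n) + t * q)) \<partial>lborel) \<le> ennreal (J / r powr (t * q))"
begin

definition np :: real where "np = real CARD('n) + s * p"
definition nq :: real where "nq = real CARD('n) + t * q"

text \<open>
  The function \<open>h\<close> at scale \<open>R\<close>, but with the infimum of the coefficient over the ball of radius \<open>4 * R\<close>:
  all radii between \<open>R\<close> and \<open>4 * R\<close> are treated with this one coefficient.
\<close>
definition level :: "real^'n \<Rightarrow> real \<Rightarrow> real \<Rightarrow> real" where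
  "level x0 R k = k powr (p - 1) / R powr (s * p)
    + a_minus a x0 (4 * R) * (k powr (q - 1) / R powr (t * q))"

text \<open>
  A quantity \<open>f\<close> that depends on the growth exponent, weighted with the model kernels of the two phases.
\<close>
definition double_kernel :: "(real \<Rightarrow> real) \<Rightarrow> real^'n \<Rightarrow> real^'n \<Rightarrow> real" where
  "double_kernel f x y = f p / norm (x - y) powr np + a x y * (f q / norm (x - y) powr nq)"

lemma q: "1 < q" using p pq by simp

lemma sp_tq: "s * p \<le> t * q" and sp: "0 < s * p" and sp_p: "s * p < p" and tq: "0 < t * q" "t * q < q"
proof -
  show "s * p \<le> t * q" using s st p pq by (intro mult_mono) auto
  show "0 < s * p" "0 < t * q" using s st p q by auto
  show "s * p < p" "t * q < q" using s st t p q by auto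
qed

lemma a_sym: "a x y = a y x" and a_nonneg: "0 \<le> a x y"
  using coeff by (auto simp: admissible_coefficient_def)

lemma a_measurable [measurable]: "case_prod a \<in> borel_measurable borel"
proof (intro borel_measurable_continuous_onI)
  show "continuous_on UNIV (case_prod a)"
  proof (intro continuous_at_imp_continuous_on ballI)
    fix z0 :: "(real^'n) \<times> (real^'n)"
    have "(\<lambda>z. case_prod a z - case_prod a z0) \<midarrow>z0\<rightarrow> 0"
    proof (rule Lim_null_comparison)
      show "\<forall>\<^sub>F z in at z0. norm (case_prod a z - case_prod a z0)
          \<le> A * (norm (fst z - fst z0) + norm (snd z - snd z0)) powr \<alpha>"
        using holder by (intro always_eventually) (auto simp: holder_coefficient_def split: prod.splits)
      have "((\<lambda>z. norm (fst z - fst z0) + norm (snd z - snd z0)) \<longlongrightarrow> 0) (at z0)"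
        by (auto intro!: tendsto_eq_intros)
      then have "((\<lambda>z. (norm (fst z - fst z0) + norm (snd z - snd z0)) powr \<alpha>) \<longlongrightarrow> 0 powr \<alpha>) (at z0)"
        using \<alpha> by (intro tendsto_powr') auto
      then show "((\<lambda>z. A * (norm (fst z - fst z0) + norm (snd z - snd z0)) powr \<alpha>) \<longlongrightarrow> 0) (at z0)"
        by (intro tendsto_mult_right_zero) simp
    qed
    then show "isCont (case_prod a) z0"
      unfolding isCont_def by (rule LIM_zero_cancel)
  qed
qed

text \<open>
  The coefficient with measurable arguments, in the form that the measurability prover can apply inside
  composite integrands.
\<close>
lemma a_measurable' [measurable (raw)]:
  assumes [measurable]: "f \<in> borel_measurable M" "g \<in> borel_measurable M"
  shows "(\<lambda>w. a (f w) (g w)) \<in> borel_measurable M"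
proof -
  have "(\<lambda>w. (f w, g w)) \<in> M \<rightarrow>\<^sub>M borel"
    by (intro borel_measurable_Pair) measurable
  from measurable_compose[OF this a_measurable] show ?thesis by simp
qed

end

text \<open>
  The function \<open>u\<close> is a representative of the minimizer that is Borel and nonnegative everywhere in the
  ball. The level \<open>k\<close> is so high that the tails of the negative part do not exceed \<open>h(k)\<close>.
\<close>
locale minimizer_in_ball = double_phase s t p q \<Lambda> \<alpha> A lam J a
  for s t p q \<Lambda> \<alpha> A lam J :: real and a :: "real^'n::finite \<Rightarrow> real^'n \<Rightarrow> real" +
  fixes u :: "real^'n \<Rightarrow> real" and x0 :: "real^'n" and R :: real and \<Omega> :: "(real^'n) set"
    and Ksp Ktq :: "real^'n \<Rightarrow> real^'n \<Rightarrow> real" and k :: real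
  assumes u_measurable [measurable]: "u \<in> borel_measurable borel"
    and u_nonneg: "\<And>x. x \<in> ball x0 (4 * R) \<Longrightarrow> 0 \<le> u x"
    and R: "0 < R" "R \<le> 1"
    and \<Omega>: "open \<Omega>" "bounded \<Omega>" "ball x0 (4 * R) \<subseteq> \<Omega>"
    and kernels: "admissible_kernel \<Lambda> (s * p) Ksp" "admissible_kernel \<Lambda> (t * q) Ktq"
    and minimizer: "is_minimizer s t p q Ksp Ktq a \<Omega> u"
    and k: "0 < k"
    and tails: "Tail s p (neg_part u) x0 (4 * R) + Tail_a t q a (neg_part u) x0 (4 * R)
      \<le> ennreal (level x0 R k)"

text \<open>
  An obstacle of height at most \<open>k\<close>; the number \<open>L\<close> measures its steepness on the natural scale \<open>k / R\<close>.
\<close>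
locale obstacle_in_ball = minimizer_in_ball s t p q \<Lambda> \<alpha> A lam J a u x0 R \<Omega> Ksp Ktq k
  for s t p q \<Lambda> \<alpha> A lam J :: real and a :: "real^'n::finite \<Rightarrow> real^'n \<Rightarrow> real"
    and u x0 R \<Omega> Ksp Ktq k +
  fixes L :: real and \<psi> :: "real^'n \<Rightarrow> real"
  assumes L: "1 \<le> L"
    and \<psi>: "\<And>x. 0 \<le> \<psi> x" "\<And>x. \<psi> x \<le> k"
    and \<psi>_lip: "\<And>x y. \<bar>\<psi> x - \<psi> y\<bar> \<le> k * (L / R * norm (x - y))"
    and \<psi>_supp: "\<And>x. x \<notin> ball x0 (3 * R) \<Longrightarrow> \<psi> x = 0"
begin

definition E :: "(real^'n) set" where "E = {x \<in> ball x0 (3 * R). u x < \<psi> x}"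

definition v :: "real^'n \<Rightarrow> real" where "v x = (if x \<in> E then \<psi> x else u x)"

definition cost :: "real \<Rightarrow> real^'n \<Rightarrow> real^'n \<Rightarrow> real" where
  "cost r x y = pair_cost r k (L / R) (norm (x - y)) (max (- u y) 0)"

lemma \<psi>_measurable [measurable]: "\<psi> \<in> borel_measurable borel"
proof (intro borel_measurable_continuous_onI)
  have "(k * (L / R))-lipschitz_on UNIV \<psi>"
    using \<psi>_lip k L R by (intro lipschitz_onI) (auto simp: dist_norm mult.assoc)
  then show "continuous_on UNIV \<psi>" by (rule lipschitz_on_continuous_on)
qed

lemma E_measurable [measurable]: "E \<in> sets borel"
proof -
  have [measurable]: "ball x0 (3 * R) \<in> sets borel" by simp
  have "{x \<in> ball x0 (3 * R). u x < \<psi> x} \<in> sets borel"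
  proof -
    have "{x \<in> ball x0 (3 * R). u x < \<psi> x} = ball x0 (3 * R) \<inter> {x \<in> space borel. u x < \<psi> x}" by auto
    also have "\<dots> \<in> sets borel" by measurable
    finally show ?thesis .
  qed
  then show ?thesis by (simp add: E_def)
qed

lemma v_measurable [measurable]: "v \<in> borel_measurable borel"
  unfolding v_def by measurable

lemma E_ball: "E \<subseteq> ball x0 (3 * R)" by (auto simp: E_def)

lemma E_Omega: "E \<subseteq> \<Omega>"
  using E_ball \<Omega> R by (auto simp: subset_iff)

lemma cost_nonneg: "1 \<le> r \<Longrightarrow> 0 \<le> cost r x y"
  using k by (simp add: cost_def pair_cost_nonneg)

lemma E_bounds: "x \<in> E \<Longrightarrow> 0 \<le> u x \<and> u x < \<psi> x"
  using u_nonneg[of x] R by (auto simp: E_def)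

lemma gain_nonneg: "x \<in> E \<Longrightarrow> 0 \<le> gain r \<psi> u x y"
  using E_bounds[of x] by (simp add: gain_def)

lemma pointwise:
  assumes "1 \<le> r"
  shows "\<bar>v x - v y\<bar> powr r + indicator E x * gain r \<psi> u x y
    \<le> \<bar>u x - u y\<bar> powr r + (indicator E x * cost r x y + indicator E y * cost r y x)"
  unfolding cost_def norm_minus_commute[of y x]
proof (rule competitor_pointwise)
  show "\<psi> y \<le> max (u y) 0" if "y \<notin> E" for y
    using that \<psi>_supp[of y] by (cases "y \<in> ball x0 (3 * R)") (auto simp: E_def)
  show "1 \<le> L / R * norm (x - y)" if "x \<in> E" "u y < 0" for x y
  proof -
    have "y \<notin> ball x0 (4 * R)" using that u_nonneg[of y] by auto
    then have "4 * R \<le> dist x0 y" by simp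
    also have "\<dots> \<le> dist x0 x + dist x y" by (rule dist_triangle)
    also have "dist x0 x < 3 * R" using that E_ball by auto
    finally have "R \<le> norm (x - y)" by (simp add: dist_norm)
    then have "R \<le> L * norm (x - y)"
      using L R mult_mono[of 1 L R "norm (x - y)"] by auto
    then show ?thesis using R by (simp add: field_simps)
  qed
  show "0 \<le> L / R" using L R by simp
qed (use assms k \<psi> \<psi>_lip E_bounds v_def in auto)

end

section \<open>Energy comparison with the truncated minimizer\<close>
lemma measurable_lebesgue_pair:
  fixes f :: "(real^'n::finite) \<times> (real^'n) \<Rightarrow> 'b::topological_space"
  assumes "f \<in> borel_measurable (lborel \<Otimes>\<^sub>M lborel)"
  shows "f \<in> borel_measurable lebesgue"
  using assms unfolding lborel_prod by (rule measurable_completion)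

text \<open>
  Tonelli's theorem in both orders, for Borel integrands against the completed product measure in which
  the energies are written. The general kernels are only Lebesgue measurable, so they are first replaced
  by the model kernels.
\<close>
lemma nn_integral_lebesgue_pair:
  fixes f :: "real^'n::finite \<Rightarrow> real^'n \<Rightarrow> ennreal"
  assumes "case_prod f \<in> borel_measurable (lborel \<Otimes>\<^sub>M lborel)"
  shows "(\<integral>\<^sup>+ z. case_prod f z \<partial>lebesgue) = (\<integral>\<^sup>+ x. \<integral>\<^sup>+ y. f x y \<partial>lborel \<partial>lborel)"
    and "(\<integral>\<^sup>+ z. case_prod f z \<partial>lebesgue) = (\<integral>\<^sup>+ y. \<integral>\<^sup>+ x. f x y \<partial>lborel \<partial>lborel)"
  using lborel.nn_integral_fst[OF assms] lborel_pair.nn_integral_snd[of "case_prod f"] assms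
  by (simp_all add: nn_integral_completion lborel_prod)

lemma admissible_kernelD:
  fixes K :: "real^'n::finite \<Rightarrow> real^'n \<Rightarrow> real"
  assumes "admissible_kernel \<Lambda> \<sigma> K" "x \<noteq> y" "0 \<le> c"
  shows "inverse \<Lambda> * (c / norm (x - y) powr (real CARD('n) + \<sigma>)) \<le> c * K x y"
    and "c * K x y \<le> \<Lambda> * (c / norm (x - y) powr (real CARD('n) + \<sigma>))"
  using assms mult_left_mono[of "inverse \<Lambda> / norm (x - y) powr (real CARD('n) + \<sigma>)" "K x y" c]
    mult_left_mono[of "K x y" "\<Lambda> / norm (x - y) powr (real CARD('n) + \<sigma>)" c]
  by (auto simp: admissible_kernel_def mult_ac divide_inverse)

lemma power_kernel_admissible:
  assumes "1 \<le> \<Lambda>"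
  shows "admissible_kernel \<Lambda> \<sigma>
    (\<lambda>x y :: real^'n::finite. 1 / norm (x - y) powr (real CARD('n) + \<sigma>))"
proof -
  have "inverse \<Lambda> \<le> 1" using assms by (simp add: inverse_le_1_iff)
  moreover have "(\<lambda>(x, y). 1 / norm (x - y :: real^'n) powr (real CARD('n) + \<sigma>))
      \<in> borel_measurable lebesgue"
    by (rule measurable_lebesgue_pair) measurable
  ultimately show ?thesis
    using assms by (auto simp: admissible_kernel_def intro!: divide_right_mono)
qed

context double_phase
begin

lemma double_kernel_diag: "double_kernel f x x = 0"
  by (simp add: double_kernel_def)

lemma double_kernel_nonneg: "0 \<le> f p \<Longrightarrow> 0 \<le> f q \<Longrightarrow> 0 \<le> double_kernel f x y"
  by (simp add: double_kernel_def a_nonneg)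

lemma double_kernel_sym: "double_kernel f x y = double_kernel f y x"
  unfolding double_kernel_def by (simp add: norm_minus_commute a_sym)

lemma double_kernel_cmult: "double_kernel (\<lambda>r. c * f r) x y = c * double_kernel f x y"
  by (simp add: double_kernel_def algebra_simps)

lemma double_kernel_add: "double_kernel (\<lambda>r. f r + g r) x y = double_kernel f x y + double_kernel g x y"
  by (simp add: double_kernel_def algebra_simps add_divide_distrib)

text \<open>
  Passage from pointwise inequalities for the powers to energy densities: in \<open>f\<close> and \<open>d\<close> the actual kernels are kept, in
  the gain \<open>g\<close> and in the cost \<open>c\<close> they are replaced by the model kernels. On the diagonal the bounds on
  the kernels say nothing, but there the differences vanish.
\<close>
lemma kernel_compare:
  assumes K: "admissible_kernel \<Lambda> (s * p) Ksp" "admissible_kernel \<Lambda> (t * q) Ktq"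
    and nonneg: "\<And>r. r \<in> {p, q} \<Longrightarrow> 0 \<le> f r \<and> 0 \<le> g r \<and> 0 \<le> c r \<and> 0 \<le> d r"
    and le: "\<And>r. r \<in> {p, q} \<Longrightarrow> f r + g r \<le> d r + c r"
    and diag: "x = y \<Longrightarrow> f p = 0 \<and> f q = 0"
  shows "(f p * Ksp x y + a x y * f q * Ktq x y) + inverse \<Lambda> * double_kernel g x y
    \<le> (d p * Ksp x y + a x y * d q * Ktq x y) + \<Lambda> * double_kernel c x y"
proof (cases "x = y")
  case True
  have "0 \<le> Ksp x y" "0 \<le> Ktq x y" using K by (auto simp: admissible_kernel_def)
  then show ?thesis
    using True diag nonneg[of p] nonneg[of q] a_nonneg[of x y] by (simp add: double_kernel_diag)
next
  case False
  have K0: "0 \<le> Ksp x y" "0 \<le> Ktq x y" using K by (auto simp: admissible_kernel_def)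
  have 1: "f p * Ksp x y + inverse \<Lambda> * (g p / norm (x - y) powr np)
      \<le> d p * Ksp x y + \<Lambda> * (c p / norm (x - y) powr np)"
    using mult_right_mono[OF le[of p] K0(1)] nonneg[of p]
      admissible_kernelD(1)[OF K(1) False, of "g p"] admissible_kernelD(2)[OF K(1) False, of "c p"]
    by (simp add: np_def algebra_simps)
  have 2: "f q * Ktq x y + inverse \<Lambda> * (g q / norm (x - y) powr nq)
      \<le> d q * Ktq x y + \<Lambda> * (c q / norm (x - y) powr nq)"
    using mult_right_mono[OF le[of q] K0(2)] nonneg[of q]
      admissible_kernelD(1)[OF K(2) False, of "g q"] admissible_kernelD(2)[OF K(2) False, of "c q"]
    by (simp add: nq_def algebra_simps)
  show ?thesis
    using add_mono[OF 1 mult_left_mono[OF 2 a_nonneg[of x y]]]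
    by (simp add: double_kernel_def algebra_simps)
qed

end

context obstacle_in_ball
begin

definition total_gain :: ennreal where
  "total_gain = (\<integral>\<^sup>+ x \<in> E. (\<integral>\<^sup>+ y. ennreal (double_kernel (\<lambda>r. gain r \<psi> u x y) x y) \<partial>lborel) \<partial>lborel)"

definition total_cost :: ennreal where
  "total_cost = (\<integral>\<^sup>+ x \<in> E. (\<integral>\<^sup>+ y. ennreal (double_kernel (\<lambda>r. cost r x y) x y) \<partial>lborel) \<partial>lborel)"

lemma gain_kernel_measurable [measurable]:
  "(\<lambda>(x, y). double_kernel (\<lambda>r. gain r \<psi> u x y) x y) \<in> borel_measurable (lborel \<Otimes>\<^sub>M lborel)"
  unfolding double_kernel_def gain_def by measurable

lemma cost_kernel_measurable [measurable]:
  "(\<lambda>(x, y). double_kernel (\<lambda>r. cost r x y) x y) \<in> borel_measurable (lborel \<Otimes>\<^sub>M lborel)"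
  unfolding double_kernel_def cost_def pair_cost_def by measurable

lemma energy_integrand_measurable:
  fixes K1 K2 :: "real^'n \<Rightarrow> real^'n \<Rightarrow> real"
  assumes "admissible_kernel \<Lambda> (s * p) K1" "admissible_kernel \<Lambda> (t * q) K2"
    and [measurable]: "w \<in> borel_measurable borel"
  shows "(\<lambda>z. (case z of (x, y) \<Rightarrow>
      ennreal (\<bar>w x - w y\<bar> powr p * K1 x y + a x y * \<bar>w x - w y\<bar> powr q * K2 x y))
      * indicator (C_set \<Omega>) z) \<in> borel_measurable lebesgue"
proof -
  have [measurable]: "case_prod K1 \<in> borel_measurable lebesgue" "case_prod K2 \<in> borel_measurable lebesgue"
    using assms by (auto simp: admissible_kernel_def)
  have [measurable]: "case_prod a \<in> borel_measurable lebesgue"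
    by (rule measurable_lebesgue_pair) simp
  have [measurable]: "(\<lambda>(x, y). \<bar>w x - w y\<bar> powr r) \<in> borel_measurable lebesgue" for r
    by (rule measurable_lebesgue_pair) measurable
  have "closed ((- \<Omega>) \<times> (- \<Omega>))" using \<Omega> by (intro closed_Times) auto
  then have "open (C_set \<Omega>)" by (auto simp: C_set_def Compl_eq_Diff_UNIV[symmetric])
  then have [measurable]: "C_set \<Omega> \<in> sets lebesgue" by auto
  have "(\<lambda>z. ennreal ((case_prod (\<lambda>x y. \<bar>w x - w y\<bar> powr p) z) * case_prod K1 z
      + case_prod a z * (case_prod (\<lambda>x y. \<bar>w x - w y\<bar> powr q) z) * case_prod K2 z)
      * indicator (C_set \<Omega>) z) \<in> borel_measurable lebesgue"
    by measurable
  then show ?thesis by (simp add: case_prod_unfold)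
qed

text \<open>
  The pointwise inequality, integrated. The cost appears twice because a pair can touch \<open>E\<close> with
  either coordinate; by symmetry of \<open>a\<close> both contributions agree.
\<close>
lemma energy_comparison:
  fixes K1 K2 :: "real^'n \<Rightarrow> real^'n \<Rightarrow> real"
  assumes K: "admissible_kernel \<Lambda> (s * p) K1" "admissible_kernel \<Lambda> (t * q) K2"
  shows "energy p q K1 K2 a v \<Omega> + ennreal (inverse \<Lambda>) * total_gain
    \<le> energy p q K1 K2 a u \<Omega> + ennreal (2 * \<Lambda>) * total_cost"
proof -
  define I where "I w = (\<lambda>(x, y). \<bar>w x - w y\<bar> powr p * K1 x y + a x y * \<bar>w x - w y\<bar> powr q * K2 x y)"
    for w :: "real^'n \<Rightarrow> real"
  define G where "G x y = indicator E x * ennreal (double_kernel (\<lambda>r. gain r \<psi> u x y) x y)" for x y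
  define C where "C x y = indicator E x * ennreal (double_kernel (\<lambda>r. cost r x y) x y)" for x y
  have G_meas [measurable]: "case_prod G \<in> borel_measurable (lborel \<Otimes>\<^sub>M lborel)"
    and C_meas [measurable]: "case_prod C \<in> borel_measurable (lborel \<Otimes>\<^sub>M lborel)"
    unfolding G_def C_def by measurable
  have C_swap [measurable]: "(\<lambda>(x, y). C y x) \<in> borel_measurable (lborel \<Otimes>\<^sub>M lborel)"
    using measurable_pair_swap[of "case_prod C" lborel lborel borel] by simp
  have [measurable]: "case_prod G \<in> borel_measurable lebesgue" "case_prod C \<in> borel_measurable lebesgue"
    "(\<lambda>(x, y). C y x) \<in> borel_measurable lebesgue"
    by (rule measurable_lebesgue_pair; simp)+
  have I_meas [measurable]: "(\<lambda>z. ennreal (I w z) * indicator (C_set \<Omega>) z) \<in> borel_measurable lebesgue"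
    if "w \<in> borel_measurable borel" for w
    using energy_integrand_measurable[OF K that] by (simp add: I_def case_prod_unfold)
  have I_nonneg: "0 \<le> I w z" for w z
    using K by (auto simp: I_def admissible_kernel_def a_nonneg split: prod.splits)
  have real_le: "I v (x, y) + inverse \<Lambda> * (indicator E x * double_kernel (\<lambda>r. gain r \<psi> u x y) x y)
      \<le> I u (x, y) + \<Lambda> * (indicator E x * double_kernel (\<lambda>r. cost r x y) x y
          + indicator E y * double_kernel (\<lambda>r. cost r y x) y x)" for x y
  proof -
    have "(\<bar>v x - v y\<bar> powr p * K1 x y + a x y * \<bar>v x - v y\<bar> powr q * K2 x y)
        + inverse \<Lambda> * double_kernel (\<lambda>r. indicator E x * gain r \<psi> u x y) x y
      \<le> (\<bar>u x - u y\<bar> powr p * K1 x y + a x y * \<bar>u x - u y\<bar> powr q * K2 x y)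
        + \<Lambda> * double_kernel (\<lambda>r. indicator E x * cost r x y + indicator E y * cost r y x) x y"
      using p q by (intro kernel_compare[OF K] pointwise)
        (auto simp: indicator_def gain_nonneg cost_nonneg)
    then show ?thesis
      by (simp only: I_def prod.case double_kernel_cmult double_kernel_add double_kernel_sym[of _ y x])
  qed
  have le: "ennreal (I v z) * indicator (C_set \<Omega>) z + ennreal (inverse \<Lambda>) * case_prod G z
      \<le> ennreal (I u z) * indicator (C_set \<Omega>) z
        + ennreal \<Lambda> * (case_prod C z + (case z of (x, y) \<Rightarrow> C y x))" for z
  proof (cases z)
    case (Pair x y)
    have dk: "0 \<le> double_kernel (\<lambda>r. cost r x y) x y" "0 \<le> double_kernel (\<lambda>r. cost r y x) y x"
      using p q by (auto intro!: double_kernel_nonneg cost_nonneg)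
    have G: "G x y = ennreal (indicator E x * double_kernel (\<lambda>r. gain r \<psi> u x y) x y)"
      and C: "C x y = ennreal (indicator E x * double_kernel (\<lambda>r. cost r x y) x y)"
      "C y x = ennreal (indicator E y * double_kernel (\<lambda>r. cost r y x) y x)"
      by (auto simp: G_def C_def indicator_def)
    show ?thesis
    proof (cases "z \<in> C_set \<Omega>")
      case True
      have g: "0 \<le> indicator E x * double_kernel (\<lambda>r. gain r \<psi> u x y) x y"
        by (auto simp: indicator_def intro!: double_kernel_nonneg gain_nonneg)
      have "ennreal (I v (x, y)) + ennreal (inverse \<Lambda>) * G x y
          = ennreal (I v (x, y) + inverse \<Lambda> * (indicator E x * double_kernel (\<lambda>r. gain r \<psi> u x y) x y))"
        unfolding G using g \<Lambda> I_nonneg by (simp add: ennreal_mult ennreal_plus)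
      also have "\<dots> \<le> ennreal (I u (x, y) + \<Lambda> * (indicator E x * double_kernel (\<lambda>r. cost r x y) x y
          + indicator E y * double_kernel (\<lambda>r. cost r y x) y x))"
        by (intro ennreal_leI real_le)
      also have "\<dots> = ennreal (I u (x, y)) + ennreal \<Lambda> * (C x y + C y x)"
        unfolding C using dk \<Lambda> I_nonneg by (simp add: ennreal_mult ennreal_plus)
      finally show ?thesis using True Pair by simp
    next
      case False
      then have "x \<notin> E" "y \<notin> E" using E_Omega Pair by (auto simp: C_set_def)
      then show ?thesis using False Pair by (simp add: G_def)
    qed
  qed
  have energy: "energy p q K1 K2 a w \<Omega> = (\<integral>\<^sup>+ z. ennreal (I w z) * indicator (C_set \<Omega>) z \<partial>lebesgue)" for w
    unfolding energy_def I_def by (simp add: case_prod_unfold)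
  have pull: "(\<integral>\<^sup>+ y. indicator E x * f y \<partial>lborel) = (\<integral>\<^sup>+ y. f y \<partial>lborel) * indicator E x"
    for x and f :: "real^'n \<Rightarrow> ennreal"
    by (cases "x \<in> E") simp_all
  have G_iterated: "(\<integral>\<^sup>+ x. \<integral>\<^sup>+ y. G x y \<partial>lborel \<partial>lborel) = total_gain"
    unfolding total_gain_def G_def pull ..
  have C_iterated: "(\<integral>\<^sup>+ x. \<integral>\<^sup>+ y. C x y \<partial>lborel \<partial>lborel) = total_cost"
    unfolding total_cost_def C_def pull ..
  have G_int: "(\<integral>\<^sup>+ z. case_prod G z \<partial>lebesgue) = total_gain"
    using nn_integral_lebesgue_pair(1)[OF G_meas] G_iterated by (rule trans)
  have C_int: "(\<integral>\<^sup>+ z. case_prod C z \<partial>lebesgue) = total_cost"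
    using nn_integral_lebesgue_pair(1)[OF C_meas] C_iterated by (rule trans)
  have C_int': "(\<integral>\<^sup>+ z. (case z of (x, y) \<Rightarrow> C y x) \<partial>lebesgue) = total_cost"
    using nn_integral_lebesgue_pair(2)[OF C_swap] C_iterated by (rule trans)
  have "energy p q K1 K2 a v \<Omega> + ennreal (inverse \<Lambda>) * total_gain
      = (\<integral>\<^sup>+ z. ennreal (I v z) * indicator (C_set \<Omega>) z + ennreal (inverse \<Lambda>) * case_prod G z \<partial>lebesgue)"
    unfolding energy G_int[symmetric]
    by (subst nn_integral_add) (auto simp: nn_integral_cmult)
  also have "\<dots> \<le> (\<integral>\<^sup>+ z. ennreal (I u z) * indicator (C_set \<Omega>) z
        + ennreal \<Lambda> * (case_prod C z + (case z of (x, y) \<Rightarrow> C y x)) \<partial>lebesgue)"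
    by (intro nn_integral_mono le)
  also have "\<dots> = energy p q K1 K2 a u \<Omega> + ennreal \<Lambda> * (total_cost + total_cost)"
  proof -
    have "(\<integral>\<^sup>+ z. case_prod C z + (case z of (x, y) \<Rightarrow> C y x) \<partial>lebesgue) = total_cost + total_cost"
      by (subst nn_integral_add) (auto simp: C_int C_int')
    moreover have "(\<lambda>z. case_prod C z + (case z of (x, y) \<Rightarrow> C y x)) \<in> borel_measurable lebesgue"
      by measurable
    ultimately show ?thesis
      unfolding energy by (subst nn_integral_add) (auto simp: nn_integral_cmult)
  qed
  also have "ennreal \<Lambda> * (total_cost + total_cost) = ennreal (2 * \<Lambda>) * total_cost"
  proof -
    have "ennreal (2 * \<Lambda>) = ennreal \<Lambda> + ennreal \<Lambda>"
      using \<Lambda> ennreal_plus[of \<Lambda> \<Lambda>] by simp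
    then show ?thesis by (simp add: algebra_simps)
  qed
  finally show ?thesis .
qed

text \<open>
  The integral that defines membership in \<open>A_space\<close> is the energy for the model kernels, which are
  themselves admissible. So \<open>energy_comparison\<close> also shows that the competitor belongs to \<open>A_space\<close> if the cost is finite.
\<close>
lemma energy_power_kernel:
  "energy p q (\<lambda>x y. 1 / norm (x - y) powr (real CARD('n) + s * p))
      (\<lambda>x y. 1 / norm (x - y) powr (real CARD('n) + t * q)) a w \<Omega>
    = (\<integral>\<^sup>+ z \<in> C_set \<Omega>. (case z of (x, y) \<Rightarrow>
        ennreal (\<bar>w x - w y\<bar> powr p / norm (x - y) powr (real CARD('n) + s * p)
          + a x y * (\<bar>w x - w y\<bar> powr q / norm (x - y) powr (real CARD('n) + t * q)))) \<partial>lebesgue)"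
  unfolding energy_def by (simp add: case_prod_unfold)

lemma competitor_in_A_space:
  assumes u: "u \<in> A_space s t p q a \<Omega>" and cost: "total_cost < \<infinity>"
  shows "v \<in> A_space s t p q a \<Omega>"
proof -
  let ?K = "\<lambda>\<sigma> x y :: real^'n. 1 / norm (x - y) powr (real CARD('n) + \<sigma>)"
  have "energy p q (?K (s * p)) (?K (t * q)) a v \<Omega>
      \<le> energy p q (?K (s * p)) (?K (t * q)) a v \<Omega> + ennreal (inverse \<Lambda>) * total_gain"
    by simp
  also have "\<dots> \<le> energy p q (?K (s * p)) (?K (t * q)) a u \<Omega> + ennreal (2 * \<Lambda>) * total_cost"
    by (intro energy_comparison power_kernel_admissible \<Lambda>)
  also have "\<dots> < \<infinity>"
    using u cost unfolding energy_power_kernel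
    by (simp add: A_space_def ennreal_mult_less_top)
  finally have energy: "energy p q (?K (s * p)) (?K (t * q)) a v \<Omega> < \<infinity>" .
  have \<Omega>_sets [measurable]: "\<Omega> \<in> sets lebesgue" using \<Omega> by auto
  have [measurable]: "u \<in> borel_measurable lebesgue" "v \<in> borel_measurable lebesgue"
    using measurable_completion[of u lborel borel] measurable_completion[of v lborel borel] by simp_all
  have "(\<integral>\<^sup>+ x \<in> \<Omega>. ennreal (\<bar>v x\<bar> powr p) \<partial>lebesgue)
      \<le> (\<integral>\<^sup>+ x. ennreal (\<bar>u x\<bar> powr p) * indicator \<Omega> x + ennreal (k powr p) * indicator \<Omega> x \<partial>lebesgue)"
  proof (intro nn_integral_mono)
    fix x
    have "\<bar>v x\<bar> powr p \<le> \<bar>u x\<bar> powr p + k powr p"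
      using powr_mono2[of p "\<psi> x" k] p \<psi>[of x] by (auto simp: v_def add_increasing)
    then have "ennreal (\<bar>v x\<bar> powr p) \<le> ennreal (\<bar>u x\<bar> powr p) + ennreal (k powr p)"
      by (simp add: ennreal_plus[symmetric] del: ennreal_plus)
    then show "ennreal (\<bar>v x\<bar> powr p) * indicator \<Omega> x
        \<le> ennreal (\<bar>u x\<bar> powr p) * indicator \<Omega> x + ennreal (k powr p) * indicator \<Omega> x"
      by (auto simp: indicator_def)
  qed
  also have "\<dots> = (\<integral>\<^sup>+ x \<in> \<Omega>. ennreal (\<bar>u x\<bar> powr p) \<partial>lebesgue) + ennreal (k powr p) * emeasure lebesgue \<Omega>"
    by (subst nn_integral_add) (auto simp: nn_integral_cmult_indicator)
  also have "\<dots> < \<infinity>"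
  proof -
    have "emeasure lebesgue \<Omega> < \<infinity>"
      using emeasure_bounded_finite[OF \<Omega>(2)] \<Omega>(1) by simp
    then show ?thesis using u by (simp add: A_space_def ennreal_mult_less_top)
  qed
  finally show ?thesis
    using energy unfolding energy_power_kernel by (simp add: A_space_def)
qed

lemma energy_finite:
  assumes w: "w \<in> A_space s t p q a \<Omega>" and [measurable]: "w \<in> borel_measurable borel"
  shows "energy p q Ksp Ktq a w \<Omega> < \<infinity>"
proof -
  let ?K = "\<lambda>\<sigma> x y :: real^'n. 1 / norm (x - y) powr (real CARD('n) + \<sigma>)"
  have "energy p q Ksp Ktq a w \<Omega> \<le> ennreal \<Lambda> * energy p q (?K (s * p)) (?K (t * q)) a w \<Omega>"
  proof -
    have K': "admissible_kernel \<Lambda> (s * p) (?K (s * p))" "admissible_kernel \<Lambda> (t * q) (?K (t * q))"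
      by (intro power_kernel_admissible \<Lambda>)+
    have "(\<integral>\<^sup>+ z \<in> C_set \<Omega>. (case z of (x, y) \<Rightarrow> ennreal (\<bar>w x - w y\<bar> powr p * Ksp x y
            + a x y * \<bar>w x - w y\<bar> powr q * Ktq x y)) \<partial>lebesgue)
        \<le> (\<integral>\<^sup>+ z. ennreal \<Lambda> * ((case z of (x, y) \<Rightarrow> ennreal (\<bar>w x - w y\<bar> powr p * ?K (s * p) x y
            + a x y * \<bar>w x - w y\<bar> powr q * ?K (t * q) x y)) * indicator (C_set \<Omega>) z) \<partial>lebesgue)"
    proof (intro nn_integral_mono)
      fix z :: "(real^'n) \<times> (real^'n)"
      obtain x y where z: "z = (x, y)" by (cases z)
      have "\<bar>w x - w y\<bar> powr p * Ksp x y + a x y * \<bar>w x - w y\<bar> powr q * Ktq x y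
          \<le> \<Lambda> * double_kernel (\<lambda>r. \<bar>w x - w y\<bar> powr r) x y"
        using kernel_compare[OF kernels, where f = "\<lambda>r. \<bar>w x - w y\<bar> powr r" and g = "\<lambda>_. 0"
            and c = "\<lambda>r. \<bar>w x - w y\<bar> powr r" and d = "\<lambda>_. 0" and x = x and y = y]
        by (simp add: double_kernel_def)
      also have "double_kernel (\<lambda>r. \<bar>w x - w y\<bar> powr r) x y = \<bar>w x - w y\<bar> powr p * ?K (s * p) x y
          + a x y * \<bar>w x - w y\<bar> powr q * ?K (t * q) x y"
        by (simp add: double_kernel_def np_def nq_def)
      finally have "ennreal (\<bar>w x - w y\<bar> powr p * Ksp x y + a x y * \<bar>w x - w y\<bar> powr q * Ktq x y)
          \<le> ennreal \<Lambda> * ennreal (\<bar>w x - w y\<bar> powr p * ?K (s * p) x y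
            + a x y * \<bar>w x - w y\<bar> powr q * ?K (t * q) x y)"
        using \<Lambda> by (subst ennreal_mult'[symmetric]) (auto intro!: ennreal_leI)
      then show "(case z of (x, y) \<Rightarrow> ennreal (\<bar>w x - w y\<bar> powr p * Ksp x y
          + a x y * \<bar>w x - w y\<bar> powr q * Ktq x y)) * indicator (C_set \<Omega>) z
        \<le> ennreal \<Lambda> * ((case z of (x, y) \<Rightarrow> ennreal (\<bar>w x - w y\<bar> powr p * ?K (s * p) x y
          + a x y * \<bar>w x - w y\<bar> powr q * ?K (t * q) x y)) * indicator (C_set \<Omega>) z)"
        by (cases "z \<in> C_set \<Omega>") (simp_all add: z)
    qed
    also have "\<dots> = ennreal \<Lambda> * energy p q (?K (s * p)) (?K (t * q)) a w \<Omega>"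
      unfolding energy_def by (intro nn_integral_cmult energy_integrand_measurable K') simp
    finally show ?thesis unfolding energy_def .
  qed
  also have "\<dots> < \<infinity>"
    using w unfolding energy_power_kernel by (simp add: A_space_def ennreal_mult_less_top)
  finally show ?thesis .
qed

lemma total_gain_le:
  assumes cost: "total_cost < \<infinity>"
  shows "total_gain \<le> ennreal (2 * \<Lambda>\<^sup>2) * total_cost"
proof -
  have u: "u \<in> A_space s t p q a \<Omega>" using minimizer by (simp add: is_minimizer_def)
  have "v x = u x" if "x \<notin> \<Omega>" for x using that E_Omega by (auto simp: v_def)
  then have "energy p q Ksp Ktq a u \<Omega> \<le> energy p q Ksp Ktq a v \<Omega>"
    using minimizer competitor_in_A_space[OF u cost] by (simp add: is_minimizer_def)
  then have "energy p q Ksp Ktq a u \<Omega> + ennreal (inverse \<Lambda>) * total_gain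
      \<le> energy p q Ksp Ktq a v \<Omega> + ennreal (inverse \<Lambda>) * total_gain"
    by (rule add_right_mono)
  also have "\<dots> \<le> energy p q Ksp Ktq a u \<Omega> + ennreal (2 * \<Lambda>) * total_cost"
    by (rule energy_comparison[OF kernels])
  finally have le: "ennreal (inverse \<Lambda>) * total_gain \<le> ennreal (2 * \<Lambda>) * total_cost"
    using energy_finite[OF u u_measurable] unfolding ennreal_add_left_cancel_le by auto
  have "total_gain = ennreal \<Lambda> * (ennreal (inverse \<Lambda>) * total_gain)"
    using \<Lambda> by (subst mult.assoc[symmetric], subst ennreal_mult'[symmetric]) simp_all
  also have "\<dots> \<le> ennreal \<Lambda> * (ennreal (2 * \<Lambda>) * total_cost)"
    by (intro mult_left_mono le) simp
  also have "\<dots> = ennreal (2 * \<Lambda>\<^sup>2) * total_cost"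
    using \<Lambda> by (subst mult.assoc[symmetric], subst ennreal_mult'[symmetric])
      (simp_all add: power2_eq_square mult_ac)
  finally show ?thesis .
qed

end

section \<open>The cost of an obstacle\<close>
context double_phase
begin

definition C_coeff :: real where "C_coeff = 1 + 17 * A / lam"

lemma C_coeff: "1 \<le> C_coeff"
  using A lam by (simp add: C_coeff_def)

lemma a_minus_le: "x \<in> ball x0 r \<Longrightarrow> y \<in> ball x0 r \<Longrightarrow> a_minus a x0 r \<le> a x y"
  unfolding a_minus_def
  using cINF_lower[of "\<lambda>(x, y). a x y" "ball x0 r \<times> ball x0 r" "(x, y)"] a_lower
  by (force intro!: bdd_belowI2[where m = lam])

lemma a_minus_ge:
  assumes "0 < r" "\<And>x y. x \<in> ball x0 r \<Longrightarrow> y \<in> ball x0 r \<Longrightarrow> c \<le> a x y"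
  shows "c \<le> a_minus a x0 r"
  unfolding a_minus_def using assms by (intro cINF_greatest) auto

lemma a_minus_lam: "0 < r \<Longrightarrow> lam \<le> a_minus a x0 r"
  using a_lower by (intro a_minus_ge) auto

text \<open>
  Moving \<open>(x, y)\<close> to any pair in the ball changes the coordinates by at most \<open>8 R\<close> and
  \<open>8 R + |x - y|\<close> respectively, so by Hoelder continuity the oscillation is at most a constant times
  \<open>max 1 (|x - y| / R) powr \<alpha>\<close>; it is absorbed into the infimum, which is at least \<open>lam\<close>.
\<close>
lemma a_upper:
  assumes R: "0 < R" "R \<le> 1" and x: "x \<in> ball x0 (4 * R)"
  shows "a x y \<le> a_minus a x0 (4 * R) * C_coeff * max 1 (norm (x - y) / R) powr \<alpha>"
proof -
  define m where "m = max 1 (norm (x - y) / R)"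
  have m: "1 \<le> m" by (simp add: m_def)
  have malpha: "1 \<le> m powr \<alpha>" using m \<alpha> by (simp add: ge_one_powr_ge_zero)
  have "a x y - A * (17 * m powr \<alpha>) \<le> a_minus a x0 (4 * R)"
  proof (rule a_minus_ge)
    fix x' y' assume x': "x' \<in> ball x0 (4 * R)" and y': "y' \<in> ball x0 (4 * R)"
    have "norm (x - x') \<le> 8 * R"
      using x x' dist_triangle3[of x x' x0] by (simp add: dist_norm[symmetric])
    moreover have "norm (y - y') \<le> norm (x - y) + 8 * R"
    proof -
      have "dist y y' \<le> dist y x + dist x y'" by (rule dist_triangle)
      moreover have "dist x y' \<le> 8 * R" using x y' dist_triangle3[of x y' x0] by simp
      ultimately show ?thesis by (simp add: dist_norm norm_minus_commute)
    qed
    moreover have "norm (x - y) \<le> m"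
    proof -
      have "norm (x - y) \<le> norm (x - y) / R"
        using R by (simp add: field_simps mult_left_le_one_le mult_right_le_one_le)
      then show ?thesis by (simp add: m_def)
    qed
    ultimately have "norm (x - x') + norm (y - y') \<le> 17 * m"
      using R m by linarith
    then have "(norm (x - x') + norm (y - y')) powr \<alpha> \<le> (17 * m) powr \<alpha>"
      using \<alpha> by (intro powr_mono2) auto
    also have "\<dots> = 17 powr \<alpha> * m powr \<alpha>" using m by (simp add: powr_mult)
    also have "\<dots> \<le> 17 * m powr \<alpha>"
      using \<alpha> powr_mono[of \<alpha> 1 17] by (intro mult_right_mono) auto
    finally have "A * (norm (x - x') + norm (y - y')) powr \<alpha> \<le> A * (17 * m powr \<alpha>)"
      using A by (intro mult_left_mono) auto
    moreover have "\<bar>a x y - a x' y'\<bar> \<le> A * (norm (x - x') + norm (y - y')) powr \<alpha>"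
      using holder by (simp add: holder_coefficient_def)
    ultimately show "a x y - A * (17 * m powr \<alpha>) \<le> a x' y'" by linarith
  qed (use R in simp)
  moreover define a0 where "a0 = a_minus a x0 (4 * R)"
  have a0: "lam \<le> a0" using a_minus_lam R by (simp add: a0_def)
  have "a0 * 1 \<le> a0 * m powr \<alpha>" using a0 lam malpha by (intro mult_left_mono) auto
  moreover have "A * (17 * m powr \<alpha>) \<le> a0 * (17 * A / lam) * m powr \<alpha>"
  proof -
    have "1 * (A * (17 * m powr \<alpha>)) \<le> (a0 / lam) * (A * (17 * m powr \<alpha>))"
      using a0 lam A by (intro mult_right_mono) auto
    then show ?thesis by (simp add: mult_ac)
  qed
  ultimately have "a x y \<le> a0 * m powr \<alpha> + a0 * (17 * A / lam) * m powr \<alpha>"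
    unfolding a0_def[symmetric] by linarith
  then show ?thesis unfolding a0_def[symmetric] m_def[symmetric] C_coeff_def by (simp add: algebra_simps)
qed

definition C_cost :: real where
  "C_cost = q * 2 powr q * (J * C_coeff + 4 powr nq)"

lemma C_cost_pos: "0 < C_cost"
  using q J C_coeff by (auto simp: C_cost_def intro!: mult_pos_pos add_pos_pos)

lemma level_pos:
  assumes "0 < R" "0 < k"
  shows "0 < level x0 R k"
  using assms a_minus_lam[of "4 * R" x0] lam
  by (auto simp: level_def intro!: add_pos_nonneg divide_pos_pos mult_nonneg_nonneg)

lemma level_times:
  assumes "0 \<le> k"
  shows "k * level x0 R k = k powr p / R powr (s * p) + a_minus a x0 (4 * R) * (k powr q / R powr (t * q))"
  using assms powr_mult_base[of k "p - 1"] powr_mult_base[of k "q - 1"]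
  by (simp add: level_def algebra_simps)

end

context obstacle_in_ball
begin

text \<open>
  One phase of the cost, with \<open>W\<close> standing for \<open>1\<close> or for the coefficient. The steepness \<open>L\<close> leaves the
  truncation at the price of the factor \<open>L powr q\<close>. The negative part of \<open>u\<close> lives
  outside \<open>B(4R)\<close>, where \<open>|y - x0| \<le> 4 |x - y|\<close> because \<open>x\<close> lies in \<open>B(3R)\<close>.
\<close>
lemma phase_cost:
  assumes r: "1 \<le> r" "r \<le> q" and \<nu>: "0 \<le> \<nu>" and x: "x \<in> E"
    and W: "0 \<le> W" "W \<le> B * max 1 (norm (x - y) / R) powr \<beta>" and B: "0 \<le> B"
  shows "W * (cost r x y / norm (x - y) powr \<nu>)
    \<le> r * 2 powr r * k powr r * L powr q * B
        * (max 1 (norm (x - y) / R) powr \<beta> * min 1 (norm (x - y) / R) powr r / norm (x - y) powr \<nu>)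
      + r * 2 powr r * k * 4 powr \<nu>
        * (W * (neg_part u y powr (r - 1) / norm (y - x0) powr \<nu>) * indicator (- ball x0 (4 * R)) y)"
proof -
  define d where "d = norm (x - y)"
  have d: "0 \<le> d" by (simp add: d_def)
  have near: "min 1 (L / R * d) powr r \<le> L powr q * min 1 (d / R) powr r"
  proof -
    have "min 1 (L / R * d) \<le> L * min 1 (d / R)"
    proof (cases "d \<le> R")
      case True
      then have "min 1 (d / R) = d / R" using R by simp
      then show ?thesis by simp
    next
      case False
      then have "min 1 (d / R) = 1" using R by simp
      then show ?thesis using L by linarith
    qed
    then have "min 1 (L / R * d) powr r \<le> (L * min 1 (d / R)) powr r"
      using L R d r by (intro powr_mono2) auto
    also have "\<dots> = L powr r * min 1 (d / R) powr r"
      using L R d by (simp add: powr_mult)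
    also have "\<dots> \<le> L powr q * min 1 (d / R) powr r"
      using L r by (intro mult_right_mono powr_mono) auto
    finally show ?thesis .
  qed
  have far: "neg_part u y powr (r - 1) / d powr \<nu>
    \<le> 4 powr \<nu> * (neg_part u y powr (r - 1) / norm (y - x0) powr \<nu>) * indicator (- ball x0 (4 * R)) y"
  proof (cases "y \<in> ball x0 (4 * R)")
    case True
    then have "neg_part u y = 0" using u_nonneg[of y] by (simp add: neg_part_def)
    then show ?thesis by simp
  next
    case False
    have "dist y x0 \<le> dist y x + dist x x0" by (rule dist_triangle)
    moreover have "dist x x0 < 3 * R" using x E_ball by (auto simp: dist_commute)
    moreover have "4 * R \<le> dist y x0" using False by (simp add: dist_commute)
    ultimately have yd: "norm (y - x0) \<le> 4 * d" and y0: "0 < norm (y - x0)"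
      using R by (auto simp: d_def dist_norm norm_minus_commute)
    then have "norm (y - x0) powr \<nu> \<le> (4 * d) powr \<nu>" using \<nu> by (intro powr_mono2) auto
    also have "\<dots> = 4 powr \<nu> * d powr \<nu>" using d by (simp add: powr_mult)
    finally have "norm (y - x0) powr \<nu> \<le> 4 powr \<nu> * d powr \<nu>" .
    moreover have "0 < d" using yd y0 by linarith
    ultimately have "1 / d powr \<nu> \<le> 4 powr \<nu> / norm (y - x0) powr \<nu>"
      using y0 by (simp add: pos_divide_le_eq pos_le_divide_eq)
    then have "neg_part u y powr (r - 1) * (1 / d powr \<nu>)
        \<le> neg_part u y powr (r - 1) * (4 powr \<nu> / norm (y - x0) powr \<nu>)"
      by (intro mult_left_mono) auto
    then show ?thesis using False by (simp add: mult_ac)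
  qed
  have c: "0 \<le> r * 2 powr r" using r by simp
  have "W * (cost r x y / d powr \<nu>)
      = r * 2 powr r * (k powr r * (W * (min 1 (L / R * d) powr r / d powr \<nu>))
        + k * (W * (neg_part u y powr (r - 1) / d powr \<nu>)))"
    by (simp add: cost_def pair_cost_def d_def neg_part_def algebra_simps add_divide_distrib)
  also have "\<dots> \<le> r * 2 powr r * (k powr r * ((B * max 1 (d / R) powr \<beta>) * (L powr q * min 1 (d / R) powr r / d powr \<nu>))
        + k * (W * (4 powr \<nu> * (neg_part u y powr (r - 1) / norm (y - x0) powr \<nu>) * indicator (- ball x0 (4 * R)) y)))"
  proof (intro mult_left_mono[OF _ c] add_mono)
    show "k powr r * (W * (min 1 (L / R * d) powr r / d powr \<nu>))
        \<le> k powr r * ((B * max 1 (d / R) powr \<beta>) * (L powr q * min 1 (d / R) powr r / d powr \<nu>))"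
      using W B near by (intro mult_left_mono mult_mono divide_right_mono) (auto simp: d_def)
    show "k * (W * (neg_part u y powr (r - 1) / d powr \<nu>))
      \<le> k * (W * (4 powr \<nu> * (neg_part u y powr (r - 1) / norm (y - x0) powr \<nu>) * indicator (- ball x0 (4 * R)) y))"
      using W k far by (intro mult_left_mono) auto
  qed
  finally show ?thesis unfolding d_def by (simp add: algebra_simps)
qed

lemma phase_cost_integral:
  assumes r: "1 \<le> r" "r \<le> q" and \<nu>: "0 \<le> \<nu>" and x: "x \<in> E"
    and W: "\<And>y. 0 \<le> W y" "\<And>y. W y \<le> B * max 1 (norm (x - y) / R) powr \<beta>" and B: "0 \<le> B"
    and [measurable]: "W \<in> borel_measurable borel"
    and mass: "(\<integral>\<^sup>+ y. ennreal (max 1 (norm (x - y) / R) powr \<beta> * min 1 (norm (x - y) / R) powr r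
      / norm (x - y) powr \<nu>) \<partial>lborel) \<le> ennreal m"
    and m: "0 \<le> m"
  shows "(\<integral>\<^sup>+ y. ennreal (W y * (cost r x y / norm (x - y) powr \<nu>)) \<partial>lborel)
    \<le> ennreal (r * 2 powr r * k powr r * L powr q * B * m)
      + ennreal (r * 2 powr r * k * 4 powr \<nu>)
        * (\<integral>\<^sup>+ y \<in> - ball x0 (4 * R). ennreal (W y * (neg_part u y powr (r - 1) / norm (y - x0) powr \<nu>)) \<partial>lborel)"
proof -
  define c1 where "c1 = r * 2 powr r * k powr r * L powr q * B"
  define c2 where "c2 = r * 2 powr r * k * 4 powr \<nu>"
  define f1 where "f1 y = max 1 (norm (x - y) / R) powr \<beta> * min 1 (norm (x - y) / R) powr r
      / norm (x - y) powr \<nu>" for y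
  define f2 where "f2 y = W y * (neg_part u y powr (r - 1) / norm (y - x0) powr \<nu>)" for y
  have c: "0 \<le> c1" "0 \<le> c2" using r B k by (auto simp: c1_def c2_def)
  have f: "0 \<le> f1 y" "0 \<le> f2 y" for y using W R by (auto simp: f1_def f2_def)
  have [measurable]: "f1 \<in> borel_measurable borel" "f2 \<in> borel_measurable borel"
    unfolding f1_def f2_def neg_part_def by measurable
  have [measurable]: "- ball x0 (4 * R) \<in> sets borel" by simp
  have "(\<integral>\<^sup>+ y. ennreal (W y * (cost r x y / norm (x - y) powr \<nu>)) \<partial>lborel)
      \<le> (\<integral>\<^sup>+ y. ennreal c1 * ennreal (f1 y) + ennreal c2 * (ennreal (f2 y) * indicator (- ball x0 (4 * R)) y) \<partial>lborel)"
  proof (intro nn_integral_mono)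
    fix y
    have "W y * (cost r x y / norm (x - y) powr \<nu>) \<le> c1 * f1 y + c2 * (f2 y * indicator (- ball x0 (4 * R)) y)"
      using phase_cost[OF r \<nu> x W B] by (simp add: c1_def c2_def f1_def f2_def)
    then have "ennreal (W y * (cost r x y / norm (x - y) powr \<nu>))
        \<le> ennreal (c1 * f1 y + c2 * (f2 y * indicator (- ball x0 (4 * R)) y))"
      by (rule ennreal_leI)
    also have "\<dots> = ennreal c1 * ennreal (f1 y) + ennreal c2 * (ennreal (f2 y) * indicator (- ball x0 (4 * R)) y)"
      using c f by (auto simp: indicator_def ennreal_mult ennreal_plus)
    finally show "ennreal (W y * (cost r x y / norm (x - y) powr \<nu>)) \<le> \<dots>" .
  qed
  also have "\<dots> = ennreal c1 * (\<integral>\<^sup>+ y. ennreal (f1 y) \<partial>lborel)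
      + ennreal c2 * (\<integral>\<^sup>+ y \<in> - ball x0 (4 * R). ennreal (f2 y) \<partial>lborel)"
    by (subst nn_integral_add) (auto simp: nn_integral_cmult)
  also have "\<dots> \<le> ennreal c1 * ennreal m
      + ennreal c2 * (\<integral>\<^sup>+ y \<in> - ball x0 (4 * R). ennreal (f2 y) \<partial>lborel)"
    using mass by (intro add_right_mono mult_left_mono) (auto simp: f1_def)
  also have "ennreal c1 * ennreal m = ennreal (c1 * m)" using c m by (simp add: ennreal_mult)
  finally show ?thesis unfolding c1_def c2_def f2_def .
qed

text \<open>
  The two phases together: the Lipschitz part costs \<open>k\<^sup>p / R\<^sup>s\<^sup>p\<close> plus \<open>k\<^sup>q / R\<^sup>t\<^sup>q\<close> times the infimum
  of the coefficient, that is \<open>k h(k)\<close>, and the tails of the negative part enter as \<open>k\<close> times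
  a quantity that is at most \<open>h(k)\<close>.
\<close>
lemma cost_integral:
  assumes x: "x \<in> E"
  shows "(\<integral>\<^sup>+ y. ennreal (double_kernel (\<lambda>r. cost r x y) x y) \<partial>lborel)
    \<le> ennreal (C_cost * L powr q * (k * level x0 R k))"
proof -
  define a0 where "a0 = a_minus a x0 (4 * R)"
  have a0: "0 < a0" using a_minus_lam[of "4 * R" x0] R lam by (simp add: a0_def)
  have x4: "x \<in> ball x0 (4 * R)" using x E_ball R by auto
  define Tp where "Tp = Tail s p (neg_part u) x0 (4 * R)"
  define Tq where "Tq = Tail_a t q a (neg_part u) x0 (4 * R)"
  have np: "0 \<le> np" "0 \<le> nq" using sp tq by (auto simp: np_def nq_def)
  have [measurable]: "(\<lambda>y. cost r x y) \<in> borel_measurable borel" for r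
    unfolding cost_def pair_cost_def by measurable
  have P: "(\<integral>\<^sup>+ y. ennreal (1 * (cost p x y / norm (x - y) powr np)) \<partial>lborel)
      \<le> ennreal (p * 2 powr p * k powr p * L powr q * 1 * (J / R powr (s * p)))
        + ennreal (p * 2 powr p * k * 4 powr np) * Tp"
  proof -
    have "Tp = (\<integral>\<^sup>+ y \<in> - ball x0 (4 * R). ennreal (1 * (neg_part u y powr (p - 1) / norm (y - x0) powr np)) \<partial>lborel)"
      by (simp add: Tp_def Tail_def np_def nn_integral_completion)
    then show ?thesis
      using phase_cost_integral[of p np x "\<lambda>_. 1" 1 0 "J / R powr (s * p)"] p pq np x J mass_p[OF R(1), of x]
      by (simp add: np_def)
  qed
  have Q: "(\<integral>\<^sup>+ y. ennreal (a x y * (cost q x y / norm (x - y) powr nq)) \<partial>lborel)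
      \<le> ennreal (q * 2 powr q * k powr q * L powr q * (a0 * C_coeff) * (J / R powr (t * q)))
        + ennreal (q * 2 powr q * k * 4 powr nq) * Tq"
  proof -
    have "(\<integral>\<^sup>+ y \<in> - ball x0 (4 * R). ennreal (a x y * (neg_part u y powr (q - 1) / norm (y - x0) powr nq)) \<partial>lborel)
       = (\<integral>\<^sup>+ y \<in> - ball x0 (4 * R). ennreal (a y x * (neg_part u y powr (q - 1) / norm (y - x0) powr (real CARD('n) + t * q))) \<partial>lebesgue)"
      by (simp add: nq_def nn_integral_completion a_sym[of x])
    also have "\<dots> \<le> Tq"
      unfolding Tq_def Tail_a_def using x4 by (intro SUP_upper)
    finally have Tq: "(\<integral>\<^sup>+ y \<in> - ball x0 (4 * R). ennreal (a x y * (neg_part u y powr (q - 1) / norm (y - x0) powr nq)) \<partial>lborel) \<le> Tq" .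
    have "(\<integral>\<^sup>+ y. ennreal (a x y * (cost q x y / norm (x - y) powr nq)) \<partial>lborel)
      \<le> ennreal (q * 2 powr q * k powr q * L powr q * (a0 * C_coeff) * (J / R powr (t * q)))
        + ennreal (q * 2 powr q * k * 4 powr nq)
          * (\<integral>\<^sup>+ y \<in> - ball x0 (4 * R). ennreal (a x y * (neg_part u y powr (q - 1) / norm (y - x0) powr nq)) \<partial>lborel)"
    proof (rule phase_cost_integral)
      show "a x y \<le> a0 * C_coeff * max 1 (norm (x - y) / R) powr \<alpha>" for y
        unfolding a0_def by (rule a_upper[OF R x4])
      show "(\<integral>\<^sup>+ y. ennreal (max 1 (norm (x - y) / R) powr \<alpha> * min 1 (norm (x - y) / R) powr q
          / norm (x - y) powr nq) \<partial>lborel) \<le> ennreal (J / R powr (t * q))"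
        unfolding nq_def by (rule mass_q[OF R(1)])
    qed (use q np x J C_coeff a0 a_nonneg in auto)
    also have "\<dots> \<le> ennreal (q * 2 powr q * k powr q * L powr q * (a0 * C_coeff) * (J / R powr (t * q)))
        + ennreal (q * 2 powr q * k * 4 powr nq) * Tq"
      by (intro add_left_mono mult_left_mono Tq) simp
    finally show ?thesis .
  qed
  have "(\<integral>\<^sup>+ y. ennreal (double_kernel (\<lambda>r. cost r x y) x y) \<partial>lborel)
      = (\<integral>\<^sup>+ y. ennreal (1 * (cost p x y / norm (x - y) powr np)) \<partial>lborel)
        + (\<integral>\<^sup>+ y. ennreal (a x y * (cost q x y / norm (x - y) powr nq)) \<partial>lborel)"
    unfolding double_kernel_def using p q
    by (subst nn_integral_add[symmetric]) (auto simp: cost_nonneg a_nonneg intro!: nn_integral_cong)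
  also have "\<dots> \<le> (ennreal (p * 2 powr p * k powr p * L powr q * 1 * (J / R powr (s * p)))
        + ennreal (p * 2 powr p * k * 4 powr np) * Tp)
      + (ennreal (q * 2 powr q * k powr q * L powr q * (a0 * C_coeff) * (J / R powr (t * q)))
        + ennreal (q * 2 powr q * k * 4 powr nq) * Tq)"
    by (intro add_mono P Q)
  also have "\<dots> \<le> (ennreal (q * 2 powr q * L powr q * J * C_coeff * (k powr p / R powr (s * p)))
        + ennreal (q * 2 powr q * k * 4 powr nq) * Tp)
      + (ennreal (q * 2 powr q * L powr q * J * C_coeff * (a0 * (k powr q / R powr (t * q))))
        + ennreal (q * 2 powr q * k * 4 powr nq) * Tq)"
  proof -
    \<comment> \<open>The constants of the \<open>p\<close>-phase are dominated by those of the \<open>q\<close>-phase.\<close>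
    have pq2: "p * 2 powr p \<le> q * 2 powr q" using p pq by (intro mult_mono) auto
    have nn: "4 powr np \<le> 4 powr nq" using sp_tq by (auto simp: np_def nq_def)
    have "(p * 2 powr p) * (k powr p * L powr q * (J / R powr (s * p)))
        \<le> (q * 2 powr q * C_coeff) * (k powr p * L powr q * (J / R powr (s * p)))"
    proof (rule mult_right_mono)
      have "p * 2 powr p * 1 \<le> q * 2 powr q * C_coeff"
        using pq2 C_coeff p pq by (intro mult_mono) auto
      then show "p * 2 powr p \<le> q * 2 powr q * C_coeff" by simp
    qed (use J in simp)
    moreover have "p * 2 powr p * k * 4 powr np \<le> q * 2 powr q * k * 4 powr nq"
      using pq2 nn k p pq by (intro mult_mono) auto
    ultimately show ?thesis
      using k by (intro add_mono mult_right_mono ennreal_leI) (auto simp: mult_ac)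
  qed
  also have "\<dots> = ennreal (q * 2 powr q * L powr q * J * C_coeff * (k * level x0 R k))
      + ennreal (q * 2 powr q * k * 4 powr nq) * (Tp + Tq)"
  proof -
    have "ennreal (q * 2 powr q * L powr q * J * C_coeff * (k * level x0 R k))
        = ennreal (q * 2 powr q * L powr q * J * C_coeff * (k powr p / R powr (s * p)))
          + ennreal (q * 2 powr q * L powr q * J * C_coeff * (a0 * (k powr q / R powr (t * q))))"
      using q J C_coeff a0 k by (subst ennreal_plus[symmetric]) (auto simp: level_times a0_def distrib_left)
    then show ?thesis by (simp add: distrib_left add_ac)
  qed
  also have "\<dots> \<le> ennreal (q * 2 powr q * L powr q * J * C_coeff * (k * level x0 R k))
      + ennreal (q * 2 powr q * k * 4 powr nq) * ennreal (level x0 R k)"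
    using tails by (intro add_left_mono mult_left_mono) (auto simp: Tp_def Tq_def)
  also have "\<dots> = ennreal (q * 2 powr q * L powr q * J * C_coeff * (k * level x0 R k)
      + q * 2 powr q * k * 4 powr nq * level x0 R k)"
    using level_pos[OF R(1) k, of x0] q J C_coeff k by (simp add: ennreal_plus ennreal_mult)
  also have "\<dots> \<le> ennreal (C_cost * L powr q * (k * level x0 R k))"
  proof (rule ennreal_leI)
    have "1 \<le> L powr q" using L q by (simp add: ge_one_powr_ge_zero)
    then have "(q * 2 powr q * 4 powr nq * (k * level x0 R k)) * 1
        \<le> (q * 2 powr q * 4 powr nq * (k * level x0 R k)) * L powr q"
      using level_pos[OF R(1) k, of x0] q k by (intro mult_left_mono) auto
    then show "q * 2 powr q * L powr q * J * C_coeff * (k * level x0 R k)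
      + q * 2 powr q * k * 4 powr nq * level x0 R k \<le> C_cost * L powr q * (k * level x0 R k)"
      by (simp add: C_cost_def algebra_simps)
  qed
  finally show ?thesis .
qed

lemma E_finite: "emeasure lborel E < \<infinity>"
proof -
  have "bounded E" using E_ball bounded_ball by (rule bounded_subset[rotated])
  then show ?thesis by (rule emeasure_bounded_finite)
qed

lemma total_cost_bound:
  "total_cost \<le> ennreal (C_cost * L powr q * (k * level x0 R k) * measure lborel E)"
proof -
  define c where "c = C_cost * L powr q * (k * level x0 R k)"
  have c: "0 \<le> c" using C_cost_pos level_pos[OF R(1) k, of x0] k by (simp add: c_def)
  have "total_cost \<le> (\<integral>\<^sup>+ x. ennreal c * indicator E x \<partial>lborel)"
    unfolding total_cost_def c_def
  proof (intro nn_integral_mono)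
    fix x
    show "(\<integral>\<^sup>+ y. ennreal (double_kernel (\<lambda>r. cost r x y) x y) \<partial>lborel) * indicator E x
      \<le> ennreal (C_cost * L powr q * (k * level x0 R k)) * indicator E x"
      using cost_integral[of x] by (cases "x \<in> E") simp_all
  qed
  also have "\<dots> = ennreal c * emeasure lborel E"
    by (rule nn_integral_cmult_indicator) simp
  also have "\<dots> = ennreal (c * measure lborel E)"
    using E_finite c by (simp add: emeasure_eq_ennreal_measure ennreal_mult)
  finally show ?thesis unfolding c_def .
qed

lemma obstacle_measure_bound:
  assumes S: "S \<subseteq> E" "S \<in> sets borel" and g: "0 \<le> g"
    and gain: "\<And>x. x \<in> S \<Longrightarrow> ennreal g \<le> (\<integral>\<^sup>+ y. ennreal (double_kernel (\<lambda>r. gain r \<psi> u x y) x y) \<partial>lborel)"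
  shows "g * measure lborel S \<le> 2 * \<Lambda>\<^sup>2 * C_cost * L powr q * (k * level x0 R k) * measure lborel E"
proof -
  define c where "c = C_cost * L powr q * (k * level x0 R k) * measure lborel E"
  have c: "0 \<le> c" using C_cost_pos level_pos[OF R(1) k, of x0] k by (simp add: c_def)
  have S_fin: "emeasure lborel S < \<infinity>"
    using emeasure_mono[of S E lborel] S E_finite by (auto simp: less_top[symmetric] top_unique)
  have "ennreal (g * measure lborel S) = ennreal g * emeasure lborel S"
    using S_fin g by (simp add: emeasure_eq_ennreal_measure ennreal_mult)
  also have "\<dots> = (\<integral>\<^sup>+ x. ennreal g * indicator S x \<partial>lborel)"
    using S by (simp add: nn_integral_cmult_indicator)
  also have "\<dots> \<le> total_gain"
    unfolding total_gain_def
    using gain S by (intro nn_integral_mono) (auto simp: indicator_def)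
  also have "\<dots> \<le> ennreal (2 * \<Lambda>\<^sup>2) * total_cost"
    using total_cost_bound by (intro total_gain_le) (auto simp: le_less_trans)
  also have "\<dots> \<le> ennreal (2 * \<Lambda>\<^sup>2) * ennreal c"
    using total_cost_bound by (intro mult_left_mono) (auto simp: c_def)
  also have "\<dots> = ennreal (2 * \<Lambda>\<^sup>2 * c)" using c by (simp add: ennreal_mult)
  finally have "g * measure lborel S \<le> 2 * \<Lambda>\<^sup>2 * c"
    using c by (simp add: ennreal_le_iff)
  then show ?thesis by (simp add: c_def mult_ac)
qed

end

section \<open>A bound for sublevel sets\<close>
lemma ennreal_le_add_cancel:
  assumes "ennreal x \<le> X + ennreal y" "0 \<le> y"
  shows "ennreal (x - y) \<le> X"
proof (cases X)
  case (real z)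
  then have "x \<le> z + y"
    using assms by (simp add: ennreal_plus[symmetric] ennreal_le_iff del: ennreal_plus)
  then show ?thesis using real by (simp add: ennreal_leI)
qed simp

lemma power_powr_swap: "0 \<le> x \<Longrightarrow> (x ^ j) powr e = (x powr e) ^ j" for x e :: real
  by (induction j) (auto simp: powr_mult)

definition cutoff :: "'a::real_normed_vector \<Rightarrow> real \<Rightarrow> real \<Rightarrow> 'a \<Rightarrow> real" where
  "cutoff x0 r \<delta> x = max 0 (min 1 ((r - norm (x - x0)) / \<delta>))"

lemma cutoff_range: "0 \<le> cutoff x0 r \<delta> x" "cutoff x0 r \<delta> x \<le> 1"
  by (auto simp: cutoff_def)

lemma cutoff_eq_1: "0 < \<delta> \<Longrightarrow> norm (x - x0) \<le> r - \<delta> \<Longrightarrow> cutoff x0 r \<delta> x = 1"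
  by (simp add: cutoff_def)

lemma cutoff_eq_0: "0 < \<delta> \<Longrightarrow> r \<le> norm (x - x0) \<Longrightarrow> cutoff x0 r \<delta> x = 0"
  by (simp add: cutoff_def min_def divide_le_0_iff)

lemma cutoff_lipschitz:
  assumes "0 < \<delta>"
  shows "\<bar>cutoff x0 r \<delta> x - cutoff x0 r \<delta> y\<bar> \<le> norm (x - y) / \<delta>"
proof -
  have "\<bar>cutoff x0 r \<delta> x - cutoff x0 r \<delta> y\<bar> \<le> \<bar>(r - norm (x - x0)) / \<delta> - (r - norm (y - x0)) / \<delta>\<bar>"
    unfolding cutoff_def by linarith
  also have "\<dots> = \<bar>norm (y - x0) - norm (x - x0)\<bar> / \<delta>"
    using assms by (simp add: diff_divide_distrib[symmetric])
  also have "\<dots> \<le> norm (x - y) / \<delta>"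
    using assms norm_triangle_ineq3[of "y - x0" "x - x0"] by (intro divide_right_mono) (auto simp: norm_minus_commute)
  finally show ?thesis .
qed

context minimizer_in_ball
begin

lemma sublevel_measurable [measurable]: "{x \<in> ball x0 r. u x < c} \<in> sets borel"
proof -
  have [measurable]: "ball x0 r \<in> sets borel" by simp
  have "{x \<in> ball x0 r. u x < c} = ball x0 r \<inter> {x \<in> space borel. u x < c}" by auto
  also have "\<dots> \<in> sets borel" by measurable
  finally show ?thesis .
qed

lemma sublevel_finite: "emeasure lborel {x \<in> ball x0 r. u x < c} < \<infinity>"
  by (intro emeasure_bounded_finite bounded_subset[OF bounded_ball[of x0 r]]) auto

text \<open>
  The form in which minimality is used from now on. The obstacle is a cutoff of the ball of
  radius \<open>r\<close> at height \<open>\<kappa>\<close>, with slope zone of width \<open>R / L\<close>; if every point of \<open>S\<close>, where the obstacle is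
  flat, gains at least \<open>g\<close>, then the measure of \<open>S\<close> is controlled by that of the sublevel set in the
  larger ball.
\<close>
lemma level_set_bound:
  assumes \<kappa>: "0 < \<kappa>" "\<kappa> \<le> k" and L: "1 \<le> L" and r: "r \<le> 3 * R"
    and S: "S \<subseteq> {x. norm (x - x0) \<le> r - R / L \<and> u x < \<kappa>}" "S \<in> sets borel" and g: "0 \<le> g"
    and gain: "\<And>x. x \<in> S \<Longrightarrow>
      ennreal g \<le> (\<integral>\<^sup>+ y. ennreal (double_kernel (\<lambda>r. gain r (\<lambda>_. \<kappa>) u x y) x y) \<partial>lborel)"
  shows "g * measure lborel S
    \<le> 2 * \<Lambda>\<^sup>2 * C_cost * L powr q * (k * level x0 R k) * measure lborel {x \<in> ball x0 r. u x < \<kappa>}"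
proof -
  define \<psi> where "\<psi> x = \<kappa> * cutoff x0 r (R / L) x" for x
  have RL: "0 < R / L" using R L by simp
  interpret obstacle_in_ball s t p q \<Lambda> \<alpha> A lam J a u x0 R \<Omega> Ksp Ktq k L \<psi>
  proof
    show "1 \<le> L" by fact
    show "0 \<le> \<psi> x" for x using \<kappa> cutoff_range[of x0 r "R / L" x] by (simp add: \<psi>_def)
    show "\<psi> x \<le> k" for x
      using \<kappa> cutoff_range[of x0 r "R / L" x] mult_mono[of \<kappa> k "cutoff x0 r (R / L) x" 1]
      by (simp add: \<psi>_def)
    show "\<bar>\<psi> x - \<psi> y\<bar> \<le> k * (L / R * norm (x - y))" for x y
    proof -
      have "\<bar>\<psi> x - \<psi> y\<bar> = \<kappa> * \<bar>cutoff x0 r (R / L) x - cutoff x0 r (R / L) y\<bar>"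
        using \<kappa> by (simp add: \<psi>_def right_diff_distrib[symmetric] abs_mult)
      also have "\<dots> \<le> k * (norm (x - y) / (R / L))"
        using \<kappa> by (intro mult_mono cutoff_lipschitz RL) auto
      finally show ?thesis by (simp add: mult_ac)
    qed
    show "\<psi> x = 0" if "x \<notin> ball x0 (3 * R)" for x
      using that r cutoff_eq_0[OF RL, of r x x0] by (simp add: \<psi>_def dist_norm norm_minus_commute)
  qed
  have \<psi>_S: "\<psi> x = \<kappa>" if "x \<in> S" for x
    using that S cutoff_eq_1[OF RL, of x x0 r] by (auto simp: \<psi>_def)
  have "S \<subseteq> E"
  proof
    fix x assume x: "x \<in> S"
    then have "norm (x - x0) < 3 * R" using S r RL by (auto simp: subset_iff)
    then show "x \<in> E" using x S \<psi>_S[OF x] by (auto simp: E_def dist_norm norm_minus_commute)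
  qed
  moreover have "ennreal g \<le> (\<integral>\<^sup>+ y. ennreal (double_kernel (\<lambda>r. gain r \<psi> u x y) x y) \<partial>lborel)" if "x \<in> S" for x
    using gain[OF that] unfolding gain_def \<psi>_S[OF that] .
  ultimately have "g * measure lborel S
      \<le> 2 * \<Lambda>\<^sup>2 * C_cost * L powr q * (k * level x0 R k) * measure lborel E"
    using S g by (intro obstacle_measure_bound) auto
  also have "\<dots> \<le> 2 * \<Lambda>\<^sup>2 * C_cost * L powr q * (k * level x0 R k) * measure lborel {x \<in> ball x0 r. u x < \<kappa>}"
  proof (intro mult_left_mono measure_mono_fmeasurable)
    show "E \<subseteq> {x \<in> ball x0 r. u x < \<kappa>}"
    proof
      fix x assume x: "x \<in> E"
      then have "0 < \<psi> x" "u x < \<psi> x" using E_bounds[OF x] by auto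
      moreover have "\<psi> x \<le> \<kappa>" using \<kappa> cutoff_range[of x0 r "R / L" x] by (simp add: \<psi>_def)
      moreover have "norm (x - x0) < r"
        using \<open>0 < \<psi> x\<close> cutoff_eq_0[OF RL, of r x x0] by (force simp: \<psi>_def)
      ultimately show "x \<in> {x \<in> ball x0 r. u x < \<kappa>}" by (simp add: dist_norm norm_minus_commute)
    qed
    show "{x \<in> ball x0 r. u x < \<kappa>} \<in> fmeasurable lborel"
      using sublevel_finite by (intro fmeasurableI) auto
  qed (use C_cost_pos level_pos[OF R(1) k, of x0] k in auto)
  finally show ?thesis .
qed

end

section \<open>Constants of the iteration\<close>
context double_phase
begin

definition c_gain :: real where "c_gain = 2 powr (- 1 - q - nq)"

lemma c_gain_pos: "0 < c_gain" by (simp add: c_gain_def)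

definition \<omega> :: real where "\<omega> = unit_ball_vol (real CARD('n))"

lemma \<omega>_pos: "0 < \<omega>" by (simp add: \<omega>_def)

definition C_step :: real where "C_step = 4 * \<Lambda>\<^sup>2 * C_cost * 2 powr (4 * q) / \<omega>"

lemma C_step_pos: "0 < C_step"
  using \<Lambda> C_cost_pos \<omega>_pos by (simp add: C_step_def)

text \<open>
  The \<open>j\<close>-th radius in the iteration will be \<open>R * \<delta> * \<theta> ^ j\<close>. The ratio \<open>\<theta>\<close> is chosen so
  that \<open>\<theta> powr (s * p)\<close> compensates the growth \<open>4 powr q\<close> per step, and \<open>\<delta>\<close> so that each step
  multiplies the measure by at most \<open>\<theta> ^ n\<close>.
\<close>
definition \<theta> :: real where "\<theta> = (1/2) powr (2 * q / (s * p))"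

definition \<delta> :: real where
  "\<delta> = min (1/2) ((\<theta> ^ CARD('n) / C_step) powr (1 / (s * p)))"

lemma \<theta>: "0 < \<theta>" "\<theta> \<le> 1/2" "\<theta> powr (s * p) = (1/4) powr q"
proof -
  show "0 < \<theta>" by (simp add: \<theta>_def)
  have "s * p \<le> 2 * q" using sp_p pq p by linarith
  then have "1 \<le> 2 * q / (s * p)" using sp by (simp add: pos_le_divide_eq)
  then have "\<theta> \<le> (1/2) powr 1" unfolding \<theta>_def by (intro powr_mono') auto
  then show "\<theta> \<le> 1/2" by simp
  have "\<theta> powr (s * p) = (1/2) powr (2 * q)" using s p by (simp add: \<theta>_def powr_powr)
  also have "\<dots> = ((1/2) powr 2) powr q" by (simp only: powr_powr)
  also have "(1/2) powr 2 = (1/4 :: real)" by (simp add: powr_numeral power2_eq_square)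
  finally show "\<theta> powr (s * p) = (1/4) powr q" .
qed

lemma \<delta>: "0 < \<delta>" "\<delta> \<le> 1/2" "C_step * \<delta> powr (s * p) \<le> \<theta> ^ CARD('n)"
proof -
  show "0 < \<delta>" using \<theta> C_step_pos by (simp add: \<delta>_def)
  show "\<delta> \<le> 1/2" by (simp add: \<delta>_def)
  have "\<delta> powr (s * p) \<le> ((\<theta> ^ CARD('n) / C_step) powr (1 / (s * p))) powr (s * p)"
    using \<open>0 < \<delta>\<close> sp by (intro powr_mono2) (auto simp: \<delta>_def)
  also have "\<dots> = \<theta> ^ CARD('n) / C_step"
    using sp s p \<theta> C_step_pos by (simp add: powr_powr)
  finally show "C_step * \<delta> powr (s * p) \<le> \<theta> ^ CARD('n)"
    using C_step_pos by (simp add: field_simps)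
qed

text \<open>
  How many times larger than \<open>h(k)\<close> the tails of the positive part have to be. The first entry makes the
  part of a tail where \<open>u < 2 k\<close> negligible, the second one makes the first sublevel set small enough for
  the iteration to start.
\<close>
definition tail_factor :: real where
  "tail_factor = max (2 * (2 powr q * J)) (4 * \<Lambda>\<^sup>2 * C_cost * 3 ^ CARD('n) / (c_gain * \<delta> ^ CARD('n)))"

lemma tail_factor_pos: "0 < tail_factor"
  using J by (auto simp: tail_factor_def less_max_iff_disj)

end

section \<open>Large tails make a sublevel set small\<close>
context minimizer_in_ball
begin

text \<open>
  Only the points where \<open>u\<close> exceeds \<open>2 k\<close> produce a good gain; the rest of the tail is at most of order
  \<open>k powr (r - 1)\<close> times the mass of the kernel.
\<close>
lemma truncated_tail:
  assumes r: "1 < r" and \<nu>: "0 \<le> \<nu>"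
    and mass: "(\<integral>\<^sup>+ y. ennreal (max 1 (norm (x0 - y) / R) powr \<beta> * min 1 (norm (x0 - y) / R) powr r
        / norm (x0 - y) powr \<nu>) \<partial>lborel) \<le> ennreal m"
    and m: "0 \<le> m" and \<beta>: "0 \<le> \<beta>"
  shows "(\<integral>\<^sup>+ y \<in> - ball x0 (2 * R). ennreal (pos_part u y powr (r - 1) / norm (y - x0) powr \<nu>) \<partial>lborel)
    \<le> (\<integral>\<^sup>+ y \<in> {y. y \<notin> ball x0 (2 * R) \<and> 2 * k \<le> u y}. ennreal (u y powr (r - 1) / norm (y - x0) powr \<nu>) \<partial>lborel)
      + ennreal ((2 * k) powr (r - 1) * m)"
proof -
  define B where "B = {y. y \<notin> ball x0 (2 * R) \<and> 2 * k \<le> u y}"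
  have "B = (- ball x0 (2 * R)) \<inter> {y \<in> space borel. 2 * k \<le> u y}" by (auto simp: B_def)
  also have "\<dots> \<in> sets borel" by (intro sets.Int) (auto intro: borel_measurable_le)
  finally have [measurable]: "B \<in> sets borel" .
  define M where "M y = max 1 (norm (x0 - y) / R) powr \<beta> * min 1 (norm (x0 - y) / R) powr r
        / norm (x0 - y) powr \<nu>" for y
  have [measurable]: "M \<in> borel_measurable borel" unfolding M_def by measurable
  have "(\<integral>\<^sup>+ y \<in> - ball x0 (2 * R). ennreal (pos_part u y powr (r - 1) / norm (y - x0) powr \<nu>) \<partial>lborel)
      \<le> (\<integral>\<^sup>+ y. ennreal (u y powr (r - 1) / norm (y - x0) powr \<nu>) * indicator B y
          + ennreal ((2 * k) powr (r - 1)) * ennreal (M y) \<partial>lborel)"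
  proof (intro nn_integral_mono)
    fix y
    consider "y \<in> ball x0 (2 * R)" | "y \<in> B" | "y \<notin> ball x0 (2 * R)" "u y < 2 * k"
      by (force simp: B_def)
    then show "ennreal (pos_part u y powr (r - 1) / norm (y - x0) powr \<nu>) * indicator (- ball x0 (2 * R)) y
      \<le> ennreal (u y powr (r - 1) / norm (y - x0) powr \<nu>) * indicator B y
          + ennreal ((2 * k) powr (r - 1)) * ennreal (M y)"
    proof cases
      case 1
      then show ?thesis by simp
    next
      case 2
      then have "pos_part u y = u y" using k by (simp add: B_def pos_part_def)
      then show ?thesis using 2 by (auto simp: indicator_def)
    next
      case 3
      then have "R \<le> norm (x0 - y)" using R by (simp add: dist_norm)
      then have "1 \<le> norm (x0 - y) / R" using R by simp
      then have M: "1 / norm (y - x0) powr \<nu> \<le> M y"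
        using ge_one_powr_ge_zero[of "norm (x0 - y) / R" \<beta>] \<beta>
        by (auto simp: M_def norm_minus_commute intro!: divide_right_mono)
      have "pos_part u y powr (r - 1) \<le> (2 * k) powr (r - 1)"
        using 3 k r by (intro powr_mono2) (auto simp: pos_part_def)
      then have "pos_part u y powr (r - 1) * (1 / norm (y - x0) powr \<nu>) \<le> (2 * k) powr (r - 1) * M y"
        using M by (intro mult_mono) auto
      then have "ennreal (pos_part u y powr (r - 1) / norm (y - x0) powr \<nu>) \<le> ennreal ((2 * k) powr (r - 1) * M y)"
        by (intro ennreal_leI) simp
      also have "\<dots> = ennreal ((2 * k) powr (r - 1)) * ennreal (M y)"
        by (intro ennreal_mult') simp
      finally show ?thesis using 3 by (simp add: add_increasing)
    qed
  qed
  also have "\<dots> = (\<integral>\<^sup>+ y \<in> B. ennreal (u y powr (r - 1) / norm (y - x0) powr \<nu>) \<partial>lborel)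
      + ennreal ((2 * k) powr (r - 1)) * (\<integral>\<^sup>+ y. ennreal (M y) \<partial>lborel)"
    by (subst nn_integral_add) (auto simp: nn_integral_cmult)
  also have "\<dots> \<le> (\<integral>\<^sup>+ y \<in> B. ennreal (u y powr (r - 1) / norm (y - x0) powr \<nu>) \<partial>lborel)
      + ennreal ((2 * k) powr (r - 1)) * ennreal m"
    using mass by (intro add_left_mono mult_left_mono) (auto simp: M_def)
  also have "ennreal ((2 * k) powr (r - 1)) * ennreal m = ennreal ((2 * k) powr (r - 1) * m)"
    using m by (simp add: ennreal_mult)
  finally show ?thesis unfolding B_def .
qed

text \<open>
  If \<open>u x < k / 2\<close> and \<open>u y \<ge> 2 k\<close>, then \<open>k - u x \<ge> k / 2\<close> and \<open>u y - u x \<ge> u y / 2\<close>, while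
  \<open>|x - y| \<le> 2 |y - x0|\<close> for \<open>y\<close> outside \<open>B(2R)\<close>. So the gain of \<open>x\<close> against such \<open>y\<close> is at least a multiple of
  \<open>k\<close> times the tails. Far away only \<open>lam\<close> is available as lower bound of the coefficient, whence
  the factor \<open>lam\<close> in the second hypothesis on the tails.
\<close>
lemma tail_gain:
  assumes N: "2 * (2 powr q * J) \<le> N"
    and Tp: "ennreal (N * (k powr (p - 1) / R powr (s * p))) \<le> Tail s p (pos_part u) x0 (2 * R)"
    and Tq: "ennreal (N * (a_minus a x0 (4 * R) * (k powr (q - 1) / R powr (t * q))))
      \<le> ennreal lam * Tail t q (pos_part u) x0 (2 * R)"
    and x: "x \<in> ball x0 (2 * R)" "u x < k / 2"
  shows "ennreal (c_gain * N * (k * level x0 R k))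
    \<le> (\<integral>\<^sup>+ y. ennreal (double_kernel (\<lambda>r. gain r (\<lambda>_. k) u x y) x y) \<partial>lborel)"
proof -
  define a0 where "a0 = a_minus a x0 (4 * R)"
  have a0: "lam \<le> a0" using a_minus_lam[of "4 * R" x0] R by (simp add: a0_def)
  have N0: "0 \<le> N" using N J by (smt (verit) mult_nonneg_nonneg powr_ge_zero)
  define B where "B = {y. y \<notin> ball x0 (2 * R) \<and> 2 * k \<le> u y}"
  have "B = (- ball x0 (2 * R)) \<inter> {y \<in> space borel. 2 * k \<le> u y}" by (auto simp: B_def)
  also have "\<dots> \<in> sets borel" by (intro sets.Int) (auto intro: borel_measurable_le)
  finally have [measurable]: "B \<in> sets borel" .
  define F where "F r \<nu> y = u y powr (r - 1) / norm (y - x0) powr \<nu>" for r \<nu> y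
  have [measurable]: "F r \<nu> \<in> borel_measurable borel" for r \<nu> unfolding F_def by measurable
  have np: "0 \<le> np" "0 \<le> nq" "np \<le> nq" using sp tq sp_tq by (auto simp: np_def nq_def)
  define Ip where "Ip = (\<integral>\<^sup>+ y \<in> B. ennreal (F p np y) \<partial>lborel)"
  define Iq where "Iq = (\<integral>\<^sup>+ y \<in> B. ennreal (F q nq y) \<partial>lborel)"
  have Ip: "ennreal (N / 2 * (k powr (p - 1) / R powr (s * p))) \<le> Ip"
  proof -
    define X where "X = k powr (p - 1) / R powr (s * p)"
    have X: "0 \<le> X" by (simp add: X_def)
    have "ennreal (N * X) \<le> Tail s p (pos_part u) x0 (2 * R)" using Tp by (simp add: X_def)
    also have "\<dots> \<le> Ip + ennreal ((2 * k) powr (p - 1) * (J / R powr (s * p)))"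
      using truncated_tail[OF p np(1), where \<beta> = 0 and m = "J / R powr (s * p)"] mass_p[OF R(1), of x0] J
      by (simp add: Ip_def B_def F_def Tail_def np_def nn_integral_completion)
    also have "(2 * k) powr (p - 1) * (J / R powr (s * p)) = 2 powr (p - 1) * J * X"
      using k by (simp add: X_def powr_mult)
    finally have "ennreal (N * X - 2 powr (p - 1) * J * X) \<le> Ip"
      using X J by (intro ennreal_le_add_cancel) auto
    moreover have "N / 2 * X \<le> N * X - 2 powr (p - 1) * J * X"
    proof -
      have "2 powr (p - 1) * J \<le> 2 powr q * J" using pq J by (intro mult_right_mono) auto
      then have "(2 powr (p - 1) * J) * X \<le> (N / 2) * X" using N X by (intro mult_right_mono) auto
      then show ?thesis by (simp add: algebra_simps)
    qed
    ultimately show ?thesis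
      unfolding X_def[symmetric] by (meson ennreal_leI order_trans)
  qed
  have Iq: "ennreal (N / 2 * (a0 * (k powr (q - 1) / R powr (t * q)))) \<le> ennreal lam * Iq"
  proof -
    define X where "X = k powr (q - 1) / R powr (t * q)"
    have X: "0 \<le> X" by (simp add: X_def)
    have "ennreal (N * (a0 * X)) \<le> ennreal lam * Tail t q (pos_part u) x0 (2 * R)"
      using Tq by (simp add: X_def a0_def)
    also have "\<dots> \<le> ennreal lam * (Iq + ennreal ((2 * k) powr (q - 1) * (J / R powr (t * q))))"
      using truncated_tail[OF q np(2), where \<beta> = \<alpha> and m = "J / R powr (t * q)"] mass_q[OF R(1), of x0] J \<alpha>
      by (intro mult_left_mono) (simp_all add: Iq_def B_def F_def Tail_def nq_def nn_integral_completion)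
    also have "(2 * k) powr (q - 1) * (J / R powr (t * q)) = 2 powr (q - 1) * J * X"
      using k by (simp add: X_def powr_mult)
    also have "ennreal lam * (Iq + ennreal (2 powr (q - 1) * J * X))
        = ennreal lam * Iq + ennreal (lam * (2 powr (q - 1) * J * X))"
      using lam X J by (simp add: distrib_left ennreal_mult)
    finally have "ennreal (N * (a0 * X) - lam * (2 powr (q - 1) * J * X)) \<le> ennreal lam * Iq"
      using X J lam by (intro ennreal_le_add_cancel) auto
    moreover have "N / 2 * (a0 * X) \<le> N * (a0 * X) - lam * (2 powr (q - 1) * J * X)"
    proof -
      have "2 powr (q - 1) * J \<le> 2 powr q * J" using J by (intro mult_right_mono) auto
      then have "(2 powr (q - 1) * J) * X \<le> (N / 2) * X" using N X by (intro mult_right_mono) auto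
      from mult_mono[OF a0 this] have "lam * ((2 powr (q - 1) * J) * X) \<le> a0 * ((N / 2) * X)"
        using X lam J a0 by simp
      then show ?thesis by (simp add: algebra_simps)
    qed
    ultimately show ?thesis
      unfolding X_def[symmetric] by (meson ennreal_leI order_trans)
  qed
  have pointwise: "ennreal (2 * c_gain * k) * (ennreal (F p np y) * indicator B y)
      + ennreal (2 * c_gain * k) * (ennreal lam * (ennreal (F q nq y) * indicator B y))
    \<le> ennreal (double_kernel (\<lambda>r. gain r (\<lambda>_. k) u x y) x y)" for y
  proof (cases "y \<in> B")
    case True
    then have y: "2 * R \<le> norm (y - x0)" "2 * k \<le> u y"
      by (auto simp: B_def dist_norm norm_minus_commute)
    have "norm (x - y) \<le> norm (x - x0) + norm (y - x0)"
      using dist_triangle2[of x y x0] by (simp add: dist_norm)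
    moreover have "norm (x - x0) < 2 * R" using x by (simp add: dist_norm norm_minus_commute)
    ultimately have xy: "norm (x - y) \<le> 2 * norm (y - x0)" using y by simp
    have "x \<noteq> y" using x y k by auto
    then have xy0: "0 < norm (x - y)" by simp
    have y0: "0 < norm (y - x0)" using y R by linarith
    have ux: "0 \<le> u x" using u_nonneg[of x] x R by auto
    have one: "2 * c_gain * k * F r \<nu> y \<le> gain r (\<lambda>_. k) u x y / norm (x - y) powr \<nu>"
      if r: "1 < r" "r \<le> q" and \<nu>: "0 \<le> \<nu>" "\<nu> \<le> nq" for r \<nu>
    proof -
      have "gain r (\<lambda>_. k) u x y = (k - u x) * (u y - u x) powr (r - 1)"
        using y k by (simp add: gain_def)
      also have "\<dots> \<ge> (k / 2) * (u y / 2) powr (r - 1)"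
        using x y k ux r by (intro mult_mono powr_mono2) auto
      finally have g: "(k / 2) * (u y / 2) powr (r - 1) \<le> gain r (\<lambda>_. k) u x y" .
      have "norm (x - y) powr \<nu> \<le> (2 * norm (y - x0)) powr \<nu>"
        using xy \<nu> by (intro powr_mono2) auto
      also have "\<dots> = 2 powr \<nu> * norm (y - x0) powr \<nu>" by (simp add: powr_mult)
      finally have d: "1 / (2 powr \<nu> * norm (y - x0) powr \<nu>) \<le> 1 / norm (x - y) powr \<nu>"
        using xy0 y0 by (intro divide_left_mono mult_pos_pos) auto
      have "2 * c_gain * k * F r \<nu> y = (k * F r \<nu> y) * 2 powr (- q - nq)"
      proof -
        have "2 * c_gain = 2 powr (- q - nq)"
          using powr_add[of 2 1 "- 1 - q - nq"] by (simp add: c_gain_def)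
        then show ?thesis by (simp add: mult_ac)
      qed
      also have "\<dots> \<le> (k * F r \<nu> y) * 2 powr (- r - \<nu>)"
        using r \<nu> k by (intro mult_left_mono) (auto simp: F_def)
      also have "2 powr (- r - \<nu>) = (1/2) * (1 / 2 powr (r - 1)) * (1 / 2 powr \<nu>)"
      proof -
        have "2 powr (- r - \<nu>) = 2 powr (- 1) * 2 powr (- (r - 1)) * 2 powr (- \<nu>)"
          by (simp only: powr_add[symmetric]) simp
        then show ?thesis by (simp only: powr_minus_divide) simp
      qed
      also have "(k * F r \<nu> y) * \<dots> = (k / 2) * (u y / 2) powr (r - 1) * (1 / (2 powr \<nu> * norm (y - x0) powr \<nu>))"
        using y k by (simp add: F_def powr_divide)
      also have "\<dots> \<le> gain r (\<lambda>_. k) u x y * (1 / norm (x - y) powr \<nu>)"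
        using g d k by (intro mult_mono) (auto intro: order_trans[OF _ g])
      finally show ?thesis by simp
    qed
    have F: "0 \<le> F r \<nu> y" for r \<nu> by (simp add: F_def)
    have "2 * c_gain * k * F p np y + 2 * c_gain * k * (lam * F q nq y)
        \<le> double_kernel (\<lambda>r. gain r (\<lambda>_. k) u x y) x y"
    proof -
      have "lam * (2 * c_gain * k * F q nq y) \<le> a x y * (gain q (\<lambda>_. k) u x y / norm (x - y) powr nq)"
        using one[OF q order_refl np(2) order_refl] a_lower[of x y] lam k F c_gain_pos
        by (intro mult_mono) auto
      then show ?thesis
        using one[OF p pq np(1) np(3)] by (simp add: double_kernel_def mult_ac)
    qed
    then have "ennreal (2 * c_gain * k * F p np y + 2 * c_gain * k * (lam * F q nq y))
        \<le> ennreal (double_kernel (\<lambda>r. gain r (\<lambda>_. k) u x y) x y)"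
      by (rule ennreal_leI)
    also have "ennreal (2 * c_gain * k * F p np y + 2 * c_gain * k * (lam * F q nq y))
        = ennreal (2 * c_gain * k) * ennreal (F p np y)
          + ennreal (2 * c_gain * k) * (ennreal lam * ennreal (F q nq y))"
      using F c_gain_pos k lam by (subst ennreal_plus) (auto simp: ennreal_mult)
    finally show ?thesis using True by simp
  qed simp
  have "ennreal (c_gain * N * (k * level x0 R k))
      = ennreal (2 * c_gain * k) * (ennreal (N / 2 * (k powr (p - 1) / R powr (s * p)))
        + ennreal (N / 2 * (a0 * (k powr (q - 1) / R powr (t * q)))))"
    using N0 a0 lam k c_gain_pos
    by (subst ennreal_plus[symmetric], simp, simp, subst ennreal_mult[symmetric])
       (auto simp: level_def a0_def algebra_simps)
  also have "\<dots> \<le> ennreal (2 * c_gain * k) * (Ip + ennreal lam * Iq)"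
    by (intro mult_left_mono add_mono Ip Iq) simp
  also have "\<dots> = (\<integral>\<^sup>+ y. ennreal (2 * c_gain * k) * (ennreal (F p np y) * indicator B y)
      + ennreal (2 * c_gain * k) * (ennreal lam * (ennreal (F q nq y) * indicator B y)) \<partial>lborel)"
    unfolding Ip_def Iq_def
    by (subst nn_integral_add) (auto simp: nn_integral_cmult distrib_left)
  also have "\<dots> \<le> (\<integral>\<^sup>+ y. ennreal (double_kernel (\<lambda>r. gain r (\<lambda>_. k) u x y) x y) \<partial>lborel)"
    by (intro nn_integral_mono pointwise)
  finally show ?thesis .
qed

lemma ball_measure: "0 \<le> r \<Longrightarrow> measure lborel (ball (x::real^'n) r) = \<omega> * r ^ CARD('n)"
  by (simp add: \<omega>_def content_ball)

lemma initial_smallness: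
  assumes N: "tail_factor \<le> N"
    and Tp: "ennreal (N * (k powr (p - 1) / R powr (s * p))) \<le> Tail s p (pos_part u) x0 (2 * R)"
    and Tq: "ennreal (N * (a_minus a x0 (4 * R) * (k powr (q - 1) / R powr (t * q))))
      \<le> ennreal lam * Tail t q (pos_part u) x0 (2 * R)"
  shows "measure lborel {x \<in> ball x0 (2 * R). u x < k / 2} \<le> \<omega> / 2 * (R * \<delta>) ^ CARD('n)"
proof -
  define S where "S = {x \<in> ball x0 (2 * R). u x < k / 2}"
  define H where "H = k * level x0 R k"
  have H: "0 < H" using level_pos[OF R(1) k] k by (simp add: H_def)
  have N': "2 * (2 powr q * J) \<le> N" "4 * \<Lambda>\<^sup>2 * C_cost * 3 ^ CARD('n) / (c_gain * \<delta> ^ CARD('n)) \<le> N"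
    using N by (auto simp: tail_factor_def)
  have N0: "0 < N" using N tail_factor_pos by simp
  have "(c_gain * N * H) * measure lborel S
      \<le> 2 * \<Lambda>\<^sup>2 * C_cost * 1 powr q * (k * level x0 R k) * measure lborel {x \<in> ball x0 (3 * R). u x < k}"
  proof (rule level_set_bound)
    show "S \<subseteq> {x. norm (x - x0) \<le> 3 * R - R / 1 \<and> u x < k}"
      using k by (auto simp: S_def dist_norm norm_minus_commute)
    show "S \<in> sets borel" unfolding S_def by measurable
    show "ennreal (c_gain * N * H) \<le> (\<integral>\<^sup>+ y. ennreal (double_kernel (\<lambda>r. gain r (\<lambda>_. k) u x y) x y) \<partial>lborel)"
      if "x \<in> S" for x
      unfolding H_def using that by (intro tail_gain N' Tp Tq) (auto simp: S_def)
    show "0 \<le> c_gain * N * H" using c_gain_pos N0 H by simp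
  qed (use k in auto)
  also have "\<dots> \<le> 2 * \<Lambda>\<^sup>2 * C_cost * H * (\<omega> * (3 * R) ^ CARD('n))"
  proof -
    have "measure lborel {x \<in> ball x0 (3 * R). u x < k} \<le> measure lborel (ball x0 (3 * R))"
      by (intro measure_mono_fmeasurable) (auto intro!: fmeasurableI emeasure_bounded_finite)
    then show ?thesis
      using H C_cost_pos R by (simp add: H_def ball_measure mult_left_mono)
  qed
  finally have "(c_gain * N * measure lborel S) * H \<le> (2 * \<Lambda>\<^sup>2 * C_cost * (\<omega> * (3 * R) ^ CARD('n))) * H"
    by (simp add: mult_ac)
  then have "c_gain * N * measure lborel S \<le> 2 * \<Lambda>\<^sup>2 * C_cost * (\<omega> * (3 * R) ^ CARD('n))"
    using H by simp
  also have "\<dots> = (4 * \<Lambda>\<^sup>2 * C_cost * 3 ^ CARD('n) / (c_gain * \<delta> ^ CARD('n)))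
      * (c_gain * (\<omega> / 2 * (R * \<delta>) ^ CARD('n)))"
    using c_gain_pos \<delta> by (simp add: power_mult_distrib field_simps)
  also have "\<dots> \<le> N * (c_gain * (\<omega> / 2 * (R * \<delta>) ^ CARD('n)))"
    using N' c_gain_pos \<omega>_pos R \<delta> by (intro mult_right_mono) auto
  finally have "(c_gain * N) * measure lborel S \<le> (c_gain * N) * (\<omega> / 2 * (R * \<delta>) ^ CARD('n))"
    by (simp add: mult_ac)
  then show ?thesis using c_gain_pos N0 by (simp add: S_def)
qed

section \<open>De Giorgi iteration\<close>
definition rad :: "nat \<Rightarrow> real" where "rad j = R * (1 + (1/2) ^ j)"
definition lev :: "nat \<Rightarrow> real" where "lev j = k / 4 * (1 + (1/2) ^ j)"
definition sublevel :: "nat \<Rightarrow> (real^'n) set" where "sublevel j = {x \<in> ball x0 (rad j). u x < lev j}"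

text \<open>
  The measure of \<open>sublevel j\<close> is at most half that of a ball of radius \<open>\<rho>\<close>, so at least half of the ball
  around \<open>x\<close> lies outside it. There \<open>u\<close> exceeds \<open>u x\<close> by at least the difference of consecutive levels, and the kernel is at
  least its value at distance \<open>\<rho>\<close>. This is the nonlinear mechanism of the iteration: the smaller the
  sublevel set, the smaller \<open>\<rho>\<close> may be, and the larger the gain.
\<close>
lemma sublevel_gain:
  assumes \<rho>: "0 < \<rho>" "\<rho> \<le> R * (1/2) ^ (j + 1)"
    and small: "measure lborel (sublevel j) \<le> \<omega> / 2 * \<rho> ^ CARD('n)"
    and x: "x \<in> sublevel (j + 1)"
  shows "ennreal (\<omega> / 2 * ((1/2) ^ (j + 3)) powr q * (R / \<rho>) powr (s * p) * (k * level x0 R k))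
    \<le> (\<integral>\<^sup>+ y. ennreal (double_kernel (\<lambda>r. gain r (\<lambda>_. lev j) u x y) x y) \<partial>lborel)"
proof -
  define a0 where "a0 = a_minus a x0 (4 * R)"
  have a0: "lam \<le> a0" using a_minus_lam[of "4 * R" x0] R by (simp add: a0_def)
  define h where "h = (1/2 :: real) ^ (j + 3)"
  have h: "0 < h" "h \<le> 1" by (auto simp: h_def power_le_one)
  have lev_diff: "lev j - lev (j + 1) = k * h"
    by (simp add: lev_def h_def power_add field_simps)
  have rad_le: "rad j \<le> 2 * R"
    using R power_le_one[of "1/2::real" j] by (simp add: rad_def)
  have rad_diff: "rad (j + 1) + R * (1/2) ^ (j + 1) = rad j"
    by (simp add: rad_def field_simps)
  have \<rho>R: "\<rho> \<le> R"
  proof -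
    have "R * (1/2) ^ (j + 1) \<le> R * 1" using R by (intro mult_left_mono power_le_one) auto
    then show ?thesis using \<rho> by simp
  qed
  have x': "x \<in> ball x0 (rad (j + 1))" "u x < lev (j + 1)" using x by (auto simp: sublevel_def)
  have ball_sub: "ball x \<rho> \<subseteq> ball x0 (rad j)"
  proof
    fix y assume "y \<in> ball x \<rho>"
    then have "dist x0 y < rad (j + 1) + \<rho>"
      using x' dist_triangle[of x0 y x] by simp
    then show "y \<in> ball x0 (rad j)" using \<rho> rad_diff by simp
  qed
  define D where "D = ball x \<rho> - sublevel j"
  have [measurable]: "sublevel j \<in> sets borel" unfolding sublevel_def by measurable
  have [measurable]: "D \<in> sets borel" unfolding D_def by (intro sets.Diff) auto
  have fin: "emeasure lborel D < \<infinity>"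
    by (intro emeasure_bounded_finite bounded_subset[OF bounded_ball[of x \<rho>]]) (auto simp: D_def)
  have D_measure: "\<omega> / 2 * \<rho> ^ CARD('n) \<le> measure lborel D"
  proof -
    have "measure lborel (ball x \<rho>) \<le> measure lborel (D \<union> sublevel j)"
      using fin sublevel_finite[of "rad j" "lev j"]
      by (intro measure_mono_fmeasurable fmeasurable.Un fmeasurableI) (auto simp: D_def sublevel_def)
    also have "\<dots> \<le> measure lborel D + measure lborel (sublevel j)"
      using fin sublevel_finite[of "rad j" "lev j"]
      by (intro measure_Un_le) auto
    finally show ?thesis using small \<rho> by (simp add: ball_measure)
  qed
  define c where "c = (k * h) powr p / \<rho> powr np + a0 * ((k * h) powr q / \<rho> powr nq)"
  have c0: "0 \<le> c" using a0 lam by (simp add: c_def)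
  have pointwise: "c \<le> double_kernel (\<lambda>r. gain r (\<lambda>_. lev j) u x y) x y" if y: "y \<in> D" for y
  proof -
    have y0: "y \<in> ball x0 (rad j)" using y ball_sub by (auto simp: D_def)
    then have uy: "lev j \<le> u y" using y by (auto simp: D_def sublevel_def)
    have "lev (j + 1) < lev j" using lev_diff k h by (smt (verit) mult_pos_pos)
    then have "x \<noteq> y" using uy x' by auto
    then have xy: "0 < norm (x - y)" "norm (x - y) \<le> \<rho>"
      using y by (auto simp: D_def dist_norm)
    have gain: "(k * h) powr r \<le> gain r (\<lambda>_. lev j) u x y" if r: "1 < r" for r
    proof -
      have "k * h \<le> lev j - u x" using lev_diff x' by simp
      moreover have "k * h \<le> u y - u x" using lev_diff x' uy by simp
      moreover have "0 \<le> k * h" using k h by simp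
      moreover from calculation have "0 \<le> lev j - u x" by linarith
      ultimately have "(k * h) * (k * h) powr (r - 1) \<le> (lev j - u x) * (u y - u x) powr (r - 1)"
        using r by (intro mult_mono powr_mono2) auto
      then show ?thesis
        using uy k h powr_mult_base[of "k * h" "r - 1"] by (simp add: gain_def)
    qed
    have quot: "(k * h) powr r / \<rho> powr \<nu> \<le> gain r (\<lambda>_. lev j) u x y / norm (x - y) powr \<nu>"
      if "1 < r" "0 \<le> \<nu>" for r \<nu>
    proof (intro frac_le gain that)
      show "0 \<le> gain r (\<lambda>_. lev j) u x y" using gain[OF that(1)] powr_ge_zero[of "k * h" r] by linarith
      show "norm (x - y) powr \<nu> \<le> \<rho> powr \<nu>" using xy that by (intro powr_mono2) auto
      show "0 < norm (x - y) powr \<nu>" using xy by simp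
    qed
    have "a0 \<le> a x y"
      unfolding a0_def
      using x' y0 rad_le R rad_diff \<rho> by (intro a_minus_le) auto
    then have "a0 * ((k * h) powr q / \<rho> powr nq) \<le> a x y * (gain q (\<lambda>_. lev j) u x y / norm (x - y) powr nq)"
      using quot[OF q, of nq] tq a0 lam by (intro mult_mono) (auto simp: nq_def a_nonneg)
    then show ?thesis
      using quot[OF p, of np] sp by (simp add: double_kernel_def c_def np_def)
  qed
  have "\<omega> / 2 * h powr q * (R / \<rho>) powr (s * p) * (k * level x0 R k) \<le> c * (\<omega> / 2 * \<rho> ^ CARD('n))"
  proof -
    \<comment> \<open>As \<open>h \<le> 1\<close> and \<open>R / \<rho> \<ge> 1\<close>, the exponents \<open>q\<close> and \<open>s * p\<close> serve both phases.\<close>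
    have phase: "h powr q * (R / \<rho>) powr (s * p) * (k powr r / R powr \<sigma>)
        \<le> (k * h) powr r / \<rho> powr (real CARD('n) + \<sigma>) * \<rho> ^ CARD('n)"
      if "r \<le> q" "s * p \<le> \<sigma>" for r \<sigma>
    proof -
      have "h powr q * (R / \<rho>) powr (s * p) \<le> h powr r * (R / \<rho>) powr \<sigma>"
        using that h \<rho> \<rho>R R by (intro mult_mono powr_mono' powr_mono) auto
      then have "h powr q * (R / \<rho>) powr (s * p) * (k powr r / R powr \<sigma>)
          \<le> h powr r * (R / \<rho>) powr \<sigma> * (k powr r / R powr \<sigma>)"
        by (intro mult_right_mono) auto
      also have "\<dots> = (k * h) powr r / \<rho> powr (real CARD('n) + \<sigma>) * \<rho> ^ CARD('n)"
        using h k \<rho> R by (simp add: powr_mult powr_divide powr_add powr_realpow)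
      finally show ?thesis .
    qed
    have P: "h powr q * (R / \<rho>) powr (s * p) * (k powr p / R powr (s * p))
        \<le> (k * h) powr p / \<rho> powr np * \<rho> ^ CARD('n)"
      unfolding np_def using pq by (intro phase) auto
    have Q: "h powr q * (R / \<rho>) powr (s * p) * (k powr q / R powr (t * q))
        \<le> (k * h) powr q / \<rho> powr nq * \<rho> ^ CARD('n)"
      unfolding nq_def using sp_tq by (intro phase) auto
    have "h powr q * (R / \<rho>) powr (s * p) * (k * level x0 R k) \<le> c * \<rho> ^ CARD('n)"
      using add_mono[OF P mult_left_mono[OF Q, of a0]] a0 lam level_times[of k x0 R] k
      unfolding c_def a0_def[symmetric] by (simp add: algebra_simps)
    then have "(\<omega> / 2) * (h powr q * (R / \<rho>) powr (s * p) * (k * level x0 R k)) \<le> (\<omega> / 2) * (c * \<rho> ^ CARD('n))"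
      using \<omega>_pos by (intro mult_left_mono) auto
    then show ?thesis by (simp add: mult_ac)
  qed
  also have "\<dots> \<le> c * measure lborel D"
    by (intro mult_left_mono D_measure c0)
  finally have "ennreal (\<omega> / 2 * h powr q * (R / \<rho>) powr (s * p) * (k * level x0 R k)) \<le> ennreal (c * measure lborel D)"
    by (rule ennreal_leI)
  also have "\<dots> = (\<integral>\<^sup>+ y. ennreal c * indicator D y \<partial>lborel)"
    using fin c0 by (simp add: nn_integral_cmult_indicator emeasure_eq_ennreal_measure ennreal_mult)
  also have "\<dots> \<le> (\<integral>\<^sup>+ y. ennreal (double_kernel (\<lambda>r. gain r (\<lambda>_. lev j) u x y) x y) \<partial>lborel)"
    using pointwise by (intro nn_integral_mono) (auto simp: indicator_def intro!: ennreal_leI)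
  finally show ?thesis unfolding h_def .
qed

text \<open>
  Gain and cost of one step are both proportional to \<open>k h(k)\<close>, which cancels. The cutoff between
  consecutive radii has steepness \<open>2 ^ (j + 1)\<close>, and the levels differ by \<open>k / 2 ^ (j + 3)\<close>; together
  they account for the factor \<open>4 powr (q * j)\<close>.
\<close>
lemma sublevel_step:
  assumes \<rho>: "0 < \<rho>" "\<rho> \<le> R * (1/2) ^ (j + 1)"
    and small: "measure lborel (sublevel j) \<le> \<omega> / 2 * \<rho> ^ CARD('n)"
  shows "measure lborel (sublevel (j + 1))
    \<le> C_step * (4 powr q) ^ j * (\<rho> / R) powr (s * p) * measure lborel (sublevel j)"
proof -
  define H where "H = k * level x0 R k"
  have H: "0 < H" using level_pos[OF R(1) k] k by (simp add: H_def)
  define G where "G = \<omega> / 2 * ((1/2) ^ (j + 3)) powr q * (R / \<rho>) powr (s * p)"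
  have G: "0 < G" using \<omega>_pos R \<rho> by (simp add: G_def)
  define L where "L = (2::real) ^ (j + 1)"
  have "(G * H) * measure lborel (sublevel (j + 1))
      \<le> 2 * \<Lambda>\<^sup>2 * C_cost * L powr q * (k * level x0 R k) * measure lborel {x \<in> ball x0 (rad j). u x < lev j}"
  proof (rule level_set_bound)
    show "0 < lev j" using k by (simp add: lev_def add_pos_pos)
    show "lev j \<le> k" using k power_le_one[of "1/2::real" j] by (simp add: lev_def)
    show "1 \<le> L" unfolding L_def by (intro one_le_power) simp
    show "rad j \<le> 3 * R" using R power_le_one[of "1/2::real" j] by (simp add: rad_def)
    have "lev (j + 1) \<le> lev j" using k by (simp add: lev_def)
    moreover have "rad j - R / L = rad (j + 1)" by (simp add: rad_def L_def field_simps)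
    ultimately show "sublevel (j + 1) \<subseteq> {x. norm (x - x0) \<le> rad j - R / L \<and> u x < lev j}"
      by (auto simp: sublevel_def dist_norm norm_minus_commute)
    show "sublevel (j + 1) \<in> sets borel" unfolding sublevel_def by measurable
    show "0 \<le> G * H" using G H by simp
    show "ennreal (G * H) \<le> (\<integral>\<^sup>+ y. ennreal (double_kernel (\<lambda>r. gain r (\<lambda>_. lev j) u x y) x y) \<partial>lborel)"
      if "x \<in> sublevel (j + 1)" for x
      using sublevel_gain[OF assms that] by (simp add: G_def H_def)
  qed
  then have "(G * measure lborel (sublevel (j + 1))) * H
      \<le> (2 * \<Lambda>\<^sup>2 * C_cost * L powr q * measure lborel (sublevel j)) * H"
    by (simp add: H_def sublevel_def mult_ac)
  then have le: "G * measure lborel (sublevel (j + 1)) \<le> 2 * \<Lambda>\<^sup>2 * C_cost * L powr q * measure lborel (sublevel j)"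
    using H by simp
  have id: "2 * \<Lambda>\<^sup>2 * C_cost * L powr q = G * (C_step * (4 powr q) ^ j * (\<rho> / R) powr (s * p))"
  proof -
    have "(R / \<rho>) powr (s * p) * (\<rho> / R) powr (s * p) = 1"
      using R \<rho> by (simp add: powr_mult[symmetric])
    moreover have "((1/2) ^ (j + 3)) powr q * (2 powr (4 * q) * (4 powr q) ^ j) = L powr q"
    proof -
      have "(4 powr q) ^ j = (4 ^ j) powr q"
        by (simp add: power_powr_swap)
      moreover have "2 powr (4 * q) = (2 ^ 4 :: real) powr q"
        using powr_powr[of 2 4 q] by simp
      ultimately have "((1/2) ^ (j + 3)) powr q * (2 powr (4 * q) * (4 powr q) ^ j)
          = ((1/2) ^ (j + 3) * (2 ^ 4 * 4 ^ j)) powr q"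
        by (simp add: powr_mult)
      also have "(1/2) ^ (j + 3) * (2 ^ 4 * 4 ^ j) = L"
      proof -
        have "(4::real) ^ j = 2 ^ j * 2 ^ j" by (simp flip: power_mult_distrib)
        then show ?thesis by (simp add: L_def power_add power_one_over field_simps)
      qed
      finally show ?thesis .
    qed
    moreover have "G * (C_step * (4 powr q) ^ j * (\<rho> / R) powr (s * p))
        = 2 * \<Lambda>\<^sup>2 * C_cost * (((1/2) ^ (j + 3)) powr q * (2 powr (4 * q) * (4 powr q) ^ j))
          * ((R / \<rho>) powr (s * p) * (\<rho> / R) powr (s * p))"
      using \<omega>_pos by (simp add: G_def C_step_def)
    ultimately show ?thesis by simp
  qed
  show ?thesis using le G unfolding id by (simp add: mult.assoc)
qed

lemma sublevel_decay:
  assumes "measure lborel {x \<in> ball x0 (2 * R). u x < k / 2} \<le> \<omega> / 2 * (R * \<delta>) ^ CARD('n)"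
  shows "measure lborel (sublevel j) \<le> \<omega> / 2 * (R * \<delta> * \<theta> ^ j) ^ CARD('n)"
proof (induction j)
  case 0
  then show ?case using assms by (simp add: sublevel_def rad_def lev_def mult.commute)
next
  case (Suc j)
  define \<rho> where "\<rho> = R * \<delta> * \<theta> ^ j"
  have \<rho>: "0 < \<rho>" using R \<delta> \<theta> by (simp add: \<rho>_def)
  have "\<rho> \<le> R * (1/2) * (1/2) ^ j"
    unfolding \<rho>_def using R \<delta> \<theta> by (intro mult_mono power_mono) auto
  then have \<rho>_le: "\<rho> \<le> R * (1/2) ^ (j + 1)" by simp
  have "measure lborel (sublevel (j + 1))
      \<le> C_step * (4 powr q) ^ j * (\<rho> / R) powr (s * p) * measure lborel (sublevel j)"
    using \<rho> \<rho>_le Suc.IH unfolding \<rho>_def by (rule sublevel_step)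
  also have "(\<rho> / R) powr (s * p) = \<delta> powr (s * p) * ((1/4) powr q) ^ j"
  proof -
    have "(\<rho> / R) powr (s * p) = \<delta> powr (s * p) * (\<theta> ^ j) powr (s * p)"
      using R \<delta> \<theta> by (simp add: \<rho>_def powr_mult)
    also have "(\<theta> ^ j) powr (s * p) = (\<theta> powr (s * p)) ^ j"
      using \<theta> by (simp add: power_powr_swap)
    finally show ?thesis by (simp add: \<theta>)
  qed
  also have "C_step * (4 powr q) ^ j * (\<delta> powr (s * p) * ((1/4) powr q) ^ j) * measure lborel (sublevel j)
      = (C_step * \<delta> powr (s * p)) * measure lborel (sublevel j)"
  proof -
    have "(4 powr q) ^ j * ((1/4) powr q) ^ j = (1::real)"
      by (simp flip: power_mult_distrib powr_mult)
    then show ?thesis by (simp add: mult_ac)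
  qed
  also have "\<dots> \<le> \<theta> ^ CARD('n) * (\<omega> / 2 * (R * \<delta> * \<theta> ^ j) ^ CARD('n))"
    using \<delta> \<theta> Suc.IH by (intro mult_mono) auto
  also have "\<dots> = \<omega> / 2 * (R * \<delta> * \<theta> ^ Suc j) ^ CARD('n)"
    by (simp add: power_mult_distrib mult_ac)
  finally show ?case by simp
qed

lemma lower_bound_AE:
  assumes "measure lborel {x \<in> ball x0 (2 * R). u x < k / 2} \<le> \<omega> / 2 * (R * \<delta>) ^ CARD('n)"
  shows "AE x in lborel. x \<in> ball x0 R \<longrightarrow> k / 4 \<le> u x"
proof -
  define Z where "Z = {x \<in> ball x0 R. u x < k / 4}"
  have Z_le: "measure lborel Z \<le> \<omega> / 2 * (R * \<delta> * \<theta> ^ j) ^ CARD('n)" for j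
  proof -
    have "R \<le> rad j" "k / 4 \<le> lev j"
      using R k by (simp_all add: rad_def lev_def distrib_left)
    then have "Z \<subseteq> sublevel j" by (auto simp: Z_def sublevel_def)
    then have "measure lborel Z \<le> measure lborel (sublevel j)"
      using sublevel_finite by (intro measure_mono_fmeasurable fmeasurableI) (auto simp: Z_def sublevel_def)
    with sublevel_decay[OF assms, of j] show ?thesis by simp
  qed
  have "(\<lambda>j. \<omega> / 2 * (R * \<delta> * \<theta> ^ j) ^ CARD('n)) \<longlonglongrightarrow> \<omega> / 2 * (R * \<delta> * 0) ^ CARD('n)"
    using \<theta> by (intro tendsto_intros LIMSEQ_realpow_zero) auto
  then have "measure lborel Z \<le> \<omega> / 2 * (R * \<delta> * 0) ^ CARD('n)"
    using Z_le by (intro LIMSEQ_le_const) auto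
  then have "measure lborel Z = 0" by (simp add: zero_power measure_le_0_iff)
  then have "Z \<in> null_sets lborel"
    using sublevel_finite[of R "k / 4"] by (auto simp: Z_def emeasure_eq_ennreal_measure intro!: null_setsI)
  then have "AE x in lborel. x \<notin> Z" by (rule AE_not_in)
  then show ?thesis by (rule AE_mp) (auto simp: Z_def)
qed

lemma lower_bound_from_tails:
  assumes "tail_factor \<le> N"
    and "ennreal (N * (k powr (p - 1) / R powr (s * p))) \<le> Tail s p (pos_part u) x0 (2 * R)"
    and "ennreal (N * (a_minus a x0 (4 * R) * (k powr (q - 1) / R powr (t * q))))
      \<le> ennreal lam * Tail t q (pos_part u) x0 (2 * R)"
  shows "AE x in lborel. x \<in> ball x0 R \<longrightarrow> k / 4 \<le> u x"
  using assms by (intro lower_bound_AE initial_smallness)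

end

section \<open>Modification on null sets\<close>
lemma AE_lebesgue_pair:
  fixes P :: "real^'n::finite \<Rightarrow> bool"
  assumes "AE x in lborel. P x"
  shows "AE z in (lebesgue :: ((real^'n) \<times> (real^'n)) measure). P (fst z) \<and> P (snd z)"
proof -
  obtain N where N: "N \<in> null_sets lborel" "{x. \<not> P x} \<subseteq> N"
    using assms unfolding eventually_ae_filter by auto
  have "emeasure (lborel \<Otimes>\<^sub>M lborel) (N \<times> (UNIV :: (real^'n) set)) = 0"
    "emeasure (lborel \<Otimes>\<^sub>M lborel) ((UNIV :: (real^'n) set) \<times> N) = 0"
    using N(1) lborel.emeasure_pair_measure_Times[of N lborel "UNIV :: (real^'n) set"]
      lborel.emeasure_pair_measure_Times[of "UNIV :: (real^'n) set" lborel N]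
    by (auto simp: null_sets_def)
  then have "N \<times> (UNIV :: (real^'n) set) \<in> null_sets (lborel \<Otimes>\<^sub>M lborel)"
    "(UNIV :: (real^'n) set) \<times> N \<in> null_sets (lborel \<Otimes>\<^sub>M lborel)"
    using N by (auto intro!: null_setsI)
  then have "N \<times> UNIV \<union> UNIV \<times> N \<in> null_sets (lborel \<Otimes>\<^sub>M lborel)"
    by (rule null_sets.Un)
  then have "AE z in lborel \<Otimes>\<^sub>M lborel. P (fst z) \<and> P (snd z)"
    using N(2) by (intro AE_I') auto
  then have "AE z in lborel. P (fst z) \<and> P (snd z)" unfolding lborel_prod .
  then show ?thesis by (rule AE_completion)
qed

lemma energy_cong_AE:
  assumes "AE x in lborel. u x = u' x"
  shows "energy p q Ksp Ktq a u \<Omega> = energy p q Ksp Ktq a u' \<Omega>"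
  unfolding energy_def
  by (intro nn_integral_cong_AE, rule AE_mp[OF AE_lebesgue_pair[OF assms]])
    (auto simp: case_prod_unfold)

lemma A_space_cong_AE:
  assumes "AE x in lborel. u x = u' x" and u': "u' \<in> borel_measurable lebesgue"
    and u: "u \<in> A_space s t p q a \<Omega>"
  shows "u' \<in> A_space s t p q a \<Omega>"
proof -
  have "(\<integral>\<^sup>+ x \<in> \<Omega>. ennreal (\<bar>u' x\<bar> powr p) \<partial>lebesgue) = (\<integral>\<^sup>+ x \<in> \<Omega>. ennreal (\<bar>u x\<bar> powr p) \<partial>lebesgue)"
    by (intro nn_integral_cong_AE, rule AE_mp[OF AE_completion[OF assms(1)]]) auto
  moreover have "(\<integral>\<^sup>+ z \<in> C_set \<Omega>. (case z of (x, y) \<Rightarrow>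
            ennreal (\<bar>u' x - u' y\<bar> powr p / norm (x - y) powr (real CARD('a) + s * p)
              + a x y * (\<bar>u' x - u' y\<bar> powr q / norm (x - y) powr (real CARD('a) + t * q)))) \<partial>lebesgue)
      = (\<integral>\<^sup>+ z \<in> C_set \<Omega>. (case z of (x, y) \<Rightarrow>
            ennreal (\<bar>u x - u y\<bar> powr p / norm (x - y) powr (real CARD('a) + s * p)
              + a x y * (\<bar>u x - u y\<bar> powr q / norm (x - y) powr (real CARD('a) + t * q)))) \<partial>lebesgue)"
    by (intro nn_integral_cong_AE, rule AE_mp[OF AE_lebesgue_pair[OF assms(1)]])
      (auto simp: case_prod_unfold)
  ultimately show ?thesis using u u' by (simp add: A_space_def)
qed

lemma is_minimizer_cong_AE:
  assumes eq: "AE x in lborel. u x = u' x" and u': "u' \<in> borel_measurable lebesgue"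
    and u: "is_minimizer s t p q Ksp Ktq a \<Omega> u"
  shows "is_minimizer s t p q Ksp Ktq a \<Omega> u'"
  unfolding is_minimizer_def
proof (intro conjI ballI impI)
  show "u' \<in> A_space s t p q a \<Omega>"
    using u by (intro A_space_cong_AE[OF eq u']) (simp add: is_minimizer_def)
  fix v assume v: "v \<in> A_space s t p q a \<Omega>" "AE x in lebesgue. x \<notin> \<Omega> \<longrightarrow> v x = u' x"
  have "AE x in lebesgue. x \<notin> \<Omega> \<longrightarrow> v x = u x"
    using v(2) AE_completion[OF eq] by eventually_elim auto
  then show "energy p q Ksp Ktq a u' \<Omega> \<le> energy p q Ksp Ktq a v \<Omega>"
    using u v(1) by (simp add: is_minimizer_def energy_cong_AE[OF eq, symmetric])
qed

lemma Tail_cong_AE: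
  assumes "AE x in lborel. w x = w' x"
  shows "Tail s p w x0 r = Tail s p w' x0 r"
  unfolding Tail_def
  by (intro nn_integral_cong_AE, rule AE_mp[OF AE_completion[OF assms]]) auto

lemma Tail_a_cong_AE:
  assumes "AE x in lborel. w x = w' x"
  shows "Tail_a t q a w x0 r = Tail_a t q a w' x0 r"
  unfolding Tail_a_def
  by (intro SUP_cong refl nn_integral_cong_AE, rule AE_mp[OF AE_completion[OF assms]]) auto

lemma essinf_on_ge:
  assumes [measurable]: "u \<in> borel_measurable lebesgue" and D: "D \<in> sets lebesgue"
    and ge: "AE x in lborel. x \<in> D \<longrightarrow> c \<le> u x"
  shows "ereal c \<le> essinf_on D u"
proof -
  have "(\<lambda>x. - ereal (u x)) \<in> borel_measurable (lebesgue_on D)"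
    by (intro measurable_restrict_space1) measurable
  moreover have "AE x in lebesgue_on D. - ereal (u x) \<le> - ereal c"
    using AE_completion[OF ge] D by (subst AE_restrict_space_iff) (auto elim!: eventually_mono)
  ultimately have "esssup (lebesgue_on D) (\<lambda>x. - ereal (u x)) \<le> - ereal c"
    by (rule esssup_I)
  then have "- (- ereal c) \<le> - esssup (lebesgue_on D) (\<lambda>x. - ereal (u x))"
    by (simp only: ereal_minus_le_minus)
  then show ?thesis by (simp add: essinf_on_def)
qed

section \<open>Tails, the inverse of h, and the final constant\<close>
lemma far_weight:
  fixes x x0 :: "'a::real_normed_vector"
  assumes r: "0 < r" "r \<le> norm (x - x0)" and \<nu>: "0 \<le> \<nu>"
  shows "1 / norm (x - x0) powr \<nu> \<le> (1 + (1 + norm x0) / r) powr \<nu> / (1 + norm x) powr \<nu>"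
proof -
  have "norm x \<le> norm (x - x0) + norm x0" using norm_triangle_ineq[of "x - x0" x0] by simp
  moreover have "(1 + norm x0) * 1 \<le> (1 + norm x0) * (norm (x - x0) / r)"
    using r by (intro mult_left_mono) auto
  ultimately have "1 + norm x \<le> (1 + (1 + norm x0) / r) * norm (x - x0)"
    by (simp add: algebra_simps)
  then have "(1 + norm x) powr \<nu> \<le> ((1 + (1 + norm x0) / r) * norm (x - x0)) powr \<nu>"
    using \<nu> by (intro powr_mono2) auto
  also have "\<dots> = (1 + (1 + norm x0) / r) powr \<nu> * norm (x - x0) powr \<nu>"
    using r by (simp add: powr_mult)
  finally have le: "(1 + norm x) powr \<nu> \<le> (1 + (1 + norm x0) / r) powr \<nu> * norm (x - x0) powr \<nu>" .
  have "0 < norm (x - x0)" using r by linarith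
  moreover have "0 < 1 + norm x" by (simp add: add_pos_nonneg)
  ultimately have "0 < norm (x - x0) powr \<nu>" "0 < (1 + norm x) powr \<nu>" by simp_all
  with le show ?thesis by (simp add: pos_divide_le_eq pos_le_divide_eq)
qed

text \<open>
  With weight \<open>1\<close> or a slice of the coefficient, this bounds a tail of the negative part by the integral
  in the definition of the corresponding tail space, so that \<open>enn2real\<close> does not destroy it.
\<close>
lemma weighted_tail_le:
  fixes u :: "real^'n::finite \<Rightarrow> real" and W :: "real^'n \<Rightarrow> real"
  assumes r: "0 < r" and \<nu>: "0 \<le> \<nu>" and e: "0 \<le> e" and W: "\<And>x. 0 \<le> W x"
    and meas: "(\<lambda>x. ennreal (W x * (\<bar>u x\<bar> powr e / (1 + norm x) powr \<nu>))) \<in> borel_measurable lebesgue"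
  shows "(\<integral>\<^sup>+ x \<in> - ball x0 r. ennreal (W x * (neg_part u x powr e / norm (x - x0) powr \<nu>)) \<partial>lebesgue)
    \<le> ennreal ((1 + (1 + norm x0) / r) powr \<nu>)
      * (\<integral>\<^sup>+ x. ennreal (W x * (\<bar>u x\<bar> powr e / (1 + norm x) powr \<nu>)) \<partial>lebesgue)"
proof -
  define c where "c = (1 + (1 + norm x0) / r) powr \<nu>"
  have "(\<integral>\<^sup>+ x \<in> - ball x0 r. ennreal (W x * (neg_part u x powr e / norm (x - x0) powr \<nu>)) \<partial>lebesgue)
      \<le> (\<integral>\<^sup>+ x. ennreal c * ennreal (W x * (\<bar>u x\<bar> powr e / (1 + norm x) powr \<nu>)) \<partial>lebesgue)"
  proof (intro nn_integral_mono)
    fix x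
    show "ennreal (W x * (neg_part u x powr e / norm (x - x0) powr \<nu>)) * indicator (- ball x0 r) x
      \<le> ennreal c * ennreal (W x * (\<bar>u x\<bar> powr e / (1 + norm x) powr \<nu>))"
    proof (cases "x \<in> ball x0 r")
      case False
      then have "r \<le> norm (x - x0)" by (simp add: dist_norm norm_minus_commute)
      from far_weight[OF r this \<nu>] have "1 / norm (x - x0) powr \<nu> \<le> c * (1 / (1 + norm x) powr \<nu>)"
        by (simp add: c_def)
      moreover have "neg_part u x powr e \<le> \<bar>u x\<bar> powr e"
        using e by (intro powr_mono2) (auto simp: neg_part_def)
      ultimately have "neg_part u x powr e * (1 / norm (x - x0) powr \<nu>)
          \<le> \<bar>u x\<bar> powr e * (c * (1 / (1 + norm x) powr \<nu>))"
        by (intro mult_mono) auto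
      from mult_left_mono[OF this W[of x]]
      have "W x * (neg_part u x powr e / norm (x - x0) powr \<nu>)
          \<le> c * (W x * (\<bar>u x\<bar> powr e / (1 + norm x) powr \<nu>))"
        by (simp add: mult_ac)
      then have "ennreal (W x * (neg_part u x powr e / norm (x - x0) powr \<nu>))
          \<le> ennreal (c * (W x * (\<bar>u x\<bar> powr e / (1 + norm x) powr \<nu>)))"
        by (rule ennreal_leI)
      also have "\<dots> = ennreal c * ennreal (W x * (\<bar>u x\<bar> powr e / (1 + norm x) powr \<nu>))"
        by (rule ennreal_mult') (simp add: c_def)
      finally show ?thesis using False by simp
    qed simp
  qed
  also have "\<dots> = ennreal c * (\<integral>\<^sup>+ x. ennreal (W x * (\<bar>u x\<bar> powr e / (1 + norm x) powr \<nu>)) \<partial>lebesgue)"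
    by (rule nn_integral_cmult[OF meas])
  finally show ?thesis unfolding c_def .
qed

context double_phase
begin

lemma Tail_neg_finite:
  fixes u :: "real^'n \<Rightarrow> real"
  assumes "u \<in> L_tail_space s p" "0 < r"
  shows "Tail s p (neg_part u) x0 r < \<infinity>"
proof -
  have [measurable]: "u \<in> borel_measurable lebesgue" using assms by (simp add: L_tail_space_def)
  have [measurable]: "(\<lambda>x::real^'n. norm x) \<in> borel_measurable lebesgue"
    by (rule measurable_completion) simp
  have "Tail s p (neg_part u) x0 r
      = (\<integral>\<^sup>+ x \<in> - ball x0 r. ennreal (1 * (neg_part u x powr (p - 1) / norm (x - x0) powr np)) \<partial>lebesgue)"
    by (simp add: Tail_def np_def)
  also have "\<dots> \<le> ennreal ((1 + (1 + norm x0) / r) powr np)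
      * (\<integral>\<^sup>+ x. ennreal (1 * (\<bar>u x\<bar> powr (p - 1) / (1 + norm x) powr np)) \<partial>lebesgue)"
  proof (rule weighted_tail_le)
    show "(\<lambda>x. ennreal (1 * (\<bar>u x\<bar> powr (p - 1) / (1 + norm x) powr np))) \<in> borel_measurable lebesgue"
      by measurable
  qed (use assms sp p in \<open>auto simp: np_def\<close>)
  also have "\<dots> < \<infinity>"
    using assms by (simp add: L_tail_space_def np_def ennreal_mult_less_top)
  finally show ?thesis .
qed

lemma Tail_a_neg_finite:
  assumes u: "u \<in> L_tail_space_coeff t q a \<Omega>" and r: "0 < r" and sub: "ball x0 r \<subseteq> \<Omega>"
  shows "Tail_a t q a (neg_part u) x0 r < \<infinity>"
proof -
  have [measurable]: "u \<in> borel_measurable lebesgue" using u by (simp add: L_tail_space_coeff_def)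
  have [measurable]: "(\<lambda>x::real^'n. norm x) \<in> borel_measurable lebesgue"
    by (rule measurable_completion) simp
  define M where "M = (SUP x\<in>\<Omega>. \<integral>\<^sup>+ y. ennreal (a x y * (\<bar>u y\<bar> powr (q - 1) / (1 + norm y) powr nq)) \<partial>lebesgue)"
  have "Tail_a t q a (neg_part u) x0 r \<le> ennreal ((1 + (1 + norm x0) / r) powr nq) * M"
    unfolding Tail_a_def
  proof (rule SUP_least)
    fix y assume y: "y \<in> ball x0 r"
    have [measurable]: "(\<lambda>x. a y x) \<in> borel_measurable lebesgue"
      by (rule measurable_completion) simp
    have "(\<integral>\<^sup>+ x \<in> - ball x0 r. ennreal (a x y * (neg_part u x powr (q - 1) / norm (x - x0) powr (real CARD('n) + t * q))) \<partial>lebesgue)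
        = (\<integral>\<^sup>+ x \<in> - ball x0 r. ennreal (a y x * (neg_part u x powr (q - 1) / norm (x - x0) powr nq)) \<partial>lebesgue)"
      by (simp add: nq_def a_sym[of _ y])
    also have "\<dots> \<le> ennreal ((1 + (1 + norm x0) / r) powr nq)
        * (\<integral>\<^sup>+ x. ennreal (a y x * (\<bar>u x\<bar> powr (q - 1) / (1 + norm x) powr nq)) \<partial>lebesgue)"
    proof (rule weighted_tail_le)
      show "(\<lambda>x. ennreal (a y x * (\<bar>u x\<bar> powr (q - 1) / (1 + norm x) powr nq))) \<in> borel_measurable lebesgue"
        by measurable
    qed (use r tq q a_nonneg in \<open>auto simp: nq_def\<close>)
    also have "\<dots> \<le> ennreal ((1 + (1 + norm x0) / r) powr nq) * M"
      unfolding M_def using y sub by (intro mult_left_mono SUP_upper) auto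
    finally show "(\<integral>\<^sup>+ x \<in> - ball x0 r. ennreal (a x y * (neg_part u x powr (q - 1) / norm (x - x0) powr (real CARD('n) + t * q))) \<partial>lebesgue)
        \<le> ennreal ((1 + (1 + norm x0) / r) powr nq) * M" .
  qed
  also have "\<dots> < \<infinity>"
    using u by (simp add: L_tail_space_coeff_def M_def nq_def ennreal_mult_less_top)
  finally show ?thesis .
qed

lemma h_fun_strict_mono:
  assumes r: "0 < r" and "0 \<le> x" "x < y"
  shows "h_fun s t p q a x0 r x < h_fun s t p q a x0 r y"
proof -
  have "x powr (p - 1) < y powr (p - 1)" "x powr (q - 1) \<le> y powr (q - 1)"
    using assms p q by (auto intro!: powr_less_mono2 powr_mono2)
  moreover have "0 \<le> a_minus a x0 r" using a_minus_lam[OF r, of x0] lam by simp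
  ultimately show ?thesis
    unfolding h_fun_def using r
    by (intro add_less_le_mono mult_left_mono divide_right_mono divide_strict_right_mono) auto
qed

lemma h_inv_spec:
  assumes r: "0 < r" and T: "0 \<le> T"
  shows "0 \<le> h_inv s t p q a x0 r T" "h_fun s t p q a x0 r (h_inv s t p q a x0 r T) = T"
proof -
  define h where "h = h_fun s t p q a x0 r"
  define K where "K = (T * r powr (s * p)) powr (1 / (p - 1))"
  have K: "0 \<le> K" by (simp add: K_def)
  have "T = K powr (p - 1) / r powr (s * p)"
    using r T p by (simp add: K_def powr_powr)
  also have "\<dots> \<le> h K"
    using a_minus_lam[OF r, of x0] lam by (simp add: h_def h_fun_def)
  finally have hK: "T \<le> h K" .
  have h0: "h 0 = 0" using p q by (simp add: h_def h_fun_def)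
  have cont: "continuous_on {0..K} h"
  proof -
    have pow: "continuous_on {0..K} (\<lambda>x. x powr c)" if "0 < c" for c
      using that by (intro continuous_on_powr' continuous_on_id continuous_on_const) auto
    show ?thesis
      unfolding h_def h_fun_def
      by (intro continuous_on_add continuous_on_mult_left continuous_on_divide continuous_on_const pow)
        (use p q r in auto)
  qed
  have "h 0 \<le> T" using h0 T by simp
  from IVT'[OF this hK K cont] obtain z where z: "0 \<le> z" "h z = T" by blast
  have inj: "inj_on h {0..}"
  proof (rule inj_onI)
    fix x y assume xy: "x \<in> {0..}" "y \<in> {0..}" "h x = h y"
    show "x = y"
      using h_fun_strict_mono[OF r, of x y x0] h_fun_strict_mono[OF r, of y x x0] xy
      unfolding h_def by (cases x y rule: linorder_cases) simp_all
  qed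
  have "h_inv s t p q a x0 r T = z"
    unfolding h_inv_def h_def[symmetric] using z inj
    by (auto intro!: the_inv_into_f_eq)
  then show "0 \<le> h_inv s t p q a x0 r T" "h_fun s t p q a x0 r (h_inv s t p q a x0 r T) = T"
    using z by (simp_all add: h_def)
qed

lemma h_fun_le_level:
  assumes "0 < R" "0 \<le> k"
  shows "h_fun s t p q a x0 (4 * R) k \<le> level x0 R k"
proof -
  have "0 \<le> a_minus a x0 (4 * R)" using a_minus_lam[of "4 * R" x0] assms lam by simp
  moreover have "R powr (s * p) \<le> (4 * R) powr (s * p)" "R powr (t * q) \<le> (4 * R) powr (t * q)"
    using assms sp tq by (auto intro!: powr_mono2)
  ultimately show ?thesis
    unfolding h_fun_def level_def using assms
    by (intro add_mono mult_left_mono divide_left_mono mult_pos_pos) auto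
qed

text \<open>
  The factor that turns the minimum in the theorem into the level \<open>k\<close>: small enough for the
  tails of the positive part to exceed \<open>h(k)\<close> by \<open>tail_factor\<close> in both phases.
\<close>
definition \<gamma>\<^sub>0 :: real where
  "\<gamma>\<^sub>0 = min (1/2) (min ((tail_factor * 2 powr (s * p)) powr (- 1 / (p - 1)))
    ((tail_factor * 2 powr (t * q) / lam) powr (- 1 / (q - 1))))"

lemma \<gamma>\<^sub>0: "0 < \<gamma>\<^sub>0" "\<gamma>\<^sub>0 \<le> 1/2"
    "tail_factor * 2 powr (s * p) * \<gamma>\<^sub>0 powr (p - 1) \<le> 1"
    "tail_factor * 2 powr (t * q) * \<gamma>\<^sub>0 powr (q - 1) \<le> lam"
proof -
  show pos: "0 < \<gamma>\<^sub>0" using tail_factor_pos lam by (simp add: \<gamma>\<^sub>0_def)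
  show "\<gamma>\<^sub>0 \<le> 1/2" by (simp add: \<gamma>\<^sub>0_def)
  have root: "\<gamma>\<^sub>0 powr e * X \<le> 1" if "\<gamma>\<^sub>0 \<le> X powr (- 1 / e)" "0 < e" "0 < X" for e X
  proof -
    have "\<gamma>\<^sub>0 powr e \<le> (X powr (- 1 / e)) powr e"
      using that pos by (intro powr_mono2) auto
    also have "\<dots> = X powr (- 1)" using that by (simp only: powr_powr) simp
    also have "\<dots> = 1 / X" using that by (simp only: powr_minus_divide powr_one less_imp_le)
    finally show ?thesis using that by (simp add: field_simps)
  qed
  show "tail_factor * 2 powr (s * p) * \<gamma>\<^sub>0 powr (p - 1) \<le> 1"
    using root[of "tail_factor * 2 powr (s * p)" "p - 1"] tail_factor_pos p by (simp add: \<gamma>\<^sub>0_def mult_ac)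
  have "\<gamma>\<^sub>0 powr (q - 1) * (tail_factor * 2 powr (t * q) / lam) \<le> 1"
    using tail_factor_pos q lam by (intro root) (auto simp: \<gamma>\<^sub>0_def)
  then show "tail_factor * 2 powr (t * q) * \<gamma>\<^sub>0 powr (q - 1) \<le> lam"
    using lam by (simp add: field_simps)
qed

text \<open>
  This holds for infinite tails as well: \<open>enn2real\<close> can only decrease them.
\<close>
lemma Tail_root_lower:
  assumes R: "0 < R" and e: "1 < e" and \<sigma>: "\<sigma> = s' * e" and m: "0 \<le> m" "m \<le> Tail_root s' e w x0 (2 * R)"
  shows "ennreal (m powr (e - 1) / (2 powr \<sigma> * R powr \<sigma>)) \<le> Tail s' e w x0 (2 * R)"
proof -
  define T where "T = enn2real (Tail s' e w x0 (2 * R))"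
  have T: "0 \<le> T" by (simp add: T_def)
  have "m powr (e - 1) \<le> (((2 * R) powr \<sigma> * T) powr (1 / (e - 1))) powr (e - 1)"
    using m e by (intro powr_mono2) (auto simp: Tail_root_def T_def \<sigma>)
  also have "\<dots> = 2 powr \<sigma> * R powr \<sigma> * T"
    using e T R by (simp add: powr_powr powr_mult)
  finally have "m powr (e - 1) / (2 powr \<sigma> * R powr \<sigma>) \<le> T"
    using R by (simp add: field_simps)
  then have "ennreal (m powr (e - 1) / (2 powr \<sigma> * R powr \<sigma>)) \<le> ennreal T" by (rule ennreal_leI)
  also have "\<dots> \<le> Tail s' e w x0 (2 * R)"
    unfolding T_def by (cases "Tail s' e w x0 (2 * R)") auto
  finally show ?thesis .
qed

text \<open>
  The factor \<open>a_minus powr (- 1 / (q - 1))\<close> in the theorem produces the infimum of the coefficient on the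
  left of the second inequality, in agreement with the \<open>q\<close>-phase of \<open>h\<close>.
\<close>
lemma Tail_lower_bounds:
  assumes R: "0 < R" and m: "0 \<le> m" "m \<le> Tail_root s p w x0 (2 * R)"
      "m \<le> a_minus a x0 (4 * R) powr (- 1 / (q - 1)) * Tail_root t q w x0 (2 * R)"
  shows "ennreal (tail_factor * ((\<gamma>\<^sub>0 * m) powr (p - 1) / R powr (s * p))) \<le> Tail s p w x0 (2 * R)"
    and "ennreal (tail_factor * (a_minus a x0 (4 * R) * ((\<gamma>\<^sub>0 * m) powr (q - 1) / R powr (t * q))))
      \<le> ennreal lam * Tail t q w x0 (2 * R)"
proof -
  define a0 where "a0 = a_minus a x0 (4 * R)"
  have a0: "0 < a0" using a_minus_lam[of "4 * R" x0] R lam by (simp add: a0_def)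
  have "tail_factor * ((\<gamma>\<^sub>0 * m) powr (p - 1) / R powr (s * p))
      = (tail_factor * 2 powr (s * p) * \<gamma>\<^sub>0 powr (p - 1)) * (m powr (p - 1) / (2 powr (s * p) * R powr (s * p)))"
    using \<gamma>\<^sub>0(1) m by (simp add: powr_mult)
  also have "\<dots> \<le> 1 * (m powr (p - 1) / (2 powr (s * p) * R powr (s * p)))"
    by (intro mult_right_mono \<gamma>\<^sub>0) auto
  finally have "ennreal (tail_factor * ((\<gamma>\<^sub>0 * m) powr (p - 1) / R powr (s * p)))
      \<le> ennreal (m powr (p - 1) / (2 powr (s * p) * R powr (s * p)))"
    unfolding mult_1 by (rule ennreal_leI)
  from this Tail_root_lower[OF R p refl m(1,2)]
  show "ennreal (tail_factor * ((\<gamma>\<^sub>0 * m) powr (p - 1) / R powr (s * p))) \<le> Tail s p w x0 (2 * R)"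
    by (rule order_trans)
  define m' where "m' = a0 powr (1 / (q - 1)) * m"
  have m': "0 \<le> m'" "m' powr (q - 1) = a0 * m powr (q - 1)"
    using m a0 q by (simp_all add: m'_def powr_mult powr_powr)
  have "m' \<le> a0 powr (1 / (q - 1)) * (a0 powr (- 1 / (q - 1)) * Tail_root t q w x0 (2 * R))"
    unfolding m'_def using m by (intro mult_left_mono) (auto simp: a0_def)
  also have "\<dots> = Tail_root t q w x0 (2 * R)"
    using a0 by (simp add: mult.assoc[symmetric] powr_add[symmetric])
  finally have m'_le: "m' \<le> Tail_root t q w x0 (2 * R)" .
  define Y where "Y = m' powr (q - 1) / (2 powr (t * q) * R powr (t * q))"
  have Y: "0 \<le> Y" by (simp add: Y_def)
  have "tail_factor * (a0 * ((\<gamma>\<^sub>0 * m) powr (q - 1) / R powr (t * q)))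
      = (tail_factor * 2 powr (t * q) * \<gamma>\<^sub>0 powr (q - 1)) * Y"
    using \<gamma>\<^sub>0(1) m by (simp add: powr_mult Y_def m'(2))
  also have "\<dots> \<le> lam * Y"
    by (intro mult_right_mono \<gamma>\<^sub>0 Y)
  finally have "ennreal (tail_factor * (a0 * ((\<gamma>\<^sub>0 * m) powr (q - 1) / R powr (t * q)))) \<le> ennreal (lam * Y)"
    by (rule ennreal_leI)
  also have "\<dots> = ennreal lam * ennreal Y" using lam Y by (simp add: ennreal_mult)
  also have "\<dots> \<le> ennreal lam * Tail t q w x0 (2 * R)"
    unfolding Y_def by (intro mult_left_mono Tail_root_lower[OF R q refl m'(1) m'_le]) simp
  finally show "ennreal (tail_factor * (a_minus a x0 (4 * R) * ((\<gamma>\<^sub>0 * m) powr (q - 1) / R powr (t * q))))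
      \<le> ennreal lam * Tail t q w x0 (2 * R)"
    unfolding a0_def .
qed

text \<open>
  If \<open>k\<close> is at most \<open>h\<^sup>-\<^sup>1\<close> of the tails of the negative part, nonnegativity of \<open>u\<close> in the ball suffices.
  Otherwise monotonicity of \<open>h\<close> bounds these tails by \<open>h(k)\<close>, and the lower bound \<open>k / 4\<close> holds.
\<close>
lemma weak_harnack:
  assumes \<Omega>: "open \<Omega>" "bounded \<Omega>" "ball x0 (4 * R) \<subseteq> \<Omega>"
    and kernels: "admissible_kernel \<Lambda> (s * p) Ksp" "admissible_kernel \<Lambda> (t * q) Ktq"
    and u: "u \<in> L_tail_space s p" "u \<in> L_tail_space_coeff t q a \<Omega>"
    and minimizer: "is_minimizer s t p q Ksp Ktq a \<Omega> u"
    and R: "0 < R" "R \<le> 1"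
    and nonneg: "AE x in lebesgue. x \<in> ball x0 (4 * R) \<longrightarrow> 0 \<le> u x"
  shows "ereal (\<gamma>\<^sub>0 / 4 * min (Tail_root s p (pos_part u) x0 (2 * R))
             (a_minus a x0 (4 * R) powr (- 1 / (q - 1)) * Tail_root t q (pos_part u) x0 (2 * R)))
    \<le> essinf_on (ball x0 R) u
         + ereal (h_inv s t p q a x0 (4 * R)
             (enn2real (Tail s p (neg_part u) x0 (4 * R) + Tail_a t q a (neg_part u) x0 (4 * R))))"
proof -
  have u_meas: "u \<in> borel_measurable lebesgue" using u by (simp add: L_tail_space_def)
  define T where "T = Tail s p (neg_part u) x0 (4 * R) + Tail_a t q a (neg_part u) x0 (4 * R)"
  have T: "T < \<infinity>"
    using Tail_neg_finite[OF u(1), of "4 * R" x0] Tail_a_neg_finite[OF u(2) _ \<Omega>(3)] R by (simp add: T_def)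
  define z where "z = h_inv s t p q a x0 (4 * R) (enn2real T)"
  have z: "0 \<le> z" "h_fun s t p q a x0 (4 * R) z = enn2real T"
    using h_inv_spec[of "4 * R" "enn2real T" x0] R by (simp_all add: z_def)
  define m where "m = min (Tail_root s p (pos_part u) x0 (2 * R))
    (a_minus a x0 (4 * R) powr (- 1 / (q - 1)) * Tail_root t q (pos_part u) x0 (2 * R))"
  have m: "0 \<le> m" by (simp add: m_def Tail_root_def)
  define k where "k = \<gamma>\<^sub>0 * m"
  have k: "0 \<le> k" using m \<gamma>\<^sub>0 by (simp add: k_def)
  have ball: "ball x0 R \<in> sets lebesgue" by simp
  have "ereal (k / 4) \<le> essinf_on (ball x0 R) u + ereal z"
  proof (cases "k \<le> z")
    case True
    have "AE x in lborel. x \<in> ball x0 R \<longrightarrow> 0 \<le> u x"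
      using nonneg R unfolding AE_completion_iff by (auto elim!: eventually_mono)
    from essinf_on_ge[OF u_meas ball this] have "ereal 0 \<le> essinf_on (ball x0 R) u" .
    moreover have "ereal (k / 4) \<le> ereal z" using True k by simp
    ultimately have "ereal 0 + ereal (k / 4) \<le> essinf_on (ball x0 R) u + ereal z" by (rule add_mono)
    then show ?thesis by simp
  next
    case False
    then have k0: "0 < k" "z < k" using z by auto
    obtain u1 where u1 [measurable]: "u1 \<in> borel_measurable lborel" "AE x in lborel. u x = u1 x"
      using completion_ex_borel_measurable_real[OF u_meas] by auto
    define u' where "u' x = (if x \<in> ball x0 (4 * R) then max (u1 x) 0 else u1 x)" for x
    have [measurable]: "ball x0 (4 * R) \<in> sets borel" by simp
    have u'_meas [measurable]: "u' \<in> borel_measurable borel"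
      using u1(1) unfolding u'_def by measurable
    have eq: "AE x in lborel. u x = u' x"
      using u1(2) nonneg unfolding AE_completion_iff by eventually_elim (auto simp: u'_def)
    have neg_eq: "AE x in lborel. neg_part u x = neg_part u' x"
      and pos_eq: "AE x in lborel. pos_part u x = pos_part u' x"
      using eq by (auto simp: neg_part_def pos_part_def elim!: eventually_mono)
    \<comment> \<open>The data of the problem depend on \<open>u\<close> only up to null sets, so the Borel representative may be used.\<close>
    interpret minimizer_in_ball s t p q \<Lambda> \<alpha> A lam J a u' x0 R \<Omega> Ksp Ktq k
    proof
      show "is_minimizer s t p q Ksp Ktq a \<Omega> u'"
        using measurable_completion[of u' lborel borel]
        by (intro is_minimizer_cong_AE[OF eq _ minimizer]) simp
      have "T = ennreal (h_fun s t p q a x0 (4 * R) z)" using z(2) T by simp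
      also have "\<dots> \<le> ennreal (level x0 R k)"
        using h_fun_strict_mono[of "4 * R" z k x0] h_fun_le_level[of R k x0] R z k0 k
        by (intro ennreal_leI) simp
      finally show "Tail s p (neg_part u') x0 (4 * R) + Tail_a t q a (neg_part u') x0 (4 * R)
          \<le> ennreal (level x0 R k)"
        by (simp add: T_def Tail_cong_AE[OF neg_eq] Tail_a_cong_AE[OF neg_eq])
    qed (use R \<Omega> kernels k0 in \<open>auto simp: u'_def\<close>)
    have "AE x in lborel. x \<in> ball x0 R \<longrightarrow> k / 4 \<le> u' x"
    proof (rule lower_bound_from_tails[OF order_refl])
      show "ennreal (tail_factor * (k powr (p - 1) / R powr (s * p))) \<le> Tail s p (pos_part u') x0 (2 * R)"
        using Tail_lower_bounds(1)[OF R(1) m, of "pos_part u" x0]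
        by (simp add: k_def m_def Tail_cong_AE[OF pos_eq])
      show "ennreal (tail_factor * (a_minus a x0 (4 * R) * (k powr (q - 1) / R powr (t * q))))
          \<le> ennreal lam * Tail t q (pos_part u') x0 (2 * R)"
        using Tail_lower_bounds(2)[OF R(1) m, of "pos_part u" x0]
        by (simp add: k_def m_def Tail_cong_AE[OF pos_eq])
    qed
    then have "AE x in lborel. x \<in> ball x0 R \<longrightarrow> k / 4 \<le> u x"
      using eq by eventually_elim auto
    from essinf_on_ge[OF u_meas ball this] have "ereal (k / 4) \<le> essinf_on (ball x0 R) u" .
    moreover have "ereal 0 \<le> ereal z" using z by simp
    ultimately have "ereal (k / 4) + ereal 0 \<le> essinf_on (ball x0 R) u + ereal z" by (rule add_mono)
    then show ?thesis by simp
  qed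
  then show ?thesis by (simp add: k_def m_def z_def T_def)
qed

end

theorem theorem1p4:
  fixes s t p q \<Lambda> \<alpha> A lam M :: real
  assumes "CARD('n::finite) \<ge> 2"
    and "0 < s" "s \<le> t" "t < 1"
    and "1 < p" "p \<le> q"
    and "\<Lambda> \<ge> 1"
    and "0 < \<alpha>" "\<alpha> \<le> 1" "0 \<le> A"
    and "\<alpha> < t * q" "t * q \<le> s * p + \<alpha>"
    and "lam > 0"
  shows "\<exists>\<gamma>. 0 < \<gamma> \<and> \<gamma> < 1 \<and>
    (\<forall>(\<Omega> :: (real^'n) set) Ksp Ktq a u x0 R.
       open \<Omega> \<and> bounded \<Omega> \<and>
       admissible_kernel \<Lambda> (s * p) Ksp \<and> admissible_kernel \<Lambda> (t * q) Ktq \<and>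
       admissible_coefficient a \<and> holder_coefficient A \<alpha> a \<and> (\<forall>x y. lam \<le> a x y) \<and>
       u \<in> A_space s t p q a \<Omega> \<inter> L_tail_space s p \<inter> L_tail_space_coeff t q a \<Omega> \<and>
       locally_bounded_in \<Omega> u \<and> is_minimizer s t p q Ksp Ktq a \<Omega> u \<and>
       0 < R \<and> R \<le> 1 \<and> ball x0 (4 * R) \<subseteq> \<Omega> \<and>
       (AE x in lebesgue. x \<in> ball x0 (4 * R) \<longrightarrow> 0 \<le> u x) \<and>
       data_entry s p (ball x0 (4 * R)) u M
       \<longrightarrow>
       essinf_on (ball x0 R) u
         + ereal (h_inv s t p q a x0 (4 * R)
             (enn2real (Tail s p (neg_part u) x0 (4 * R) + Tail_a t q a (neg_part u) x0 (4 * R))))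
       \<ge> ereal (\<gamma> * min (Tail_root s p (pos_part u) x0 (2 * R))
             (a_minus a x0 (4 * R) powr (- 1 / (q - 1)) * Tail_root t q (pos_part u) x0 (2 * R))))"
proof -
  have sp: "0 < s * p" "s * p < p" and tq: "0 < t * q" "t * q < q"
    and \<alpha>: "0 \<le> \<alpha>" "\<alpha> < t * q"
    using assms by auto
  obtain Jp where Jp: "0 < Jp" "\<And>(x::real^'n) r. 0 < r \<Longrightarrow>
      (\<integral>\<^sup>+ y. ennreal (max 1 (norm (x - y) / r) powr 0 * min 1 (norm (x - y) / r) powr p
        / norm (x - y) powr (real CARD('n) + s * p)) \<partial>lborel) \<le> ennreal (Jp / r powr (s * p))"
    using radial_mass_scaled[of 0 "s * p" p, where 'n = 'n] sp by blast
  obtain Jq where Jq: "0 < Jq" "\<And>(x::real^'n) r. 0 < r \<Longrightarrow>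
      (\<integral>\<^sup>+ y. ennreal (max 1 (norm (x - y) / r) powr \<alpha> * min 1 (norm (x - y) / r) powr q
        / norm (x - y) powr (real CARD('n) + t * q)) \<partial>lborel) \<le> ennreal (Jq / r powr (t * q))"
    using radial_mass_scaled[of \<alpha> "t * q" q, where 'n = 'n] tq \<alpha> by blast
  define J where "J = max Jp Jq"
  have J: "ennreal (Jp / r) \<le> ennreal (J / r)" "ennreal (Jq / r) \<le> ennreal (J / r)" if "0 \<le> r" for r
    using that by (auto simp: J_def intro!: ennreal_leI divide_right_mono)
  have phase: "double_phase s t p q \<Lambda> \<alpha> A lam J a"
    if "admissible_coefficient a" "holder_coefficient A \<alpha> a" "\<And>x y. lam \<le> a x y"
    for a :: "real^'n \<Rightarrow> real^'n \<Rightarrow> real"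
    using assms that Jp(1) order_trans[OF Jp(2) J(1)] order_trans[OF Jq(2) J(2)]
    by unfold_locales (auto simp: J_def)
  define \<gamma> where "\<gamma> = double_phase.\<gamma>\<^sub>0 TYPE('n) s t p q \<Lambda> A lam J / 4"
  \<comment> \<open>The constant is the same for all coefficients, so its sign can be read off from the constant
    coefficient \<open>lam\<close>.\<close>
  have "double_phase s t p q \<Lambda> \<alpha> A lam J (\<lambda>_ _ :: real^'n. lam)"
    using assms by (intro phase) (auto simp: admissible_coefficient_def holder_coefficient_def)
  from double_phase.\<gamma>\<^sub>0(1,2)[OF this] have "0 < \<gamma>" "\<gamma> < 1"
    by (simp_all add: \<gamma>_def)
  then show ?thesis
    unfolding \<gamma>_def
    by (intro exI[of _ "double_phase.\<gamma>\<^sub>0 TYPE('n) s t p q \<Lambda> A lam J / 4"] conjI allI impI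
        double_phase.weak_harnack[OF phase]) auto
qed

end
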